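(* Let $T>0$, let $b:[0,T]\times\mathbb{R}^d\to\mathbb{R}^d$ be measurable, and suppose there are nonnegative $C_0,C_1\in L^1([0,T])$ such that for all $t\in[0,T]$ and $x,y\in\mathbb{R}^d$, $|b(t,x)|\le C_0(t)(1+|x|)$ and $(b(t,x)-b(t,y))\cdot(x-y)\ge -C_1(t)|x-y|^2$. Let $\phi_{t,s}$ be the flow of $b$ defined in the context. Fix $1\le p<\infty$ and $s\in[0,T)$. Then $$\{(t,x)\mapsto\phi_{t,s}(x)\}\in L^p_{\mathrm{loc}}(\mathbb{R}^d,W^{1,1}([0,T])),$$ and, for a.e. $x\in\mathbb{R}^d$, $[s,T]\ni t\mapsto\phi_{t,s}(x)$ is an absolutely continuous solution of $$\phi_{t,s}(x)=x+\int_s^tb(r,\phi_{r,s}(x))\,dr .$$ If $(b^\varepsilon)_{\varepsilon>0}$ is an admissible regularization of $b$ and $\phi^\varepsilon$ is the corresponding flow, then, for all $R>0$, $$\lim_{\varepsilon\to0}\|\phi^\varepsilon_{\cdot,s}-\phi_{\cdot,s}\|_{L^p(B_R,W^{1,1}([s,T]))}=0 .$$ For all $0\le r\le s\le t\le T$, $\phi_{t,r}=\phi_{t,s}\circ\phi_{s,r}$ a.e.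
   Context: Backward part of the flow: let $\hat b(t,x)$ be the convex hull of all limit points of $b(t,y)$ as $y\to x$. For every $(s,x)$ there is a unique absolutely continuous $[0,s]\ni t\mapsto\phi_{t,s}(x)$ with $\partial_t\phi_{t,s}(x)\in\hat b(t,\phi_{t,s}(x))$ for a.e. $t$ and $\phi_{s,s}(x)=x$; it is Lipschitz in $x$. Forward part of the flow: for $0\le s\le t\le T$ and a.e. $y$, $\phi_{s,t}^{-1}(\{y\})$ is a singleton, whose element is denoted $\phi_{t,s}(y)$; $\phi_{t,s}$ denotes a version of this right inverse that is continuous almost everywhere. These maps satisfy $|\{x:\phi_{t,s}(x)\in A\}|\le C|A|$ for $s\le t$, so compositions $F\circ\phi_{t,s}$ are well defined a.e. for $F$ defined a.e. Admissible regularization: $(b^\varepsilon)_{\varepsilon>0}\subset L^1([0,T],C^{0,1}(\mathbb{R}^d))$ with $b^\varepsilon\to b$ a.e. as $\varepsilon\to0$ and each $b^\varepsilon$ satisfying the same inequalities as $b$ with $C_0,C_1$ independent of $\varepsilon$; $\phi^\varepsilon$ is the classical flow $\partial_t\phi^\varepsilon_{t,s}(x)=b^\varepsilon(t,\phi^\varepsilon_{t,s}(x))$, $\phi^\varepsilon_{s,s}(x)=x$. *)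

theory Defs
  imports "HOL-Analysis.Analysis"
begin

section \<open>Velocity fields\<close>

definition linear_growth :: "real \<Rightarrow> ('a::euclidean_space \<Rightarrow> 'a) \<Rightarrow> bool" where
  "linear_growth c f \<longleftrightarrow> (\<forall>x. norm (f x) \<le> c * (1 + norm x))"

definition lower_one_sided_lipschitz :: "real \<Rightarrow> ('a::euclidean_space \<Rightarrow> 'a) \<Rightarrow> bool" where
  "lower_one_sided_lipschitz c f \<longleftrightarrow>
     (\<forall>x y. (f x - f y) \<bullet> (x - y) \<ge> - c * (norm (x - y))\<^sup>2)"

definition nonneg_L1 :: "real \<Rightarrow> (real \<Rightarrow> real) \<Rightarrow> bool" where
  "nonneg_L1 T C \<longleftrightarrow> set_integrable lebesgue {0..T} C \<and> (\<forall>t\<in>{0..T}. 0 \<le> C t)"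

text \<open>Velocity fields and flows are total functions; nothing is required of them at times
  outside \<open>{0..T}\<close>.\<close>

definition measurable_field :: "real \<Rightarrow> (real \<Rightarrow> 'a::euclidean_space \<Rightarrow> 'a) \<Rightarrow> bool" where
  "measurable_field T b \<longleftrightarrow>
     (\<lambda>(t, x). b t x) \<in> borel_measurable (lebesgue_on ({0..T} \<times> UNIV))"

definition regularized_field :: "(real \<Rightarrow> 'a::euclidean_space \<Rightarrow> 'a) \<Rightarrow> real \<Rightarrow> 'a \<Rightarrow> 'a set" where
  "regularized_field b t x =
     convex hull {z. \<exists>Y. filterlim Y (at x) sequentially \<and> (\<lambda>n. b t (Y n)) \<longlonglongrightarrow> z}"


section \<open>Absolutely continuous functions and flows\<close>

text \<open>The classical \<open>\<epsilon>\<close>-\<open>\<delta>\<close> definition; \<open>\<D>\<close> ranges over the finite families of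
  non-overlapping compact subintervals \<open>{Inf K..Sup K}\<close> of \<open>{a..b}\<close>.\<close>

definition abs_continuous_on :: "real \<Rightarrow> real \<Rightarrow> (real \<Rightarrow> 'b::real_normed_vector) \<Rightarrow> bool" where
  "abs_continuous_on a b f \<longleftrightarrow>
     (\<forall>\<epsilon>>0. \<exists>\<delta>>0. \<forall>\<D>. \<D> division_of \<Union>\<D> \<and> \<Union>\<D> \<subseteq> {a..b} \<and> (\<Sum>K\<in>\<D>. Sup K - Inf K) < \<delta>
        \<longrightarrow> (\<Sum>K\<in>\<D>. norm (f (Sup K) - f (Inf K))) < \<epsilon>)"

text \<open>Throughout, \<open>\<phi> t s x\<close> is the position at time \<open>t\<close> of the point that is at \<open>x\<close> at
  time \<open>s\<close>.\<close>

definition is_backward_flow ::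
    "real \<Rightarrow> (real \<Rightarrow> 'a::euclidean_space \<Rightarrow> 'a) \<Rightarrow> (real \<Rightarrow> real \<Rightarrow> 'a \<Rightarrow> 'a) \<Rightarrow> bool" where
  "is_backward_flow T b \<phi> \<longleftrightarrow>
     (\<forall>s\<in>{0..T}. \<forall>x.
        abs_continuous_on 0 s (\<lambda>t. \<phi> t s x) \<and>
        (AE t in lebesgue_on {0..s}. \<exists>v\<in>regularized_field b t (\<phi> t s x).
           ((\<lambda>t. \<phi> t s x) has_vector_derivative v) (at t within {0..s})) \<and>
        \<phi> s s x = x)"

text \<open>For \<open>s \<le> t\<close>, the value of \<open>\<phi> t s\<close> is prescribed at \<^emph>\<open>every\<close> point over which \<open>\<phi> s t\<close> has
  a singleton fibre, and is free (subject to almost everywhere continuity) on the remaining null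
  set.  Prescribing it only at almost every point, with an exceptional set depending arbitrarily
  on \<open>t\<close>, would say nothing about \<open>t \<mapsto> \<phi> t s x\<close> for a fixed \<open>x\<close>.\<close>

definition is_forward_flow ::
    "real \<Rightarrow> (real \<Rightarrow> real \<Rightarrow> 'a::euclidean_space \<Rightarrow> 'a) \<Rightarrow> bool" where
  "is_forward_flow T \<phi> \<longleftrightarrow>
     (\<forall>s t. 0 \<le> s \<and> s \<le> t \<and> t \<le> T \<longrightarrow>
        (AE y in lebesgue. \<exists>x. \<phi> s t -` {y} = {x}) \<and>
        (\<forall>x y. \<phi> s t -` {y} = {x} \<longrightarrow> \<phi> t s y = x) \<and>
        (AE y in lebesgue. isCont (\<phi> t s) y))"

definition is_flow ::
    "real \<Rightarrow> (real \<Rightarrow> 'a::euclidean_space \<Rightarrow> 'a) \<Rightarrow> (real \<Rightarrow> real \<Rightarrow> 'a \<Rightarrow> 'a) \<Rightarrow> bool" where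
  "is_flow T b \<phi> \<longleftrightarrow> is_backward_flow T b \<phi> \<and> is_forward_flow T \<phi>"

text \<open>The field is only integrable in time, so the equation holds in the sense of
  Caratheodory.\<close>

definition is_classical_flow ::
    "real \<Rightarrow> (real \<Rightarrow> 'a::euclidean_space \<Rightarrow> 'a) \<Rightarrow> (real \<Rightarrow> real \<Rightarrow> 'a \<Rightarrow> 'a) \<Rightarrow> bool" where
  "is_classical_flow T b \<phi> \<longleftrightarrow>
     (\<forall>s\<in>{0..T}. \<forall>x.
        abs_continuous_on 0 T (\<lambda>t. \<phi> t s x) \<and>
        (AE t in lebesgue_on {0..T}.
           ((\<lambda>t. \<phi> t s x) has_vector_derivative b t (\<phi> t s x)) (at t within {0..T})) \<and>
        \<phi> s s x = x)"


section \<open>Admissible regularizations\<close>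

text \<open>\<open>L\<^sup>1([0,T], C\<^sup>0\<^sup>,\<^sup>1)\<close>: jointly measurable fields that are Lipschitz in space, with a Lipschitz
  constant integrable in time.  Boundedness in space is not required, since the fields may grow
  linearly.\<close>

definition L1_lipschitz_field :: "real \<Rightarrow> (real \<Rightarrow> 'a::euclidean_space \<Rightarrow> 'a) \<Rightarrow> bool" where
  "L1_lipschitz_field T b \<longleftrightarrow>
     measurable_field T b \<and>
     (\<exists>L. nonneg_L1 T L \<and> (AE t in lebesgue_on {0..T}. lipschitz_on (L t) UNIV (b t)))"

definition admissible_regularization ::
    "real \<Rightarrow> (real \<Rightarrow> 'a::euclidean_space \<Rightarrow> 'a) \<Rightarrow> (real \<Rightarrow> real \<Rightarrow> 'a \<Rightarrow> 'a) \<Rightarrow> bool" where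
  "admissible_regularization T b b\<epsilon> \<longleftrightarrow>
     (\<forall>\<epsilon>>0. L1_lipschitz_field T (b\<epsilon> \<epsilon>)) \<and>
     (AE z in lebesgue_on ({0..T} \<times> UNIV).
        ((\<lambda>\<epsilon>. b\<epsilon> \<epsilon> (fst z) (snd z)) \<longlongrightarrow> b (fst z) (snd z)) (at_right 0)) \<and>
     (\<exists>C\<^sub>0 C\<^sub>1. nonneg_L1 T C\<^sub>0 \<and> nonneg_L1 T C\<^sub>1 \<and>
        (\<forall>\<epsilon>>0. AE t in lebesgue_on {0..T}.
           linear_growth (C\<^sub>0 t) (b\<epsilon> \<epsilon> t) \<and> lower_one_sided_lipschitz (C\<^sub>1 t) (b\<epsilon> \<epsilon> t)))"


section \<open>The spaces \<open>W\<^sup>1\<^sup>,\<^sup>1([a,b])\<close> and \<open>L\<^sup>p(A, W\<^sup>1\<^sup>,\<^sup>1([a,b]))\<close>\<close>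

definition test_function :: "real \<Rightarrow> real \<Rightarrow> (real \<Rightarrow> real) \<Rightarrow> bool" where
  "test_function a b \<psi> \<longleftrightarrow>
     (\<forall>n. (deriv ^^ n) \<psi> differentiable_on UNIV) \<and>
     compact (closure {t. \<psi> t \<noteq> 0}) \<and> closure {t. \<psi> t \<noteq> 0} \<subseteq> {a<..<b}"

definition has_weak_derivative ::
    "(real \<Rightarrow> 'b::euclidean_space) \<Rightarrow> (real \<Rightarrow> 'b) \<Rightarrow> real \<Rightarrow> real \<Rightarrow> bool" where
  "has_weak_derivative u v a b \<longleftrightarrow>
     set_integrable lebesgue {a..b} v \<and>
     (\<forall>\<psi>. test_function a b \<psi> \<longrightarrow>
        (LINT t:{a..b}|lebesgue. deriv \<psi> t *\<^sub>R u t) = - (LINT t:{a..b}|lebesgue. \<psi> t *\<^sub>R v t))"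

definition W11 :: "real \<Rightarrow> real \<Rightarrow> (real \<Rightarrow> 'b::euclidean_space) set" where
  "W11 a b = {u. set_integrable lebesgue {a..b} u \<and> (\<exists>v. has_weak_derivative u v a b)}"

text \<open>The weak derivative is unique up to null sets.\<close>

definition weak_derivative ::
    "real \<Rightarrow> real \<Rightarrow> (real \<Rightarrow> 'b::euclidean_space) \<Rightarrow> real \<Rightarrow> 'b" where
  "weak_derivative a b u = (SOME v. has_weak_derivative u v a b)"

definition W11_norm :: "real \<Rightarrow> real \<Rightarrow> (real \<Rightarrow> 'b::euclidean_space) \<Rightarrow> ennreal" where
  "W11_norm a b u =
     (if u \<in> W11 a b
      then (\<integral>\<^sup>+t\<in>{a..b}. norm (u t) \<partial>lebesgue) +
           (\<integral>\<^sup>+t\<in>{a..b}. norm (weak_derivative a b u t) \<partial>lebesgue)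
      else \<infinity>)"

text \<open>Bochner measurability: almost everywhere limits, in the norm of \<open>W\<^sup>1\<^sup>,\<^sup>1([a,b])\<close>, of
  measurable functions with finitely many values.\<close>

definition W11_strongly_measurable ::
    "'a::euclidean_space set \<Rightarrow> real \<Rightarrow> real \<Rightarrow> ('a \<Rightarrow> real \<Rightarrow> 'b::euclidean_space) \<Rightarrow> bool" where
  "W11_strongly_measurable A a b u \<longleftrightarrow>
     (\<exists>\<sigma> :: nat \<Rightarrow> 'a \<Rightarrow> real \<Rightarrow> 'b.
        (\<forall>n. finite (\<sigma> n ` A) \<and> \<sigma> n ` A \<subseteq> W11 a b \<and>
             (\<forall>g. {x \<in> A. \<sigma> n x = g} \<in> sets lebesgue)) \<and>
        (AE x in lebesgue_on A. (\<lambda>n. W11_norm a b (\<lambda>t. u x t - \<sigma> n x t)) \<longlonglongrightarrow> 0))"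

definition ennreal_powr :: "ennreal \<Rightarrow> real \<Rightarrow> ennreal" where
  "ennreal_powr c p = (if c = \<infinity> then \<infinity> else ennreal (enn2real c powr p))"

definition LpW11_norm ::
    "real \<Rightarrow> 'a::euclidean_space set \<Rightarrow> real \<Rightarrow> real \<Rightarrow> ('a \<Rightarrow> real \<Rightarrow> 'b::euclidean_space) \<Rightarrow> ennreal"
  where
  "LpW11_norm p A a b u =
     ennreal_powr (\<integral>\<^sup>+x\<in>A. ennreal_powr (W11_norm a b (u x)) p \<partial>lebesgue) (1 / p)"

definition LpW11 ::
    "real \<Rightarrow> 'a::euclidean_space set \<Rightarrow> real \<Rightarrow> real \<Rightarrow> ('a \<Rightarrow> real \<Rightarrow> 'b::euclidean_space) set"
  where
  "LpW11 p A a b = {u. W11_strongly_measurable A a b u \<and> LpW11_norm p A a b u < \<infinity>}"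

definition LpW11_loc ::
    "real \<Rightarrow> real \<Rightarrow> real \<Rightarrow> ('a::euclidean_space \<Rightarrow> real \<Rightarrow> 'b::euclidean_space) set" where
  "LpW11_loc p a b = {u. \<forall>K. compact K \<longrightarrow> u \<in> LpW11 p K a b}"

end

theory Submission
  imports Defs
begin

text \<open>
  For a map with a one-sided lower Lipschitz bound, the values compatible with that bound on a
  countable dense set \<open>D\<close> form a monotone set-valued extension with closed graph. It contains
  \<^const>\<open>regularized_field\<close>, and it is single-valued wherever the map has a limit along \<open>D\<close>, that
  is, almost everywhere. Monotonicity and Gronwall's inequality give uniqueness and stability of
  trajectories that are prescribed at their final time, also under convergence of the fields on
  \<open>D\<close> only.

  For almost every \<open>x\<close> there is exactly one \<open>z\<close> with \<open>\<phi> s T z = x\<close>, and then \<open>\<phi> t s x = \<phi> t T z\<close> for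
  all \<open>t\<close>: forward trajectories are backward trajectories read in the other direction. Since
  \<open>\<phi> s t\<close> is Lipschitz, it maps the null set of discontinuities of \<open>b t\<close> to a null set, so by
  Fubini almost every forward trajectory meets discontinuities only at a null set of times. There
  the velocity is \<open>b t (\<phi> t s x)\<close>, and velocities of approximating trajectories converge pointwise.
\<close>

section \<open>Absolutely continuous functions\<close>

text \<open>Stability runs backwards from a final position, whereas the regularized curves are
  prescribed at time \<open>s\<close>. Compactness closes this gap: their positions at
  \<open>T\<close> stay bounded, and every limit point \<open>\<zeta>\<close> satisfies
  \<open>\<phi> s T \<zeta> = x\<close>, so a one-point fibre leaves a single candidate. Going
  through \<open>T\<close> also yields one null set of starting points valid for all times at once;
  null sets chosen separately for each \<open>t\<close> could not be united. The set
  \<open>D\<close> answers the fact that joint measurability and almost everywhere convergence say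
  nothing about a fixed point \<open>q\<close>. By Fubini almost every \<open>q\<close> is good, and
  countably many good points can be handled together outside one null set of times. The limit points
  in \<open>regularized_field\<close> are taken over punctured neighbourhoods, so
  \<open>b t x\<close> itself need not belong to it; the larger monotone extension contains both,
  which makes them comparable. Velocities are dominated by a multiple of the integrable growth
  constant and the norms of the curves by a constant on each ball. This turns pointwise convergence
  into convergence in time and then in the starting point.\<close>

lemma abs_continuous_onD:
  assumes "abs_continuous_on a b f" "0 < \<epsilon>"
  obtains \<delta> where "0 < \<delta>"
    "\<And>\<D>. \<D> division_of \<Union>\<D> \<Longrightarrow> \<Union>\<D> \<subseteq> {a..b} \<Longrightarrow> (\<Sum>K\<in>\<D>. Sup K - Inf K) < \<delta> \<Longrightarrow>
        (\<Sum>K\<in>\<D>. norm (f (Sup K) - f (Inf K))) < \<epsilon>"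
  using assms(1)[unfolded abs_continuous_on_def, rule_format, OF assms(2)] by blast

lemma division_of_real_interval:
  fixes K :: "real set"
  assumes "\<D> division_of S" "K \<in> \<D>"
  obtains u v where "K = {u..v}" "u \<le> v" "Inf K = u" "Sup K = v" "u \<in> S" "v \<in> S"
proof -
  obtain u v where "K = {u..v}" "K \<noteq> {}" "K \<subseteq> S"
    using division_ofD[OF assms(1)] assms(2) by (metis box_real(2))
  then show ?thesis
    by (intro that[of u v]) auto
qed

lemma abs_continuous_on_cong:
  assumes "\<And>t. t \<in> {a..b} \<Longrightarrow> f t = g t"
  shows "abs_continuous_on a b f \<longleftrightarrow> abs_continuous_on a b g"
proof -
  have *: "(\<Sum>K\<in>\<D>. norm (f (Sup K) - f (Inf K))) = (\<Sum>K\<in>\<D>. norm (g (Sup K) - g (Inf K)))"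
    if D: "\<D> division_of \<Union>\<D>" "\<Union>\<D> \<subseteq> {a..b}" for \<D>
  proof (rule sum.cong[OF refl])
    fix K assume "K \<in> \<D>"
    then obtain u v where "K = {u..v}" "u \<le> v" "Inf K = u" "Sup K = v" "u \<in> \<Union>\<D>" "v \<in> \<Union>\<D>"
      using division_of_real_interval[OF D(1)] by metis
    then show "norm (f (Sup K) - f (Inf K)) = norm (g (Sup K) - g (Inf K))"
      using assms D(2) by (metis subsetD)
  qed
  show ?thesis
    unfolding abs_continuous_on_def by (simp add: * cong: conj_cong imp_cong)
qed

lemma abs_continuous_on_subinterval:
  assumes "abs_continuous_on a b f" "a \<le> c" "d \<le> b"
  shows "abs_continuous_on c d f"
  unfolding abs_continuous_on_def
proof (intro allI impI)
  fix \<epsilon> :: real assume "0 < \<epsilon>"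
  obtain \<delta> where \<delta>: "0 < \<delta>"
    "\<And>\<D>. \<D> division_of \<Union>\<D> \<Longrightarrow> \<Union>\<D> \<subseteq> {a..b} \<Longrightarrow> (\<Sum>K\<in>\<D>. Sup K - Inf K) < \<delta> \<Longrightarrow>
        (\<Sum>K\<in>\<D>. norm (f (Sup K) - f (Inf K))) < \<epsilon>"
    using abs_continuous_onD[OF assms(1) \<open>0 < \<epsilon>\<close>] by blast
  have "{c..d} \<subseteq> {a..b}" using assms by auto
  then show "\<exists>\<delta>>0. \<forall>\<D>. \<D> division_of \<Union>\<D> \<and> \<Union>\<D> \<subseteq> {c..d} \<and> (\<Sum>K\<in>\<D>. Sup K - Inf K) < \<delta>
        \<longrightarrow> (\<Sum>K\<in>\<D>. norm (f (Sup K) - f (Inf K))) < \<epsilon>"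
    using \<delta> by (intro exI[of _ \<delta>]) (meson subset_trans)
qed

lemma abs_continuous_on_imp_continuous_on:
  assumes "abs_continuous_on a b f"
  shows "continuous_on {a..b} f"
  unfolding continuous_on_iff
proof (intro ballI allI impI)
  fix t \<epsilon> :: real assume t: "t \<in> {a..b}" and "0 < \<epsilon>"
  obtain \<delta> where \<delta>: "0 < \<delta>"
    "\<And>\<D>. \<D> division_of \<Union>\<D> \<Longrightarrow> \<Union>\<D> \<subseteq> {a..b} \<Longrightarrow> (\<Sum>K\<in>\<D>. Sup K - Inf K) < \<delta> \<Longrightarrow>
        (\<Sum>K\<in>\<D>. norm (f (Sup K) - f (Inf K))) < \<epsilon>"
    using abs_continuous_onD[OF assms(1) \<open>0 < \<epsilon>\<close>] by blast
  have *: "dist (f u) (f v) < \<epsilon>" if "u \<in> {a..b}" "v \<in> {a..b}" "u \<le> v" "v - u < \<delta>" for u v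
  proof -
    have "{cbox u v} division_of \<Union>{cbox u v}"
      using that by (auto intro!: division_of_self simp del: box_real)
    with \<delta>(2)[of "{{u..v}}"] show ?thesis using that by (auto simp: dist_norm norm_minus_commute)
  qed
  show "\<exists>d>0. \<forall>t'\<in>{a..b}. dist t' t < d \<longrightarrow> dist (f t') (f t) < \<epsilon>"
  proof (intro exI[of _ \<delta>] conjI \<delta> ballI impI)
    fix t' assume "t' \<in> {a..b}" "dist t' t < \<delta>"
    then show "dist (f t') (f t) < \<epsilon>"
      using *[of t t'] *[of t' t] t by (cases "t \<le> t'") (auto simp: dist_real_def dist_commute)
  qed
qed

text \<open>The increment splits as \<open>h (f v - f u) (g v) + h (f u) (g v - g u)\<close>, and
  \<open>f\<close>, \<open>g\<close> are bounded on the compact interval. A general bilinear map is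
  taken because the result serves both the inner product in squared distances and the scaling by a
  test function.\<close>

lemma abs_continuous_on_bilinear:
  fixes f :: "real \<Rightarrow> 'b::real_normed_vector" and g :: "real \<Rightarrow> 'c::real_normed_vector"
    and h :: "'b \<Rightarrow> 'c \<Rightarrow> 'd::real_normed_vector"
  assumes "bounded_bilinear h" and f: "abs_continuous_on a b f" and g: "abs_continuous_on a b g"
  shows "abs_continuous_on a b (\<lambda>t. h (f t) (g t))"
  unfolding abs_continuous_on_def
proof (intro allI impI)
  interpret h: bounded_bilinear h by fact
  fix \<epsilon> :: real assume "0 < \<epsilon>"
  obtain B where B: "0 < B" "\<And>x y. norm (h x y) \<le> norm x * norm y * B"
    using h.pos_bounded by blast
  have "bounded (f ` {a..b})" "bounded (g ` {a..b})"
    using f g by (auto intro!: compact_imp_bounded compact_continuous_image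
        abs_continuous_on_imp_continuous_on)
  then obtain M N where M: "0 < M" "\<And>t. t \<in> {a..b} \<Longrightarrow> norm (f t) \<le> M"
    and N: "0 < N" "\<And>t. t \<in> {a..b} \<Longrightarrow> norm (g t) \<le> N"
    unfolding bounded_pos by fastforce
  \<comment> \<open>Increments of \<open>f\<close> are later multiplied by \<open>N * B\<close> and
    those of \<open>g\<close> by \<open>M * B\<close>, so each contributes half of
    \<open>\<epsilon>\<close>.\<close>
  have posN: "0 < \<epsilon> / (2 * N * B)" and posM: "0 < \<epsilon> / (2 * M * B)"
    using \<open>0 < \<epsilon>\<close> B M N by auto
  obtain \<delta>\<^sub>1 where \<delta>\<^sub>1: "0 < \<delta>\<^sub>1"
    "\<And>\<D>. \<D> division_of \<Union>\<D> \<Longrightarrow> \<Union>\<D> \<subseteq> {a..b} \<Longrightarrow> (\<Sum>K\<in>\<D>. Sup K - Inf K) < \<delta>\<^sub>1 \<Longrightarrow>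
        (\<Sum>K\<in>\<D>. norm (f (Sup K) - f (Inf K))) < \<epsilon> / (2 * N * B)"
    using abs_continuous_onD[OF f posN] by blast
  obtain \<delta>\<^sub>2 where \<delta>\<^sub>2: "0 < \<delta>\<^sub>2"
    "\<And>\<D>. \<D> division_of \<Union>\<D> \<Longrightarrow> \<Union>\<D> \<subseteq> {a..b} \<Longrightarrow> (\<Sum>K\<in>\<D>. Sup K - Inf K) < \<delta>\<^sub>2 \<Longrightarrow>
        (\<Sum>K\<in>\<D>. norm (g (Sup K) - g (Inf K))) < \<epsilon> / (2 * M * B)"
    using abs_continuous_onD[OF g posM] by blast
  show "\<exists>\<delta>>0. \<forall>\<D>. \<D> division_of \<Union>\<D> \<and> \<Union>\<D> \<subseteq> {a..b} \<and> (\<Sum>K\<in>\<D>. Sup K - Inf K) < \<delta> \<longrightarrow>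
      (\<Sum>K\<in>\<D>. norm (h (f (Sup K)) (g (Sup K)) - h (f (Inf K)) (g (Inf K)))) < \<epsilon>"
  proof (intro exI[of _ "min \<delta>\<^sub>1 \<delta>\<^sub>2"] conjI allI impI; (elim conjE)?)
    show "0 < min \<delta>\<^sub>1 \<delta>\<^sub>2" using \<delta>\<^sub>1 \<delta>\<^sub>2 by auto
    fix \<D> assume D: "\<D> division_of \<Union>\<D>" "\<Union>\<D> \<subseteq> {a..b}" "(\<Sum>K\<in>\<D>. Sup K - Inf K) < min \<delta>\<^sub>1 \<delta>\<^sub>2"
    have "(\<Sum>K\<in>\<D>. norm (h (f (Sup K)) (g (Sup K)) - h (f (Inf K)) (g (Inf K))))
        \<le> (\<Sum>K\<in>\<D>. N * B * norm (f (Sup K) - f (Inf K)) + M * B * norm (g (Sup K) - g (Inf K)))"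
    proof (rule sum_mono)
      fix K assume "K \<in> \<D>"
      then obtain u v where K: "K = {u..v}" "Inf K = u" "Sup K = v" "u \<in> \<Union>\<D>" "v \<in> \<Union>\<D>"
        using division_of_real_interval[OF D(1)] by metis
      then have uv: "u \<in> {a..b}" "v \<in> {a..b}" using D(2) by auto
      have "h (f v) (g v) - h (f u) (g u) = h (f v - f u) (g v) + h (f u) (g v - g u)"
        by (simp add: h.diff_left h.diff_right)
      also have "norm \<dots> \<le> norm (f v - f u) * norm (g v) * B + norm (f u) * norm (g v - g u) * B"
        by (intro norm_triangle_le add_mono B)
      also have "\<dots> \<le> norm (f v - f u) * N * B + M * norm (g v - g u) * B"
        using M N uv B by (intro add_mono mult_right_mono mult_left_mono) auto
      finally show "norm (h (f (Sup K)) (g (Sup K)) - h (f (Inf K)) (g (Inf K)))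
          \<le> N * B * norm (f (Sup K) - f (Inf K)) + M * B * norm (g (Sup K) - g (Inf K))"
        using K by (simp add: mult_ac)
    qed
    also have "\<dots> = N * B * (\<Sum>K\<in>\<D>. norm (f (Sup K) - f (Inf K)))
        + M * B * (\<Sum>K\<in>\<D>. norm (g (Sup K) - g (Inf K)))"
      by (simp add: sum.distrib sum_distrib_left)
    also have "\<dots> < N * B * (\<epsilon> / (2 * N * B)) + M * B * (\<epsilon> / (2 * M * B))"
      using \<delta>\<^sub>1(2)[of \<D>] \<delta>\<^sub>2(2)[of \<D>] D M N B
      by (intro add_strict_mono mult_strict_left_mono) auto
    also have "\<dots> = \<epsilon>" using M N B by (simp add: field_simps)
    finally show "(\<Sum>K\<in>\<D>. norm (h (f (Sup K)) (g (Sup K)) - h (f (Inf K)) (g (Inf K)))) < \<epsilon>" .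
  qed
qed

lemma abs_continuous_on_lipschitz:
  fixes f :: "real \<Rightarrow> 'b::real_normed_vector"
  assumes "L-lipschitz_on {a..b} f"
  shows "abs_continuous_on a b f"
  unfolding abs_continuous_on_def
proof (intro allI impI)
  fix \<epsilon> :: real assume "0 < \<epsilon>"
  have L: "0 \<le> L" using assms lipschitz_on_nonneg by blast
  show "\<exists>\<delta>>0. \<forall>\<D>. \<D> division_of \<Union>\<D> \<and> \<Union>\<D> \<subseteq> {a..b} \<and> (\<Sum>K\<in>\<D>. Sup K - Inf K) < \<delta> \<longrightarrow>
      (\<Sum>K\<in>\<D>. norm (f (Sup K) - f (Inf K))) < \<epsilon>"
  proof (intro exI[of _ "\<epsilon> / (L + 1)"] conjI allI impI; (elim conjE)?)
    show "0 < \<epsilon> / (L + 1)" using L \<open>0 < \<epsilon>\<close> by auto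
    fix \<D> assume D: "\<D> division_of \<Union>\<D>" "\<Union>\<D> \<subseteq> {a..b}" "(\<Sum>K\<in>\<D>. Sup K - Inf K) < \<epsilon> / (L + 1)"
    have "(\<Sum>K\<in>\<D>. norm (f (Sup K) - f (Inf K))) \<le> (\<Sum>K\<in>\<D>. L * (Sup K - Inf K))"
    proof (rule sum_mono)
      fix K assume "K \<in> \<D>"
      then obtain u v where K: "K = {u..v}" "Inf K = u" "Sup K = v" "u \<le> v" "u \<in> \<Union>\<D>" "v \<in> \<Union>\<D>"
        using division_of_real_interval[OF D(1)] by metis
      then show "norm (f (Sup K) - f (Inf K)) \<le> L * (Sup K - Inf K)"
        using lipschitz_onD[OF assms, of v u] subsetD[OF D(2)] by (simp add: dist_norm)
    qed
    also have "\<dots> = L * (\<Sum>K\<in>\<D>. Sup K - Inf K)" by (simp add: sum_distrib_left)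
    also have "\<dots> \<le> L * (\<epsilon> / (L + 1))" using D L by (intro mult_left_mono) auto
    also have "\<dots> < \<epsilon>" using L \<open>0 < \<epsilon>\<close> by (simp add: field_simps)
    finally show "(\<Sum>K\<in>\<D>. norm (f (Sup K) - f (Inf K))) < \<epsilon>" .
  qed
qed

lemma abs_continuous_on_diff:
  assumes f: "abs_continuous_on a b f" and g: "abs_continuous_on a b g"
  shows "abs_continuous_on a b (\<lambda>t. f t - g t)"
  unfolding abs_continuous_on_def
proof (intro allI impI)
  fix \<epsilon> :: real assume "0 < \<epsilon>"
  obtain \<delta>\<^sub>1 where \<delta>\<^sub>1: "0 < \<delta>\<^sub>1"
    "\<And>\<D>. \<D> division_of \<Union>\<D> \<Longrightarrow> \<Union>\<D> \<subseteq> {a..b} \<Longrightarrow> (\<Sum>K\<in>\<D>. Sup K - Inf K) < \<delta>\<^sub>1 \<Longrightarrow>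
        (\<Sum>K\<in>\<D>. norm (f (Sup K) - f (Inf K))) < \<epsilon> / 2"
    using abs_continuous_onD[OF f half_gt_zero[OF \<open>0 < \<epsilon>\<close>]] by blast
  obtain \<delta>\<^sub>2 where \<delta>\<^sub>2: "0 < \<delta>\<^sub>2"
    "\<And>\<D>. \<D> division_of \<Union>\<D> \<Longrightarrow> \<Union>\<D> \<subseteq> {a..b} \<Longrightarrow> (\<Sum>K\<in>\<D>. Sup K - Inf K) < \<delta>\<^sub>2 \<Longrightarrow>
        (\<Sum>K\<in>\<D>. norm (g (Sup K) - g (Inf K))) < \<epsilon> / 2"
    using abs_continuous_onD[OF g half_gt_zero[OF \<open>0 < \<epsilon>\<close>]] by blast
  show "\<exists>\<delta>>0. \<forall>\<D>. \<D> division_of \<Union>\<D> \<and> \<Union>\<D> \<subseteq> {a..b} \<and> (\<Sum>K\<in>\<D>. Sup K - Inf K) < \<delta> \<longrightarrow>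
      (\<Sum>K\<in>\<D>. norm (f (Sup K) - g (Sup K) - (f (Inf K) - g (Inf K)))) < \<epsilon>"
  proof (intro exI[of _ "min \<delta>\<^sub>1 \<delta>\<^sub>2"] conjI allI impI; (elim conjE)?)
    show "0 < min \<delta>\<^sub>1 \<delta>\<^sub>2" using \<delta>\<^sub>1 \<delta>\<^sub>2 by auto
    fix \<D> assume D: "\<D> division_of \<Union>\<D>" "\<Union>\<D> \<subseteq> {a..b}" "(\<Sum>K\<in>\<D>. Sup K - Inf K) < min \<delta>\<^sub>1 \<delta>\<^sub>2"
    have "(\<Sum>K\<in>\<D>. norm (f (Sup K) - g (Sup K) - (f (Inf K) - g (Inf K))))
       \<le> (\<Sum>K\<in>\<D>. norm (f (Sup K) - f (Inf K)) + norm (g (Sup K) - g (Inf K)))"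
      by (intro sum_mono) norm
    then show "(\<Sum>K\<in>\<D>. norm (f (Sup K) - g (Sup K) - (f (Inf K) - g (Inf K)))) < \<epsilon>"
      using \<delta>\<^sub>1(2)[of \<D>] \<delta>\<^sub>2(2)[of \<D>] D by (simp add: sum.distrib)
  qed
qed

text \<open>The gauge treats two kinds of tags. Around tags in \<open>N\<close> it is an open set of
  small measure, so absolute continuity makes the increments of \<open>f\<close> over their
  intervals small in total. Around the other tags differentiability gives the straddle estimate. The
  conclusion is a gauge integral; absolute integrability is obtained later, from a growth bound on
  the velocity.\<close>

theorem fundamental_theorem_of_calculus_abs_continuous:
  fixes f :: "real \<Rightarrow> 'b::euclidean_space"
  assumes "a \<le> b" and f: "abs_continuous_on a b f" and N: "negligible N"
    and deriv: "\<And>t. t \<in> {a..b} - N \<Longrightarrow> (f has_vector_derivative f' t) (at t within {a..b})"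
  shows "(f' has_integral (f b - f a)) {a..b}"
proof -
  \<comment> \<open>A zero integrand on \<open>N\<close> removes the uncontrolled values of
    \<open>f'\<close> from the Riemann sums, so that only increments of \<open>f\<close> remain at
    those tags.\<close>
  define g where "g t = (if t \<in> N then 0 else f' t)" for t
  have "(g has_integral (f b - f a)) {a..b}"
    unfolding has_integral_real
  proof (intro allI impI)
    fix e :: real assume "0 < e"
    obtain \<delta> where \<delta>: "0 < \<delta>"
      "\<And>\<D>. \<D> division_of \<Union>\<D> \<Longrightarrow> \<Union>\<D> \<subseteq> {a..b} \<Longrightarrow> (\<Sum>K\<in>\<D>. Sup K - Inf K) < \<delta> \<Longrightarrow>
        (\<Sum>K\<in>\<D>. norm (f (Sup K) - f (Inf K))) < e / 2"
      using abs_continuous_onD[OF f half_gt_zero[OF \<open>0 < e\<close>]] by blast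
    obtain U where U: "open U" "N \<subseteq> U" "U - N \<in> lmeasurable" "emeasure lebesgue (U - N) < ennreal \<delta>"
      using sets_lebesgue_outer_open[OF negligible_imp_sets[OF N] \<delta>(1)] by blast
    have Um: "U \<in> lmeasurable" "measure lebesgue U < \<delta>"
    proof -
      have eq: "U = (U - N) \<union> N" using U by blast
      have "U - N \<union> N \<in> lmeasurable" using U(3) negligible_imp_measurable[OF N] by blast
      with eq show "U \<in> lmeasurable" by simp
      have "measure lebesgue U = measure lebesgue (U - N)"
        using measure_Diff_null_set[of U lebesgue N] N fmeasurableD[OF \<open>U \<in> lmeasurable\<close>]
        by (simp add: negligible_iff_null_sets)
      moreover have "measure lebesgue (U - N) < \<delta>"
        using U(3,4) \<delta>(1) by (metis emeasure_eq_measure2 ennreal_less_iff measure_nonneg)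
      ultimately show "measure lebesgue U < \<delta>" by simp
    qed
    \<comment> \<open>The \<open>+ 1\<close> avoids a division by zero when \<open>a = b\<close> and
      makes the total error strictly smaller than \<open>e / 2\<close>.\<close>
    define c where "c = e / (2 * (b - a + 1))"
    have c: "0 < c" "c * (b - a) < e / 2"
    proof -
      show "0 < c" using \<open>0 < e\<close> \<open>a \<le> b\<close> by (simp add: c_def)
      have "c * (b - a) = (e / 2) * ((b - a) / (b - a + 1))" by (simp add: c_def field_simps)
      also have "\<dots> < (e / 2) * 1"
        using \<open>0 < e\<close> \<open>a \<le> b\<close> by (intro mult_strict_left_mono) auto
      finally show "c * (b - a) < e / 2" by simp
    qed
    have "\<forall>x. \<exists>d>0. x \<in> {a..b} - N \<longrightarrow>
         (\<forall>y\<in>{a..b}. norm (y-x) < d \<longrightarrow> norm (f y - f x - (y-x) *\<^sub>R f' x) \<le> c * norm (y-x))"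
      using deriv[unfolded has_vector_derivative_def has_derivative_within_alt] c by (metis zero_less_one)
    then obtain d where d: "\<And>x. 0 < d x"
      "\<And>x y. \<lbrakk>x \<in> {a..b} - N; y \<in> {a..b}; norm (y-x) < d x\<rbrakk>
          \<Longrightarrow> norm (f y - f x - (y-x) *\<^sub>R f' x) \<le> c * norm (y-x)"
      by metis
    define \<gamma> where "\<gamma> x = (if x \<in> N then U else ball x (d x))" for x
    show "\<exists>\<gamma>. gauge \<gamma> \<and> (\<forall>p. p tagged_division_of {a..b} \<and> \<gamma> fine p \<longrightarrow>
        norm ((\<Sum>(x, k)\<in>p. measure lborel k *\<^sub>R g x) - (f b - f a)) < e)"
    proof (intro exI[of _ \<gamma>] conjI allI impI; (elim conjE)?)
      show "gauge \<gamma>" using U d unfolding gauge_def \<gamma>_def by auto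
      fix p assume p: "p tagged_division_of {a..b}" and fine: "\<gamma> fine p"
      have finp: "finite p" using p by blast
      have ba: "b - a = (\<Sum>(x,K)\<in>p. Sup K - Inf K)" "f b - f a = (\<Sum>(x,K)\<in>p. f(Sup K) - f(Inf K))"
        using additive_tagged_division_1[where f= "\<lambda>x. x"] additive_tagged_division_1[where f= f]
              \<open>a \<le> b\<close> p by auto
      have pK: "\<exists>u v. K = {u..v} \<and> u \<le> v \<and> Inf K = u \<and> Sup K = v \<and> u \<in> {a..b} \<and> v \<in> {a..b} \<and> x \<in> {u..v}
           \<and> {u..v} \<subseteq> \<gamma> x"
        if "(x, K) \<in> p" for x K
      proof -
        have x: "x \<in> K" "K \<subseteq> {a..b}" "\<exists>u v. K = cbox u v" "K \<subseteq> \<gamma> x"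
          using tagged_division_ofD(2-4)[OF p that] fineD[OF fine that] by auto
        then obtain u v where "K = {u..v}" by auto
        with x show ?thesis by (intro exI[of _ u] exI[of _ v]) auto
      qed
      define p1 where "p1 = {q \<in> p. fst q \<in> N}"
      define p2 where "p2 = {q \<in> p. fst q \<notin> N}"
      have pp: "p = p1 \<union> p2" "p1 \<inter> p2 = {}" "p1 \<subseteq> p" "p2 \<subseteq> p" "finite p1" "finite p2"
        using finp by (auto simp: p1_def p2_def)
      let ?h = "\<lambda>(x,K). measure lborel K *\<^sub>R g x - (f (Sup K) - f (Inf K))"
      have "(\<Sum>(x, k)\<in>p. measure lborel k *\<^sub>R g x) - (f b - f a) = (\<Sum>q\<in>p. ?h q)"
        unfolding ba(2) by (simp add: sum_subtractf[symmetric] case_prod_unfold)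
      also have "\<dots> = (\<Sum>q\<in>p1. ?h q) + (\<Sum>q\<in>p2. ?h q)"
        unfolding pp(1) by (rule sum.union_disjoint) (use pp in auto)
      finally have split: "norm ((\<Sum>(x, k)\<in>p. measure lborel k *\<^sub>R g x) - (f b - f a))
          \<le> norm (\<Sum>q\<in>p1. ?h q) + norm (\<Sum>q\<in>p2. ?h q)"
        by (simp only: norm_triangle_ineq)
      have part: "p1 tagged_partial_division_of {a..b}"
        using tagged_partial_division_subset pp(3) p unfolding tagged_division_of_def by blast
      have div: "snd ` p1 division_of \<Union>(snd ` p1)"
        using partial_division_of_tagged_division[OF part] .
      have tdiv: "p1 tagged_division_of \<Union>(snd ` p1)"
        using tagged_partial_division_of_Union_self[OF part] .
      have sub: "\<Union>(snd ` p1) \<subseteq> U" "\<Union>(snd ` p1) \<subseteq> {a..b}"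
      proof -
        have "K \<subseteq> U \<and> K \<subseteq> {a..b}" if "(x, K) \<in> p1" for x K
          using that fineD[OF fine, of x K] tagged_division_ofD(3)[OF p, of x K]
          by (auto simp: p1_def \<gamma>_def)
        then show "\<Union>(snd ` p1) \<subseteq> U" "\<Union>(snd ` p1) \<subseteq> {a..b}" by fastforce+
      qed
      have "(\<Sum>K\<in>snd ` p1. Sup K - Inf K) = (\<Sum>K\<in>snd ` p1. measure lebesgue K)"
        using pK pp(3) by (intro sum.cong refl) (auto dest!: subsetD pK)
      also have "\<dots> = measure lebesgue (\<Union>(snd ` p1))"
        using content_division[OF div] by simp
      also have "\<dots> \<le> measure lebesgue U"
        using sub Um fmeasurableD[OF lmeasurable_division[OF div]] by (intro measure_mono_fmeasurable) auto
      also have "\<dots> < \<delta>" by fact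
      finally have "(\<Sum>K\<in>snd ` p1. norm (f (Sup K) - f (Inf K))) < e / 2"
        using \<delta>(2)[OF div sub(2)] by simp
      moreover have "(\<Sum>K\<in>snd ` p1. norm (f (Sup K) - f (Inf K)))
          = (\<Sum>(x,K)\<in>p1. norm (f (Sup K) - f (Inf K)))"
      proof -
        \<comment> \<open>Passing from tagged pairs to intervals requires a function that vanishes
          on intervals without interior; \<open>Sup\<close> and \<open>Inf\<close> of the empty set
          are unspecified, hence the separate case.\<close>
        define d where "d K = (if K = {} then 0 else norm (f (Sup K) - f (Inf K)))" for K
        have ne: "K \<noteq> {}" if "(x, K) \<in> p1" for x K
          using pK[of x K] that pp(3) by auto
        have "(\<Sum>(x,K)\<in>p1. d K) = (\<Sum>K\<in>snd ` p1. d K)"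
        proof (rule sum.over_tagged_division_lemma[OF tdiv])
          fix u v :: real assume "box u v = {}"
          then show "d (cbox u v) = 0" by (cases "u = v") (auto simp: d_def)
        qed
        moreover have "(\<Sum>(x,K)\<in>p1. d K) = (\<Sum>(x,K)\<in>p1. norm (f (Sup K) - f (Inf K)))"
          using ne by (intro sum.cong refl) (auto simp: d_def)
        moreover have "(\<Sum>K\<in>snd ` p1. d K) = (\<Sum>K\<in>snd ` p1. norm (f (Sup K) - f (Inf K)))"
          using ne by (intro sum.cong refl) (auto simp: d_def)
        ultimately show ?thesis by simp
      qed
      moreover have "norm (\<Sum>q\<in>p1. ?h q) \<le> (\<Sum>(x,K)\<in>p1. norm (f (Sup K) - f (Inf K)))"
        by (intro sum_norm_le) (auto simp: p1_def g_def norm_minus_commute)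
      ultimately have 1: "norm (\<Sum>q\<in>p1. ?h q) < e / 2" by linarith
      have "norm (\<Sum>q\<in>p2. ?h q) \<le> (\<Sum>(x,K)\<in>p2. c * (Sup K - Inf K))"
      proof (rule sum_norm_le, safe)
        fix x K assume xK: "(x, K) \<in> p2"
        then obtain u v where K: "K = {u..v}" "u \<le> v" "Inf K = u" "Sup K = v" "u \<in> {a..b}" "v \<in> {a..b}"
           "x \<in> {u..v}" "{u..v} \<subseteq> \<gamma> x"
          using pK[of x K] pp by blast
        have xN: "x \<notin> N" using xK by (auto simp: p2_def)
        have xab: "x \<in> {a..b} - N" using K xN by auto
        have "u \<in> \<gamma> x" "v \<in> \<gamma> x" using K by auto
        then have dd: "norm (u - x) < d x" "norm (v - x) < d x"
          using xN by (auto simp: \<gamma>_def dist_norm norm_minus_commute)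
        \<comment> \<open>The tag lies between \<open>u\<close> and \<open>v\<close>, so the two
          linearization errors measured from \<open>x\<close> add up to exactly
          \<open>c * (v - u)\<close>.\<close>
        have "norm ((v - u) *\<^sub>R f' x - (f v - f u)) = norm (f u - f x - (u - x) *\<^sub>R f' x - (f v - f x - (v - x) *\<^sub>R f' x))"
          by (auto simp: algebra_simps)
        also have "\<dots> \<le> norm (f u - f x - (u - x) *\<^sub>R f' x) + norm (f v - f x - (v - x) *\<^sub>R f' x)"
          by (rule norm_triangle_ineq4)
        also have "\<dots> \<le> c * norm (u - x) + c * norm (v - x)"
          using d(2)[OF xab K(5) dd(1)] d(2)[OF xab K(6) dd(2)] by linarith
        also have "\<dots> = c * (v - u)" using K by (auto simp: algebra_simps)
        finally show "norm (measure lborel K *\<^sub>R g x - (f (Sup K) - f (Inf K))) \<le> c * (Sup K - Inf K)"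
          using K xN by (simp add: g_def)
      qed
      also have "\<dots> \<le> (\<Sum>(x,K)\<in>p. c * (Sup K - Inf K))"
        using c pp(4) by (intro sum_mono2 finp) (auto dest!: pK)
      also have "\<dots> = c * (b - a)"
        unfolding ba(1) by (simp add: sum_distrib_left case_prod_unfold)
      also have "\<dots> < e / 2" by fact
      finally show "norm ((\<Sum>(x, k)\<in>p. measure lborel k *\<^sub>R g x) - (f b - f a)) < e"
        using 1 split by linarith
    qed
  qed
  then show ?thesis
    by (rule has_integral_spike[OF N, rotated]) (auto simp: g_def)
qed

section \<open>Gronwall's inequality with integrable kernel\<close>

text \<open>The exponential is replaced by doubling. The majorant \<open>U\<close> at most doubles
  across a stretch on which \<open>k\<close> has mass at most 1/2, and \<open>n\<close> such
  stretches exhaust the interval. Only integrability of \<open>k\<close> enters, and no differential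
  inequality has to be integrated.\<close>

lemma gronwall_backward:
  fixes k u :: "real \<Rightarrow> real"
  assumes k: "k integrable_on {a..b}" "\<And>t. t \<in> {a..b} \<Longrightarrow> 0 \<le> k t"
    and u: "\<And>t. t \<in> {a..b} \<Longrightarrow> 0 \<le> u t"
    and ku: "(\<lambda>r. k r * u r) integrable_on {a..b}"
    and le: "\<And>t. t \<in> {a..b} \<Longrightarrow> u t \<le> A + integral {t..b} (\<lambda>r. k r * u r)"
    and n: "integral {a..b} k \<le> real n / 2" and t: "t \<in> {a..b}"
  shows "u t \<le> 2 ^ n * A"
proof -
  define U where "U t = A + integral {t..b} (\<lambda>r. k r * u r)" for t
  define J where "J t = integral {t..b} k" for t
  have ab: "b \<in> {a..b}" using t by auto
  have A: "0 \<le> A" using u[OF ab] le[OF ab] by simp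
  have ints: "k integrable_on {c..d}" "(\<lambda>r. k r * u r) integrable_on {c..d}" if "a \<le> c" "d \<le> b" for c d
    using integrable_on_subinterval k(1) ku that by (metis atLeastatMost_subset_iff)+
  have J0: "0 \<le> J t" if "t \<in> {a..b}" for t
    unfolding J_def using that k by (intro integral_nonneg ints) auto
  have U0: "0 \<le> U t" if "t \<in> {a..b}" for t
  proof -
    have "0 \<le> integral {t..b} (\<lambda>r. k r * u r)"
      using that k u by (intro integral_nonneg ints mult_nonneg_nonneg) auto
    then show ?thesis using A by (simp add: U_def)
  qed
  \<comment> \<open>\<open>U\<close> decreases in time, so \<open>u r \<le> U r \<le> U t\<close> on
    the stretch and the integral of \<open>k * u\<close> is at most \<open>U t\<close> times the
    mass of \<open>k\<close>.\<close>
  have step: "U t \<le> U t' + U t * (J t - J t')" if "t \<in> {a..b}" "t' \<in> {a..b}" "t \<le> t'" for t t'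
  proof -
    have U_mono: "U r \<le> U t" if "r \<in> {t..t'}" for r
    proof -
      have "integral {t..r} (\<lambda>r. k r * u r) + integral {r..b} (\<lambda>r. k r * u r) = integral {t..b} (\<lambda>r. k r * u r)"
        using that \<open>t \<in> {a..b}\<close> \<open>t' \<in> {a..b}\<close>
        by (intro Henstock_Kurzweil_Integration.integral_combine ints) auto
      moreover have "0 \<le> integral {t..r} (\<lambda>r. k r * u r)"
        using that \<open>t \<in> {a..b}\<close> \<open>t' \<in> {a..b}\<close> k u by (intro integral_nonneg ints mult_nonneg_nonneg) auto
      ultimately show ?thesis unfolding U_def by linarith
    qed
    have "integral {t..t'} (\<lambda>r. k r * u r) \<le> integral {t..t'} (\<lambda>r. U t * k r)"
    proof (rule integral_le)
      show "(\<lambda>r. k r * u r) integrable_on {t..t'}" "(\<lambda>r. U t * k r) integrable_on {t..t'}"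
        using that by (auto intro!: ints integrable_on_mult_right)
      fix r assume r: "r \<in> {t..t'}"
      then have "u r \<le> U r" using le[of r] that unfolding U_def by auto
      also have "\<dots> \<le> U t" by (rule U_mono[OF r])
      finally show "k r * u r \<le> U t * k r"
        using k(2)[of r] r that by (subst mult.commute) (intro mult_right_mono, auto)
    qed
    also have "\<dots> = U t * integral {t..t'} k" by simp
    finally have 1: "integral {t..t'} (\<lambda>r. k r * u r) \<le> U t * integral {t..t'} k" .
    have 2: "integral {t..t'} k + J t' = J t"
      unfolding J_def using that by (intro Henstock_Kurzweil_Integration.integral_combine ints) auto
    have "integral {t..t'} (\<lambda>r. k r * u r) + integral {t'..b} (\<lambda>r. k r * u r) = integral {t..b} (\<lambda>r. k r * u r)"
      using that by (intro Henstock_Kurzweil_Integration.integral_combine ints) auto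
    then have "U t = U t' + integral {t..t'} (\<lambda>r. k r * u r)" by (simp add: U_def)
    moreover have "J t - J t' = integral {t..t'} k" using 2 by simp
    ultimately show ?thesis using 1 by simp
  qed
  have main: "U t \<le> 2 ^ n * A" if "J t \<le> real n / 2" "t \<in> {a..b}" for n t
    using that
  proof (induction n arbitrary: t)
    case 0
    then have "J t = 0" using J0[of t] by simp
    moreover have "J b = 0" "U b = A" by (simp_all add: J_def U_def)
    ultimately show ?case using step[of t b] 0 ab by simp
  next
    case (Suc n)
    show ?case
    proof (cases "J t \<le> real n / 2")
      case True
      then have "U t \<le> 2 ^ n * A" by (rule Suc.IH) fact
      also have "\<dots> \<le> 2 ^ Suc n * A" using A by (intro mult_right_mono) auto
      finally show ?thesis .
    next
      case False
      have "continuous_on {t..b} J"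
        unfolding J_def using Suc.prems by (intro indefinite_integral_continuous_1' ints) auto
      \<comment> \<open>The remaining mass exceeds \<open>n / 2\<close> at \<open>t\<close> and is
        zero at \<open>b\<close>. At the intermediate point where it equals \<open>n / 2\<close> the
        mass already passed is at most 1/2, so its contribution is absorbed at the price of a factor
        2.\<close>
      then have "\<exists>t'\<ge>t. t' \<le> b \<and> J t' = real n / 2"
        using False Suc.prems by (intro IVT2') (auto simp: J_def)
      then obtain t' where t': "t \<le> t'" "t' \<le> b" "J t' = real n / 2" by blast
      then have "t' \<in> {a..b}" using Suc.prems by auto
      have "U t \<le> U t' + U t * (J t - J t')"
        by (rule step) (use Suc.prems t' in auto)
      also have "U t * (J t - J t') \<le> U t * (1 / 2)"
        using U0 Suc.prems t' by (intro mult_left_mono) auto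
      finally have "U t \<le> 2 * U t'" by simp
      also have "U t' \<le> 2 ^ n * A" using Suc.IH[of t'] t' \<open>t' \<in> {a..b}\<close> by simp
      finally show ?thesis by simp
    qed
  qed
  have "J t \<le> integral {a..b} k"
    unfolding J_def using t k ints by (intro integral_subset_le) auto
  then have "U t \<le> 2 ^ n * A" using n t by (intro main) auto
  then show ?thesis using le[OF t] unfolding U_def by linarith
qed

text \<open>Reflection of time \<open>r \<mapsto> - r\<close> turns it into the backward
  inequality.\<close>

lemma gronwall_forward:
  fixes k u :: "real \<Rightarrow> real"
  assumes k: "k integrable_on {a..b}" "\<And>t. t \<in> {a..b} \<Longrightarrow> 0 \<le> k t"
    and u: "\<And>t. t \<in> {a..b} \<Longrightarrow> 0 \<le> u t"
    and ku: "(\<lambda>r. k r * u r) integrable_on {a..b}"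
    and le: "\<And>t. t \<in> {a..b} \<Longrightarrow> u t \<le> A + integral {a..t} (\<lambda>r. k r * u r)"
    and n: "integral {a..b} k \<le> real n / 2" and t: "t \<in> {a..b}"
  shows "u t \<le> 2 ^ n * A"
proof -
  have "u (- (- t)) \<le> 2 ^ n * A"
  proof (rule gronwall_backward[of "\<lambda>r. k (- r)" "- b" "- a" "\<lambda>r. u (- r)"])
    fix r assume "r \<in> {- b..- a}"
    then have "u (- r) \<le> A + integral {a..- r} (\<lambda>r. k r * u r)" by (intro le) auto
    also have "integral {a..- r} (\<lambda>r. k r * u r) = integral {r..- a} (\<lambda>r. k (- r) * u (- r))"
      using Henstock_Kurzweil_Integration.integral_reflect_real[of "- r" a "\<lambda>r. k r * u r"] by simp
    finally show "u (- r) \<le> A + integral {r..- a} (\<lambda>r. k (- r) * u (- r))" .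
  next
    show "integral {- b..- a} (\<lambda>r. k (- r)) \<le> real n / 2"
      using n Henstock_Kurzweil_Integration.integral_reflect_real[of b a k] by simp
    show "(\<lambda>r. k (- r)) integrable_on {- b..- a}" using k(1) by simp
    show "(\<lambda>r. k (- r) * u (- r)) integrable_on {- b..- a}"
      using ku Henstock_Kurzweil_Integration.integrable_reflect_real[of "\<lambda>r. k r * u r" b a] by simp
  qed (use k u t in auto)
  then show ?thesis by simp
qed

section \<open>Extensions of one-sided Lipschitz maps\<close>

lemma negligible_countable_UN:
  assumes "countable I" "\<And>i. i \<in> I \<Longrightarrow> negligible (A i)"
  shows "negligible (\<Union>i\<in>I. A i)"
  using assms by (intro negligible_countable_Union) auto

definition monotone_extension :: "'a::euclidean_space set \<Rightarrow> real \<Rightarrow> ('a \<Rightarrow> 'a) \<Rightarrow> 'a \<Rightarrow> 'a set" where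
  "monotone_extension D c f x =
     {v. \<forall>q\<in>D. - c * (norm (x - q))\<^sup>2 \<le> (v - f q) \<bullet> (x - q)}"

text \<open>Cauchy's criterion for a limit of \<open>f\<close> along \<open>D\<close> at
  \<open>x\<close>. Tolerances and radii come from the countable families \<open>1 / Suc m\<close>
  and \<open>1 / Suc n\<close>, so for countable \<open>D\<close> the condition is a countable
  combination of elementary ones and stays measurable.\<close>

definition cauchy_at :: "'a::metric_space set \<Rightarrow> ('a \<Rightarrow> 'b::metric_space) \<Rightarrow> 'a \<Rightarrow> bool" where
  "cauchy_at D f x \<longleftrightarrow>
     (\<forall>m::nat. \<exists>n::nat. \<forall>q\<in>D. \<forall>q'\<in>D. dist q x < 1 / Suc n \<and> dist q' x < 1 / Suc n \<longrightarrow>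
        dist (f q) (f q') \<le> 1 / Suc m)"

lemma monotone_extension_mono:
  assumes "c \<le> c'"
  shows "monotone_extension D c f x \<subseteq> monotone_extension D c' f x"
proof -
  have "- c' * (norm (x - q))\<^sup>2 \<le> - c * (norm (x - q))\<^sup>2" for q
    using assms by (intro mult_right_mono) auto
  then show ?thesis unfolding monotone_extension_def by (blast intro: order_trans)
qed

lemma convex_monotone_extension: "convex (monotone_extension D c f x)"
proof -
  have "monotone_extension D c f x =
      (\<Inter>q\<in>D. {v. - c * (norm (x - q))\<^sup>2 + f q \<bullet> (x - q) \<le> (x - q) \<bullet> v})"
    
  proof -
    have "- c * (norm (x - q))\<^sup>2 \<le> (v - f q) \<bullet> (x - q) \<longleftrightarrow>
        - c * (norm (x - q))\<^sup>2 + f q \<bullet> (x - q) \<le> (x - q) \<bullet> v" for v q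
      unfolding inner_diff_left[of v "f q"] inner_commute[of "x - q" v] by linarith
    then show ?thesis by (auto simp: monotone_extension_def)
  qed
  also have "convex \<dots>"
    by (intro convex_INT convex_halfspace_ge)
  finally show ?thesis .
qed

text \<open>Each constraint involves the map at a single \<open>q\<close>, so pointwise convergence
  on \<open>D\<close> is exactly what passes to the limit. With a constant sequence of maps this is
  closedness of the graph.\<close>

lemma monotone_extension_limit:
  assumes "x \<longlonglongrightarrow> x'" "v \<longlonglongrightarrow> v'" and "\<And>q. q \<in> D \<Longrightarrow> (\<lambda>n. f n q) \<longlonglongrightarrow> f' q"
    and "\<And>n. v n \<in> monotone_extension D c (f n) (x n)"
  shows "v' \<in> monotone_extension D c f' x'"
  unfolding monotone_extension_def
proof (safe)
  fix q assume q: "q \<in> D"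
  have "(\<lambda>n. - c * (norm (x n - q))\<^sup>2) \<longlonglongrightarrow> - c * (norm (x' - q))\<^sup>2"
    by (intro tendsto_intros assms)
  moreover have "(\<lambda>n. (v n - f n q) \<bullet> (x n - q)) \<longlonglongrightarrow> (v' - f' q) \<bullet> (x' - q)"
    by (intro tendsto_intros assms q)
  ultimately show "- c * (norm (x' - q))\<^sup>2 \<le> (v' - f' q) \<bullet> (x' - q)"
    using assms(4) q by (intro LIMSEQ_le) (auto simp: monotone_extension_def)
qed

lemma lower_one_sided_lipschitz_monotone_extension:
  "lower_one_sided_lipschitz c f \<Longrightarrow> f x \<in> monotone_extension D c f x"
  by (auto simp: lower_one_sided_lipschitz_def monotone_extension_def)

text \<open>Limit points belong to the extension because its graph is closed, and their convex hull
  because the extension is an intersection of half-spaces.\<close>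

lemma regularized_field_subset_monotone_extension:
  assumes "lower_one_sided_lipschitz c (b t)"
  shows "regularized_field b t x \<subseteq> monotone_extension D c (b t) x"
  unfolding regularized_field_def
proof (rule hull_minimal[where S = convex, OF subsetI convex_monotone_extension], elim CollectE exE conjE)
  fix z Y assume Y: "filterlim Y (at x) sequentially" "(\<lambda>n. b t (Y n)) \<longlonglongrightarrow> z"
  then have "Y \<longlonglongrightarrow> x" by (simp add: filterlim_at)
  then show "z \<in> monotone_extension D c (b t) x"
    using Y assms
    by (intro monotone_extension_limit[of Y x _ _ _ "\<lambda>_. b t"])
      (auto intro: lower_one_sided_lipschitz_monotone_extension)
qed

lemma regularized_field_norm_le:
  assumes "linear_growth k (b t)" "v \<in> regularized_field b t x"
  shows "norm v \<le> k * (1 + norm x)"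
proof -
  have "regularized_field b t x \<subseteq> cball 0 (k * (1 + norm x))"
    unfolding regularized_field_def
  proof (rule hull_minimal[where S = convex, OF subsetI convex_cball], elim CollectE exE conjE)
    fix z Y assume Y: "filterlim Y (at x) sequentially" "(\<lambda>n. b t (Y n)) \<longlonglongrightarrow> z"
    then have "Y \<longlonglongrightarrow> x" by (simp add: filterlim_at)
    then have "(\<lambda>n. k * (1 + norm (Y n))) \<longlonglongrightarrow> k * (1 + norm x)" by (intro tendsto_intros)
    moreover have "(\<lambda>n. norm (b t (Y n))) \<longlonglongrightarrow> norm z" using Y by (intro tendsto_intros)
    ultimately have "norm z \<le> k * (1 + norm x)"
      using assms(1) by (intro LIMSEQ_le) (auto simp: linear_growth_def)
    then show "z \<in> cball 0 (k * (1 + norm x))" by simp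
  qed
  with assms show ?thesis by auto
qed

lemma linear_growth_nonneg:
  assumes "linear_growth k f"
  shows "0 \<le> k"
proof -
  have "norm (f 0) \<le> k" using assms unfolding linear_growth_def by (metis add.right_neutral mult.right_neutral norm_zero)
  then show ?thesis using norm_ge_zero order_trans by blast
qed

section \<open>Monotonicity and single-valuedness of the extension\<close>

lemma linear_growth_convergent_subseq:
  assumes f: "linear_growth k f" and Q: "Q \<longlonglongrightarrow> x"
  obtains w r where "strict_mono (r :: nat \<Rightarrow> nat)" "(\<lambda>n. f (Q (r n))) \<longlonglongrightarrow> w"
proof -
  have "bounded (range Q)" using Q convergent_imp_bounded by blast
  then obtain B where B: "\<And>n. norm (Q n) \<le> B" unfolding bounded_iff by auto
  have "norm (f (Q n)) \<le> k * (1 + B)" for n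
  proof -
    have "norm (f (Q n)) \<le> k * (1 + norm (Q n))" using f by (simp add: linear_growth_def)
    also have "\<dots> \<le> k * (1 + B)"
      using B[of n] linear_growth_nonneg[OF f] by (intro mult_left_mono) auto
    finally show ?thesis .
  qed
  then have "bounded (range (\<lambda>n. f (Q n)))" unfolding bounded_iff by auto
  then obtain w r where "strict_mono (r :: nat \<Rightarrow> nat)" "((\<lambda>n. f (Q n)) \<circ> r) \<longlonglongrightarrow> w"
    using bounded_imp_convergent_subsequence by blast
  then show ?thesis using that by (auto simp: o_def)
qed

lemma dense_sequence:
  fixes x :: "'a::metric_space"
  assumes "closure D = UNIV"
  obtains Q where "\<And>n. Q n \<in> D" "Q \<longlonglongrightarrow> x"
  using assms closure_sequential[of x D] by auto

text \<open>Testing the two extensions at points of \<open>D\<close> near the midpoint loses nothing in the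
  constant.\<close>

lemma monotone_extension_monotone:
  assumes D: "closure D = UNIV" and f: "linear_growth k f"
    and v: "v \<in> monotone_extension D c f x" and w: "w \<in> monotone_extension D c f y"
  shows "- c * (norm (x - y))\<^sup>2 \<le> (v - w) \<bullet> (x - y)"
proof -
  define m where "m = (1 / 2) *\<^sub>R (x + y)"
  obtain Q where Q: "\<And>n. Q n \<in> D" "Q \<longlonglongrightarrow> m" using dense_sequence[OF D] by blast
  obtain u r where r: "strict_mono (r :: nat \<Rightarrow> nat)" "(\<lambda>n. f (Q (r n))) \<longlonglongrightarrow> u"
    using linear_growth_convergent_subseq[OF f Q(2)] by blast
  have Qr: "(\<lambda>n. Q (r n)) \<longlonglongrightarrow> m" using LIMSEQ_subseq_LIMSEQ[OF Q(2) r(1)] by (simp add: o_def)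
  have *: "- c * (norm (z - m))\<^sup>2 \<le> (v - u) \<bullet> (z - m)" if "v \<in> monotone_extension D c f z" for v z
  proof (rule LIMSEQ_le)
    show "(\<lambda>n. - c * (norm (z - Q (r n)))\<^sup>2) \<longlonglongrightarrow> - c * (norm (z - m))\<^sup>2"
      "(\<lambda>n. (v - f (Q (r n))) \<bullet> (z - Q (r n))) \<longlonglongrightarrow> (v - u) \<bullet> (z - m)"
      by (intro tendsto_intros Qr r)+
    show "\<exists>N. \<forall>n\<ge>N. - c * (norm (z - Q (r n)))\<^sup>2 \<le> (v - f (Q (r n))) \<bullet> (z - Q (r n))"
      using that Q by (auto simp: monotone_extension_def)
  qed
  have xm: "x - m = (1 / 2) *\<^sub>R (x - y)" "y - m = - (1 / 2) *\<^sub>R (x - y)"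
    by (simp_all add: m_def algebra_simps scaleR_2[symmetric])
  \<comment> \<open>Each half-segment costs \<open>c * (norm (x - y))\<^sup>2 / 4\<close>, while its
    inner product is only halved. Adding both cancels \<open>u\<close> and returns the constant
    \<open>c\<close> itself.\<close>
  have "- c * (norm (x - y))\<^sup>2 / 4 \<le> (v - u) \<bullet> (x - y) / 2"
    using *[OF v] by (simp add: xm power_divide)
  moreover have "- c * (norm (x - y))\<^sup>2 / 4 \<le> - ((w - u) \<bullet> (x - y)) / 2"
    using *[OF w] by (simp add: xm power_divide)
  ultimately show ?thesis by (simp add: inner_diff_left)
qed

lemma cauchy_at_limit:
  fixes f :: "'a::metric_space \<Rightarrow> 'b::complete_space"
  assumes D: "closure D = UNIV" and "cauchy_at D f x"
  obtains w where "\<And>Q. (\<And>n. Q n \<in> D) \<Longrightarrow> Q \<longlonglongrightarrow> x \<Longrightarrow> (\<lambda>n. f (Q n)) \<longlonglongrightarrow> w"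
proof -
  have ev: "\<forall>e>0. \<exists>d>0. \<forall>q\<in>D. \<forall>q'\<in>D. dist q x < d \<and> dist q' x < d \<longrightarrow> dist (f q) (f q') < e"
  proof (intro allI impI)
    fix e :: real assume "0 < e"
    then obtain m where m: "1 / Suc m < e" using nat_approx_posE by blast
    obtain n where "\<forall>q\<in>D. \<forall>q'\<in>D. dist q x < 1 / Suc n \<and> dist q' x < 1 / Suc n \<longrightarrow>
        dist (f q) (f q') \<le> 1 / Suc m"
      using assms(2) unfolding cauchy_at_def by blast
    with m show "\<exists>d>0. \<forall>q\<in>D. \<forall>q'\<in>D. dist q x < d \<and> dist q' x < d \<longrightarrow> dist (f q) (f q') < e"
      by (intro exI[of _ "1 / Suc n"]) force
  qed
  obtain Q where Q: "\<And>n. Q n \<in> D" "Q \<longlonglongrightarrow> x" using dense_sequence[OF D] by blast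
  have "Cauchy (\<lambda>n. f (Q n))"
    unfolding Cauchy_def
  proof (intro allI impI)
    fix e :: real assume "0 < e"
    with ev obtain d where d: "0 < d" "\<forall>q\<in>D. \<forall>q'\<in>D. dist q x < d \<and> dist q' x < d \<longrightarrow> dist (f q) (f q') < e"
      by blast
    obtain N where "\<forall>n\<ge>N. dist (Q n) x < d" using Q(2) d(1) unfolding lim_sequentially by blast
    with d Q(1) show "\<exists>M. \<forall>m\<ge>M. \<forall>n\<ge>M. dist (f (Q m)) (f (Q n)) < e" by blast
  qed
  then obtain w where w: "(\<lambda>n. f (Q n)) \<longlonglongrightarrow> w" using Cauchy_convergent convergent_def by blast
  show ?thesis
  proof (rule that)
    fix R assume R: "\<And>n. R n \<in> D" "R \<longlonglongrightarrow> x"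
    have "(\<lambda>n. dist (f (R n)) (f (Q n))) \<longlonglongrightarrow> 0"
      unfolding lim_sequentially
    proof (intro allI impI)
      fix e :: real assume "0 < e"
      with ev obtain d where d: "0 < d" "\<forall>q\<in>D. \<forall>q'\<in>D. dist q x < d \<and> dist q' x < d \<longrightarrow> dist (f q) (f q') < e"
        by blast
      obtain N where "\<forall>n\<ge>N. dist (Q n) x < d" using Q(2) d(1) unfolding lim_sequentially by blast
      moreover obtain M where "\<forall>n\<ge>M. dist (R n) x < d" using R(2) d(1) unfolding lim_sequentially by blast
      ultimately have "\<forall>n\<ge>max N M. dist (dist (f (R n)) (f (Q n))) 0 < e"
        using d(2) Q(1) R(1) by simp
      then show "\<exists>no. \<forall>n\<ge>no. dist (dist (f (R n)) (f (Q n))) 0 < e" by blast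
    qed
    then have "(\<lambda>n. dist (f (R n)) (f (Q n)) + dist (f (Q n)) w) \<longlonglongrightarrow> 0 + 0"
      using w[THEN iffD1[OF tendsto_dist_iff]] by (rule tendsto_add)
    then have "(\<lambda>n. dist (f (R n)) w) \<longlonglongrightarrow> 0"
      by (intro Lim_null_comparison[of "\<lambda>n. dist (f (R n)) w"
            "\<lambda>n. dist (f (R n)) (f (Q n)) + dist (f (Q n)) w"] always_eventually)
        (simp_all add: dist_triangle)
    then show "(\<lambda>n. f (R n)) \<longlonglongrightarrow> w" using tendsto_dist_iff by blast
  qed
qed

text \<open>Minty's argument. With \<open>w\<close> the limit of \<open>f\<close> along
  \<open>D\<close> and \<open>d = v - w\<close>, the defining inequality is tested at points of
  \<open>D\<close> near \<open>x + h *\<^sub>R d\<close>. Division by \<open>h\<close> and passage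
  to \<open>h = 0\<close> give \<open>d \<bullet> d \<le> 0\<close>. The constant drops out in the
  limit, so \<open>c\<close> and \<open>c'\<close> may differ.\<close>

lemma cauchy_at_monotone_extension_unique:
  fixes f :: "'a::euclidean_space \<Rightarrow> 'a"
  assumes D: "closure D = UNIV" and "cauchy_at D f x"
    and "v \<in> monotone_extension D c f x" "v' \<in> monotone_extension D c' f x"
  shows "v = v'"
proof -
  obtain w where w: "\<And>Q. (\<And>n. Q n \<in> D) \<Longrightarrow> Q \<longlonglongrightarrow> x \<Longrightarrow> (\<lambda>n. f (Q n)) \<longlonglongrightarrow> w"
    using cauchy_at_limit[OF assms(1,2)] by blast
  have "v = w" if v: "v \<in> monotone_extension D c f x" for v c
  proof -
    define d where "d = v - w"
    define h :: "nat \<Rightarrow> real" where "h n = 1 / Suc n" for n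
    have h: "0 < h n" for n by (simp add: h_def)
    have h0: "h \<longlonglongrightarrow> 0" unfolding h_def using LIMSEQ_inverse_real_of_nat by (simp add: inverse_eq_divide)
    \<comment> \<open>The accuracy is quadratic in \<open>h n\<close>, so that after rescaling by
      \<open>1 / h n\<close> the direction \<open>\<rho> n\<close> still converges to
      \<open>d\<close>.\<close>
    have "\<exists>q\<in>D. dist q (x + h n *\<^sub>R d) < h n * h n" for n
    proof -
      have "x + h n *\<^sub>R d \<in> closure D" using D by simp
      then show ?thesis using h[of n] unfolding closure_approachable by simp
    qed
    then obtain Q where Q: "\<And>n. Q n \<in> D" "\<And>n. dist (Q n) (x + h n *\<^sub>R d) < h n * h n" by metis
    define \<rho> where "\<rho> n = (1 / h n) *\<^sub>R (Q n - x)" for n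
    have "norm (\<rho> n - d) \<le> h n" for n
    proof -
      have "\<rho> n - d = (1 / h n) *\<^sub>R (Q n - (x + h n *\<^sub>R d))"
        using h[of n] by (simp add: \<rho>_def algebra_simps)
      then have "norm (\<rho> n - d) = dist (Q n) (x + h n *\<^sub>R d) / h n"
        using h[of n] by (simp add: dist_norm)
      also have "\<dots> \<le> (h n * h n) / h n" using Q(2)[of n] h[of n] by (intro divide_right_mono) auto
      finally show ?thesis using h[of n] by simp
    qed
    then have "(\<lambda>n. \<rho> n - d) \<longlonglongrightarrow> 0" using h0 by (rule Lim_null_comparison[OF always_eventually, OF allI])
    then have \<rho>: "\<rho> \<longlonglongrightarrow> d" by (simp add: LIM_zero_iff)
    have Qx: "Q n = x + h n *\<^sub>R \<rho> n" for n using h[of n] by (simp add: \<rho>_def)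
    have "Q \<longlonglongrightarrow> x + 0 *\<^sub>R d" unfolding Qx by (intro tendsto_intros h0 \<rho>)
    then have fQ: "(\<lambda>n. f (Q n)) \<longlonglongrightarrow> w" using w Q(1) by simp
    have "(v - f (Q n)) \<bullet> \<rho> n \<le> c * h n * (norm (\<rho> n))\<^sup>2" for n
    proof -
      have "- c * (norm (x - Q n))\<^sup>2 \<le> (v - f (Q n)) \<bullet> (x - Q n)"
        using v Q(1) by (auto simp: monotone_extension_def)
      then have "h n * ((v - f (Q n)) \<bullet> \<rho> n) \<le> h n * (c * h n * (norm (\<rho> n))\<^sup>2)"
        unfolding Qx by (simp add: power_mult_distrib power2_eq_square mult_ac)
      then show ?thesis using h[of n] by simp
    qed
    moreover have "(\<lambda>n. (v - f (Q n)) \<bullet> \<rho> n) \<longlonglongrightarrow> (v - w) \<bullet> d"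
      "(\<lambda>n. c * h n * (norm (\<rho> n))\<^sup>2) \<longlonglongrightarrow> c * 0 * (norm d)\<^sup>2"
      by (intro tendsto_intros fQ \<rho> h0)+
    ultimately have "(v - w) \<bullet> d \<le> c * 0 * (norm d)\<^sup>2" by (intro LIMSEQ_le) auto
    then have "d \<bullet> d \<le> 0" by (simp add: d_def)
    then have "d \<bullet> d = 0" using inner_ge_zero[of d] by linarith
    then have "d = 0" by simp
    then show "v = w" by (simp add: d_def)
  qed
  with assms show ?thesis by metis
qed

text \<open>Infinitely many pairwise disjoint translates of \<open>S\<close>, all of the same
  measure, lie in one ball; this forces measure zero.\<close>

lemma negligible_disjoint_translates:
  fixes S :: "'a::euclidean_space set"
  assumes "compact S" "0 < \<delta>"
    and disj: "\<And>x \<tau>. x \<in> S \<Longrightarrow> 0 < \<tau> \<Longrightarrow> \<tau> < \<delta> \<Longrightarrow> x + \<tau> *\<^sub>R i \<notin> S"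
  shows "negligible S"
proof -
  obtain B where B: "0 < B" "\<And>x. x \<in> S \<Longrightarrow> norm x \<le> B"
    using assms(1) compact_imp_bounded bounded_pos by metis
  \<comment> \<open>Distinct shifts differ by less than \<open>\<delta>\<close>, which makes the
    translates disjoint; the \<open>+ 2\<close> keeps every shift strictly below
    \<open>\<delta>\<close>.\<close>
  define \<tau> :: "nat \<Rightarrow> real" where "\<tau> n = \<delta> / (n + 2)" for n
  have \<tau>: "0 < \<tau> n" "\<tau> n < \<delta>" for n using assms(2) by (auto simp: \<tau>_def field_simps intro!: add_pos_nonneg)
  have \<tau>_less: "\<tau> m < \<tau> n" if "n < m" for m n
    using that assms(2) by (auto simp: \<tau>_def field_simps)
  define S' where "S' n = (\<lambda>x. \<tau> n *\<^sub>R i + x) ` S" for n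
  have meas: "S' n \<in> lmeasurable" "measure lebesgue (S' n) = measure lebesgue S" for n
    unfolding S'_def using lmeasurable_compact[OF assms(1)]
    by (simp_all add: measurable_translation measure_translation)
  have "disjoint_family S'"
    unfolding disjoint_family_on_def
  proof (intro ballI impI)
    have *: "S' m \<inter> S' n = {}" if "n < m" for m n
    proof (rule ccontr)
      assume "S' m \<inter> S' n \<noteq> {}"
      then obtain x y where "x \<in> S" "y \<in> S" "\<tau> m *\<^sub>R i + x = \<tau> n *\<^sub>R i + y" by (auto simp: S'_def)
      then have "x = y + (\<tau> n - \<tau> m) *\<^sub>R i" by (simp add: algebra_simps)
      then show False
        using disj[OF \<open>y \<in> S\<close>, of "\<tau> n - \<tau> m"] \<open>x \<in> S\<close> \<tau>_less[OF that] \<tau>[of n] \<tau>(1)[of m] by auto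
    qed
    fix m n :: nat assume "m \<noteq> n"
    then show "S' m \<inter> S' n = {}" using *[of m n] *[of n m] by (cases m n rule: linorder_cases) auto
  qed
  have bound: "real N * measure lebesgue S \<le> measure lebesgue (cball (0::'a) (B + \<delta> * norm i))" for N
  proof -
    have "real N * measure lebesgue S = (\<Sum>n<N. measure lebesgue (S' n))" by (simp add: meas)
    also have "\<dots> = measure lebesgue (\<Union>n<N. S' n)"
    proof (rule measure_UNION_AE[symmetric])
      show "pairwise (\<lambda>i j. AE x in lebesgue. x \<notin> S' i \<or> x \<notin> S' j) {..<N}"
        using \<open>disjoint_family S'\<close> unfolding pairwise_def disjoint_family_on_def
        by (intro ballI impI AE_I2) auto
    qed (use meas in auto)
    also have "\<dots> \<le> measure lebesgue (cball (0::'a) (B + \<delta> * norm i))"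
    proof (rule measure_mono_fmeasurable)
      show "(\<Union>n<N. S' n) \<subseteq> cball 0 (B + \<delta> * norm i)"
      proof safe
        fix n y assume "y \<in> S' n"
        then obtain x where x: "x \<in> S" "y = \<tau> n *\<^sub>R i + x" by (auto simp: S'_def)
        have "norm y \<le> \<tau> n * norm i + norm x"
          using norm_triangle_ineq[of "\<tau> n *\<^sub>R i" x] \<tau>[of n] x by simp
        also have "\<dots> \<le> \<delta> * norm i + B"
          using \<tau>[of n] B x by (intro add_mono mult_right_mono) auto
        finally show "y \<in> cball 0 (B + \<delta> * norm i)" by simp
      qed
    qed (use meas in \<open>auto intro: fmeasurableD\<close>)
    finally show ?thesis .
  qed
  have "measure lebesgue S = 0"
  proof (rule ccontr)
    assume "measure lebesgue S \<noteq> 0"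
    then have "0 < measure lebesgue S" by (simp add: zero_less_measure_iff)
    then obtain N :: nat where "measure lebesgue (cball (0::'a) (B + \<delta> * norm i)) < real N * measure lebesgue S"
      using reals_Archimedean3 by blast
    with bound[of N] show False by simp
  qed
  then show ?thesis using lmeasurable_compact[OF assms(1)] negligible_iff_measure by blast
qed

text \<open>Where \<open>f\<close> oscillates, the monotone extension contains two values that differ in some
  coordinate \<open>i\<close>; the points where it does so by a fixed amount form a set that monotonicity keeps
  disjoint from its small translates in direction \<open>i\<close>.\<close>

lemma negligible_not_cauchy_at:
  fixes f :: "'a::euclidean_space \<Rightarrow> 'a"
  assumes D: "closure D = UNIV" and f: "linear_growth k f" and os: "lower_one_sided_lipschitz c f"
  shows "negligible {x. \<not> cauchy_at D f x}"
proof -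
  \<comment> \<open>Nonstrict thresholds and the bound \<open>M\<close> make this graph piece closed
    and bounded, so that its projection to \<open>x\<close> is compact as the translation argument
    requires.\<close>
  define P where "P i \<alpha> \<beta> M = {(x, v, w). v \<in> monotone_extension D c f x \<and> w \<in> monotone_extension D c f x
      \<and> norm x \<le> M \<and> norm v \<le> M \<and> norm w \<le> M \<and> v \<bullet> i \<le> \<alpha> \<and> \<beta> \<le> w \<bullet> i}" for i \<alpha> \<beta> M
  have compact_P: "compact (P i \<alpha> \<beta> M)" for i \<alpha> \<beta> M
  proof -
    have "closed (P i \<alpha> \<beta> M)"
      unfolding P_def monotone_extension_def case_prod_unfold mem_Collect_eq Ball_def
      by (intro closed_Collect_conj closed_Collect_all closed_Collect_imp closed_Collect_le
          open_Collect_const continuous_intros)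
    moreover have "P i \<alpha> \<beta> M \<subseteq> cball 0 M \<times> cball 0 M \<times> cball 0 M" by (auto simp: P_def)
    ultimately show ?thesis
      using bounded_subset[OF bounded_Times[OF bounded_cball bounded_Times[OF bounded_cball bounded_cball]]]
      by (simp add: compact_eq_bounded_closed)
  qed
  have null: "negligible (fst ` P i \<alpha> \<beta> M)" if "i \<in> Basis" "\<alpha> < \<beta>" for i \<alpha> \<beta> M
  proof (rule negligible_disjoint_translates)
    show "compact (fst ` P i \<alpha> \<beta> M)"
      by (intro compact_continuous_image compact_P continuous_intros)
    \<comment> \<open>For shifts below this length \<open>c * \<tau> < \<beta> - \<alpha>\<close>,
      whatever the sign of \<open>c\<close>, contrary to what monotonicity demands of a low value at
      \<open>x + \<tau> *\<^sub>R i\<close> and a high one at \<open>x\<close>.\<close>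
    show "0 < (\<beta> - \<alpha>) / (\<bar>c\<bar> + 1)" using that by auto
    fix x \<tau> assume x: "x \<in> fst ` P i \<alpha> \<beta> M" and \<tau>: "0 < \<tau>" "\<tau> < (\<beta> - \<alpha>) / (\<bar>c\<bar> + 1)"
    show "x + \<tau> *\<^sub>R i \<notin> fst ` P i \<alpha> \<beta> M"
    proof
      assume "x + \<tau> *\<^sub>R i \<in> fst ` P i \<alpha> \<beta> M"
      then obtain v where v: "v \<in> monotone_extension D c f (x + \<tau> *\<^sub>R i)" "v \<bullet> i \<le> \<alpha>" by (auto simp: P_def)
      obtain w where w: "w \<in> monotone_extension D c f x" "\<beta> \<le> w \<bullet> i" using x by (auto simp: P_def)
      have "- c * \<tau>\<^sup>2 \<le> \<tau> * ((v - w) \<bullet> i)"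
        using monotone_extension_monotone[OF D f v(1) w(1)] that(1) by simp
      also have "\<dots> \<le> \<tau> * (\<alpha> - \<beta>)"
        using v w \<tau> by (intro mult_left_mono) (auto simp: inner_diff_left)
      finally have "\<tau> * (\<beta> - \<alpha>) \<le> \<tau> * (c * \<tau>)" by (simp add: power2_eq_square algebra_simps)
      then have "\<beta> - \<alpha> \<le> c * \<tau>" using \<tau> by simp
      also have "\<dots> \<le> (\<bar>c\<bar> + 1) * \<tau>" using \<tau> by (intro mult_right_mono) auto
      also have "\<dots> < \<beta> - \<alpha>" using \<tau> by (simp add: pos_less_divide_eq mult.commute)
      finally show False by simp
    qed
  qed
  have "{x. \<not> cauchy_at D f x} \<subseteq>
      (\<Union>i\<in>Basis. \<Union>\<alpha>\<in>\<rat>. \<Union>\<beta>\<in>{\<beta>\<in>\<rat>. \<alpha> < \<beta>}. \<Union>M::nat. fst ` P i \<alpha> \<beta> (real M))"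
  proof safe
    fix x assume "\<not> cauchy_at D f x"
    then obtain m where m: "\<forall>n. \<exists>q\<in>D. \<exists>q'\<in>D. dist q x < 1 / Suc n \<and> dist q' x < 1 / Suc n \<and>
        1 / Suc m < dist (f q) (f q')"
      unfolding cauchy_at_def not_all not_ex by (metis not_le)
    then obtain Q Q' where Q: "\<And>n. dist (Q n) x < 1 / Suc n" and Q': "\<And>n. dist (Q' n) x < 1 / Suc n"
      and QQ': "\<And>n. 1 / Suc m < dist (f (Q n)) (f (Q' n))"
      by metis
    have lim: "R \<longlonglongrightarrow> x" if "\<And>n. dist (R n) x < 1 / Suc n" for R
    proof -
      have "(\<lambda>n. dist (R n) x) \<longlonglongrightarrow> 0"
        using LIMSEQ_inverse_real_of_nat that
        by (intro Lim_null_comparison[of "\<lambda>n. dist (R n) x" "\<lambda>n. inverse (real (Suc n))"] always_eventually)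
          (auto simp: inverse_eq_divide intro: less_imp_le)
      then show ?thesis using tendsto_dist_iff by blast
    qed
    obtain v r where r: "strict_mono (r :: nat \<Rightarrow> nat)" "(\<lambda>n. f (Q (r n))) \<longlonglongrightarrow> v"
      using linear_growth_convergent_subseq[OF f lim[OF Q]] by blast
    have Qr: "(\<lambda>n. Q (r n)) \<longlonglongrightarrow> x" "(\<lambda>n. Q' (r n)) \<longlonglongrightarrow> x"
      using LIMSEQ_subseq_LIMSEQ[OF lim[OF Q] r(1)] LIMSEQ_subseq_LIMSEQ[OF lim[OF Q'] r(1)]
      by (simp_all add: o_def)
    obtain w r' where r': "strict_mono (r' :: nat \<Rightarrow> nat)" "(\<lambda>n. f (Q' (r (r' n)))) \<longlonglongrightarrow> w"
      using linear_growth_convergent_subseq[OF f Qr(2)] by blast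
    have v': "(\<lambda>n. f (Q (r (r' n)))) \<longlonglongrightarrow> v"
      using LIMSEQ_subseq_LIMSEQ[OF r(2) r'(1)] by (simp add: o_def)
    have Qr': "(\<lambda>n. Q (r (r' n))) \<longlonglongrightarrow> x" "(\<lambda>n. Q' (r (r' n))) \<longlonglongrightarrow> x"
      using LIMSEQ_subseq_LIMSEQ[OF Qr(1) r'(1)] LIMSEQ_subseq_LIMSEQ[OF Qr(2) r'(1)]
      by (simp_all add: o_def)
    have "1 / Suc m \<le> dist v w"
      using v' r'(2) QQ' by (intro LIMSEQ_le[OF tendsto_const tendsto_dist]) (auto intro: less_imp_le)
    then have "v \<noteq> w" by auto
    then obtain i where i: "i \<in> Basis" "v \<bullet> i \<noteq> w \<bullet> i" by (metis euclidean_eqI)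
    have vw: "v \<in> monotone_extension D c f x" "w \<in> monotone_extension D c f x"
      using lower_one_sided_lipschitz_monotone_extension[OF os]
      by (auto intro!: monotone_extension_limit[OF Qr'(1) v', of _ "\<lambda>_. f"]
          monotone_extension_limit[OF Qr'(2) r'(2), of _ "\<lambda>_. f"])
    \<comment> \<open>Rational thresholds and integer bounds keep the union countable. The pair is
      left arbitrary because it is not known which of the two limits has the smaller
      coordinate.\<close>
    have ex: "\<exists>\<alpha>\<in>\<rat>. \<exists>\<beta>\<in>{\<beta>\<in>\<rat>. \<alpha> < \<beta>}. \<exists>M::nat. (x, v, w) \<in> P i \<alpha> \<beta> (real M)"
      if "v \<in> monotone_extension D c f x" "w \<in> monotone_extension D c f x"
        and less: "v \<bullet> i < w \<bullet> i" for v w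
    proof -
      obtain \<alpha> where \<alpha>: "\<alpha> \<in> \<rat>" "v \<bullet> i < \<alpha>" "\<alpha> < w \<bullet> i" using Rats_dense_in_real less by blast
      obtain \<beta> where \<beta>: "\<beta> \<in> \<rat>" "\<alpha> < \<beta>" "\<beta> < w \<bullet> i" using Rats_dense_in_real \<alpha>(3) by blast
      obtain M :: nat where "max (norm x) (max (norm v) (norm w)) \<le> real M" using real_arch_simple by blast
      then have "(x, v, w) \<in> P i \<alpha> \<beta> (real M)" using \<alpha> \<beta> that by (auto simp: P_def)
      then show ?thesis using \<alpha> \<beta> by blast
    qed
    have "\<exists>\<alpha>\<in>\<rat>. \<exists>\<beta>\<in>{\<beta>\<in>\<rat>. \<alpha> < \<beta>}. \<exists>M::nat. x \<in> fst ` P i \<alpha> \<beta> (real M)"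
      using ex[OF vw] ex[OF vw(2,1)] i(2) by (cases "v \<bullet> i" "w \<bullet> i" rule: linorder_cases) (force+)
    then show "x \<in> (\<Union>i\<in>Basis. \<Union>\<alpha>\<in>\<rat>. \<Union>\<beta>\<in>{\<beta>\<in>\<rat>. \<alpha> < \<beta>}. \<Union>M::nat. fst ` P i \<alpha> \<beta> (real M))"
      using i(1) by blast
  qed
  moreover have "negligible (\<Union>i\<in>Basis. \<Union>\<alpha>\<in>\<rat>. \<Union>\<beta>\<in>{\<beta>\<in>\<rat>. \<alpha> < \<beta>}. \<Union>M::nat. fst ` P i \<alpha> \<beta> (real M))"
  proof -
    have "countable {\<beta>\<in>\<rat>. \<alpha> < \<beta>}" for \<alpha> :: real
      by (rule countable_subset[OF _ countable_rat]) auto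
    then show ?thesis
      by (intro negligible_countable_UN) (auto intro: null countable_rat countable_finite)
  qed
  ultimately show ?thesis using negligible_subset by blast
qed

section \<open>Trajectories and their stability\<close>

lemma AE_lebesgue_on_iff:
  assumes "S \<in> sets lebesgue"
  shows "(AE x in lebesgue_on S. P x) \<longleftrightarrow> (AE x in lebesgue. x \<in> S \<longrightarrow> P x)"
  using assms by (simp add: AE_restrict_space_iff)

lemma AE_lebesgue_negligible: "(AE x in lebesgue. P x) \<longleftrightarrow> negligible {x. \<not> P x}"
  unfolding eventually_ae_filter_negligible using negligible_subset by blast

lemma absolutely_integrable_on_iff_integrable:
  fixes f :: "'n::euclidean_space \<Rightarrow> 'm::euclidean_space"
  assumes "S \<in> sets lebesgue"
  shows "f absolutely_integrable_on S \<longleftrightarrow> integrable (lebesgue_on S) f"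
  using assms by (simp add: set_integrable_def integrable_restrict_space)

lemma integral_norm_bound_AE:
  fixes f :: "'n::euclidean_space \<Rightarrow> 'm::euclidean_space"
  assumes "f integrable_on S" "g integrable_on S"
    and "AE x in lebesgue. x \<in> S \<longrightarrow> norm (f x) \<le> g x"
  shows "norm (integral S f) \<le> integral S g"
proof -
  define N where "N = {x. \<not> (x \<in> S \<longrightarrow> norm (f x) \<le> g x)}"
  have N: "negligible N" using assms(3) by (simp add: AE_lebesgue_negligible N_def)
  define f' where "f' x = (if x \<in> N then 0 else f x)" for x
  define g' where "g' x = (if x \<in> N then 0 else g x)" for x
  have "f' integrable_on S" by (rule integrable_spike[OF assms(1) N]) (simp add: f'_def)
  moreover have "g' integrable_on S" by (rule integrable_spike[OF assms(2) N]) (simp add: g'_def)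
  ultimately have "norm (integral S f') \<le> integral S g'"
    by (rule integral_norm_bound_integral) (auto simp: f'_def g'_def N_def)
  moreover have "integral S f' = integral S f"
    by (rule integral_spike[OF N, symmetric]) (simp add: f'_def)
  moreover have "integral S g' = integral S g"
    by (rule integral_spike[OF N, symmetric]) (simp add: g'_def)
  ultimately show ?thesis by simp
qed

lemma integral_le_AE:
  fixes f :: "'n::euclidean_space \<Rightarrow> real"
  assumes "f integrable_on S" "g integrable_on S"
    and "AE x in lebesgue. x \<in> S \<longrightarrow> f x \<le> g x"
  shows "integral S f \<le> integral S g"
proof -
  have "norm (integral S (\<lambda>x. 0::real)) \<le> integral S (\<lambda>x. g x - f x)"
    using assms by (intro integral_norm_bound_AE integrable_diff integrable_0)
      (auto elim: eventually_mono)
  then show ?thesis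
    using assms(1,2) by (simp add: Henstock_Kurzweil_Integration.integral_diff)
qed

lemma tendsto_subseqI:
  fixes f :: "nat \<Rightarrow> 'a::metric_space"
  assumes "\<And>r :: nat \<Rightarrow> nat. strict_mono r \<Longrightarrow> \<exists>r' :: nat \<Rightarrow> nat. strict_mono r' \<and> (\<lambda>n. f (r (r' n))) \<longlonglongrightarrow> l"
  shows "f \<longlonglongrightarrow> l"
proof (rule ccontr)
  assume "\<not> f \<longlonglongrightarrow> l"
  then obtain e where e: "0 < e" "\<forall>N. \<exists>n\<ge>N. e \<le> dist (f n) l"
    unfolding lim_sequentially by (metis not_le)
  then have "infinite {n. e \<le> dist (f n) l}"
    unfolding infinite_nat_iff_unbounded_le by auto
  then obtain r :: "nat \<Rightarrow> nat" where r: "strict_mono r" "\<And>n. e \<le> dist (f (r n)) l"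
    using infinite_enumerate by blast
  obtain r' where r': "strict_mono r'" "(\<lambda>n. f (r (r' n))) \<longlonglongrightarrow> l" using assms[OF r(1)] by blast
  then obtain N where "dist (f (r (r' N))) l < e" using e(1) unfolding lim_sequentially by blast
  then show False using r(2)[of "r' N"] by simp
qed

lemma bounded_subseq2:
  fixes y w :: "nat \<Rightarrow> 'a::euclidean_space"
  assumes "\<And>n. norm (y n) \<le> B" "\<And>n. norm (w n) \<le> C"
  obtains r y' w' where "strict_mono (r :: nat \<Rightarrow> nat)" "(\<lambda>n. y (r n)) \<longlonglongrightarrow> y'" "(\<lambda>n. w (r n)) \<longlonglongrightarrow> w'"
proof -
  have "bounded (range y)" "bounded (range w)" unfolding bounded_iff using assms by auto
  then have "bounded (range y \<times> range w)" by (rule bounded_Times)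
  then have "bounded (range (\<lambda>n. (y n, w n)))" by (rule bounded_subset) auto
  then obtain l r where r: "strict_mono (r :: nat \<Rightarrow> nat)" "((\<lambda>n. (y n, w n)) \<circ> r) \<longlonglongrightarrow> l"
    using bounded_imp_convergent_subsequence by blast
  then show ?thesis using that[OF r(1), of "fst l" "snd l"] tendsto_fst[OF r(2)] tendsto_snd[OF r(2)]
    by (simp add: o_def)
qed

text \<open>Values belonging to different maps \<open>F n\<close> and \<open>f\<close> satisfy no
  common one-sided inequality; the deficit measures by how much it fails. Along a subsequence the
  bounded pairs converge to a point of the graph for \<open>f\<close>, where the inequality with
  \<open>v\<close> is exact. The points \<open>y n\<close> are merely bounded, since their
  convergence is what the stability proof will conclude.\<close>

lemma monotone_extension_deficit_tendsto_0:
  assumes D: "closure D = UNIV" and f: "linear_growth k f"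
    and F: "\<And>q. q \<in> D \<Longrightarrow> (\<lambda>n. F n q) \<longlonglongrightarrow> f q"
    and w: "\<And>n. w n \<in> monotone_extension D c (F n) (y n)" and v: "v \<in> monotone_extension D c f x"
    and bounds: "\<And>n. norm (y n) \<le> B" "\<And>n. norm (w n) \<le> C"
  shows "(\<lambda>n. max 0 (- ((w n - v) \<bullet> (y n - x) + c * (norm (y n - x))\<^sup>2))) \<longlonglongrightarrow> 0"
proof (rule tendsto_subseqI)
  fix r :: "nat \<Rightarrow> nat" assume r: "strict_mono r"
  obtain r' y' w' where r': "strict_mono (r' :: nat \<Rightarrow> nat)" "(\<lambda>n. y (r (r' n))) \<longlonglongrightarrow> y'"
    "(\<lambda>n. w (r (r' n))) \<longlonglongrightarrow> w'"
    using bounded_subseq2[of "\<lambda>n. y (r n)" B "\<lambda>n. w (r n)" C] bounds by blast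
  have "w' \<in> monotone_extension D c f y'"
  proof (rule monotone_extension_limit[OF r'(2,3)])
    show "w (r (r' n)) \<in> monotone_extension D c (F (r (r' n))) (y (r (r' n)))" for n by (rule w)
    fix q assume "q \<in> D"
    from LIMSEQ_subseq_LIMSEQ[OF F[OF this] strict_mono_o[OF r r'(1)]]
    show "(\<lambda>n. F (r (r' n)) q) \<longlonglongrightarrow> f q" by (simp add: o_def)
  qed
  then have "- c * (norm (y' - x))\<^sup>2 \<le> (w' - v) \<bullet> (y' - x)"
    using monotone_extension_monotone[OF D f _ v] by blast
  then have "max 0 (- ((w' - v) \<bullet> (y' - x) + c * (norm (y' - x))\<^sup>2)) = 0" by simp
  moreover have "(\<lambda>n. max 0 (- ((w (r (r' n)) - v) \<bullet> (y (r (r' n)) - x) + c * (norm (y (r (r' n)) - x))\<^sup>2)))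
      \<longlonglongrightarrow> max 0 (- ((w' - v) \<bullet> (y' - x) + c * (norm (y' - x))\<^sup>2))"
    by (intro tendsto_intros r')
  ultimately show "\<exists>r' :: nat \<Rightarrow> nat. strict_mono r' \<and>
    (\<lambda>n. max 0 (- ((w (r (r' n)) - v) \<bullet> (y (r (r' n)) - x) + c * (norm (y (r (r' n)) - x))\<^sup>2))) \<longlonglongrightarrow> 0"
    using r'(1) by auto
qed

text \<open>Boundedness provides limit points of \<open>w\<close>, the closed graph puts them into
  the extension at \<open>x\<close>, and there the extension is single-valued.\<close>

lemma monotone_extension_tendsto:
  assumes D: "closure D = UNIV" and F: "\<And>q. q \<in> D \<Longrightarrow> (\<lambda>n. F n q) \<longlonglongrightarrow> f q"
    and w: "\<And>n. w n \<in> monotone_extension D c (F n) (y n)" and v: "v \<in> monotone_extension D c f x"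
    and y: "y \<longlonglongrightarrow> x" and C: "\<And>n. norm (w n) \<le> C" and x: "cauchy_at D f x"
  shows "w \<longlonglongrightarrow> v"
proof (rule tendsto_subseqI)
  fix r :: "nat \<Rightarrow> nat" assume r: "strict_mono r"
  obtain r' w' where r': "strict_mono (r' :: nat \<Rightarrow> nat)" "(\<lambda>n. w (r (r' n))) \<longlonglongrightarrow> w'"
    using bounded_subseq2[of "\<lambda>n. w (r n)" C "\<lambda>n. w (r n)" C] C by blast
  have "w' \<in> monotone_extension D c f x"
  proof (rule monotone_extension_limit[OF _ r'(2)])
    show "w (r (r' n)) \<in> monotone_extension D c (F (r (r' n))) (y (r (r' n)))" for n by (rule w)
    show "(\<lambda>n. y (r (r' n))) \<longlonglongrightarrow> x"
      using LIMSEQ_subseq_LIMSEQ[OF y strict_mono_o[OF r r'(1)]] by (simp add: o_def)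
    fix q assume "q \<in> D"
    from LIMSEQ_subseq_LIMSEQ[OF F[OF this] strict_mono_o[OF r r'(1)]]
    show "(\<lambda>n. F (r (r' n)) q) \<longlonglongrightarrow> f q" by (simp add: o_def)
  qed
  then have "w' = v" using cauchy_at_monotone_extension_unique[OF D x _ v] by blast
  then show "\<exists>r' :: nat \<Rightarrow> nat. strict_mono r' \<and> (\<lambda>n. w (r (r' n))) \<longlonglongrightarrow> v"
    using r' by auto
qed

section \<open>Integral representation and a priori estimates for trajectories\<close>

lemma abs_continuous_on_has_integral:
  fixes f :: "real \<Rightarrow> 'b::euclidean_space"
  assumes "a \<le> b" and f: "abs_continuous_on a b f"
    and deriv: "AE t in lebesgue. t \<in> {a..b} \<longrightarrow> (f has_vector_derivative v t) (at t within {a..b})"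
  shows "(v has_integral (f b - f a)) {a..b}"
  using fundamental_theorem_of_calculus_abs_continuous[OF assms(1,2) deriv[unfolded AE_lebesgue_negligible]]
  by auto

text \<open>Upgrades the gauge integrability supplied by the fundamental theorem of calculus; an
  absolutely integrable bound suffices because gauge integrable functions are measurable.\<close>

lemma absolutely_integrable_bound_AE:
  fixes f :: "'n::euclidean_space \<Rightarrow> 'm::euclidean_space"
  assumes "f integrable_on S" "g absolutely_integrable_on S" "S \<in> sets lebesgue"
    and "AE x in lebesgue. x \<in> S \<longrightarrow> norm (f x) \<le> g x"
  shows "f absolutely_integrable_on S"
proof -
  have "f \<in> borel_measurable (lebesgue_on S)" using assms(1) by (rule integrable_imp_measurable)
  moreover have "integrable (lebesgue_on S) g"
    using assms absolutely_integrable_on_iff_integrable by blast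
  moreover have "AE x in lebesgue_on S. norm (f x) \<le> norm (g x)"
    unfolding AE_lebesgue_on_iff[OF assms(3)] using assms(4) by (auto elim: eventually_mono)
  ultimately show ?thesis
    using assms(3) Bochner_Integration.integrable_bound absolutely_integrable_on_iff_integrable by blast
qed

text \<open>The common form of the curves of the flow and of the regularized flows. The velocity
  \<open>v\<close> is carried as data because it is selected from a set and is not a function of the
  position.\<close>

definition trajectory ::
    "real \<Rightarrow> (real \<Rightarrow> real) \<Rightarrow> (real \<Rightarrow> real) \<Rightarrow> 'a::euclidean_space set \<Rightarrow> (real \<Rightarrow> 'a \<Rightarrow> 'a) \<Rightarrow>
      (real \<Rightarrow> 'a) \<Rightarrow> (real \<Rightarrow> 'a) \<Rightarrow> bool" where
  "trajectory T k c D f X v \<longleftrightarrow> abs_continuous_on 0 T X \<and>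
     (AE t in lebesgue. t \<in> {0..T} \<longrightarrow> (X has_vector_derivative v t) (at t within {0..T})) \<and>
     (AE t in lebesgue. t \<in> {0..T} \<longrightarrow> norm (v t) \<le> k t * (1 + norm (X t))) \<and>
     (AE t in lebesgue. t \<in> {0..T} \<longrightarrow> v t \<in> monotone_extension D (c t) (f t) (X t))"

lemma trajectoryD:
  assumes "trajectory T k c D f X v"
  shows "abs_continuous_on 0 T X"
    and "AE t in lebesgue. t \<in> {0..T} \<longrightarrow> (X has_vector_derivative v t) (at t within {0..T})"
    and "AE t in lebesgue. t \<in> {0..T} \<longrightarrow> norm (v t) \<le> k t * (1 + norm (X t))"
    and "AE t in lebesgue. t \<in> {0..T} \<longrightarrow> v t \<in> monotone_extension D (c t) (f t) (X t)"
  using assms by (auto simp: trajectory_def)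

lemma nonneg_L1_subinterval:
  assumes "nonneg_L1 T k" "S \<le> T"
  shows "nonneg_L1 S k"
  unfolding nonneg_L1_def
proof
  have "{0..S} \<subseteq> {0..T}" using assms(2) by auto
  then show "set_integrable lebesgue {0..S} k"
    using assms(1) absolutely_integrable_on_subinterval unfolding nonneg_L1_def by blast
qed (use assms in \<open>auto simp: nonneg_L1_def\<close>)

lemma nonneg_L1_integral_bound:
  obtains n :: nat where "integral {0..T} k \<le> real n / 2"
  using real_arch_simple[of "2 * integral {0..T} k"] by (metis divide_le_eq_numeral1(1) le_divide_eq_numeral1(1) mult.commute)

lemma trajectory_subinterval:
  assumes "trajectory T k c D f X v" "S \<le> T"
  shows "trajectory S k c D f X v"
proof -
  have "{0..S} \<subseteq> {0..T}" using assms(2) by auto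
  note X = trajectoryD[OF assms(1)]
  show ?thesis
    unfolding trajectory_def
  proof (intro conjI)
    show "abs_continuous_on 0 S X" using abs_continuous_on_subinterval[OF X(1)] assms(2) by simp
    show "AE t in lebesgue. t \<in> {0..S} \<longrightarrow> (X has_vector_derivative v t) (at t within {0..S})"
      using X(2) by eventually_elim
        (use \<open>{0..S} \<subseteq> {0..T}\<close> in \<open>auto intro: has_vector_derivative_within_subset\<close>)
    show "AE t in lebesgue. t \<in> {0..S} \<longrightarrow> norm (v t) \<le> k t * (1 + norm (X t))"
      using X(3) by eventually_elim (use \<open>{0..S} \<subseteq> {0..T}\<close> in auto)
    show "AE t in lebesgue. t \<in> {0..S} \<longrightarrow> v t \<in> monotone_extension D (c t) (f t) (X t)"
      using X(4) by eventually_elim (use \<open>{0..S} \<subseteq> {0..T}\<close> in auto)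
  qed
qed

lemma trajectory_has_integral:
  assumes "trajectory T k c D f X v" "0 \<le> a" "a \<le> b" "b \<le> T"
  shows "(v has_integral (X b - X a)) {a..b}"
proof (rule abs_continuous_on_has_integral[OF assms(3)])
  show "abs_continuous_on a b X"
    using assms abs_continuous_on_subinterval unfolding trajectory_def by blast
  have "{a..b} \<subseteq> {0..T}" using assms by auto
  then show "AE t in lebesgue. t \<in> {a..b} \<longrightarrow> (X has_vector_derivative v t) (at t within {a..b})"
    using assms(1) unfolding trajectory_def
    by (auto elim!: eventually_mono intro: has_vector_derivative_within_subset)
qed

lemma trajectory_continuous: "trajectory T k c D f X v \<Longrightarrow> continuous_on {0..T} X"
  by (auto simp: trajectory_def intro: abs_continuous_on_imp_continuous_on)

lemma trajectory_bound_integrable: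
  assumes X: "trajectory T k c D f X v" and k: "nonneg_L1 T k" and "0 \<le> a" "b \<le> T"
  shows "(\<lambda>t. k t * (1 + norm (X t))) absolutely_integrable_on {a..b}"
proof -
  have cont: "continuous_on {0..T} (\<lambda>t. 1 + norm (X t))"
    by (intro continuous_intros trajectory_continuous[OF X])
  have "(\<lambda>t. (1 + norm (X t)) * k t) absolutely_integrable_on {0..T}"
    using k cont
    by (intro absolutely_integrable_bounded_measurable_product_real
        continuous_imp_measurable_on_sets_lebesgue compact_imp_bounded compact_continuous_image)
      (auto simp: nonneg_L1_def)
  moreover have "{a..b} \<subseteq> {0..T}" using assms(3,4) by auto
  ultimately have "(\<lambda>t. (1 + norm (X t)) * k t) absolutely_integrable_on {a..b}"
    by (rule absolutely_integrable_on_subinterval)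
  then show ?thesis by (simp only: mult.commute)
qed

lemma trajectory_absolutely_integrable:
  assumes X: "trajectory T k c D f X v" and k: "nonneg_L1 T k" and ab: "0 \<le> a" "a \<le> b" "b \<le> T"
  shows "v absolutely_integrable_on {a..b}"
proof (rule absolutely_integrable_bound_AE)
  show "v integrable_on {a..b}" using trajectory_has_integral[OF X ab] by blast
  show "(\<lambda>t. k t * (1 + norm (X t))) absolutely_integrable_on {a..b}"
    by (rule trajectory_bound_integrable[OF X k ab(1,3)])
  show "AE t in lebesgue. t \<in> {a..b} \<longrightarrow> norm (v t) \<le> k t * (1 + norm (X t))"
    using trajectoryD(3)[OF X] by eventually_elim (use ab in auto)
qed auto

text \<open>The growth bound on the speed has no preferred direction of time, so Gronwall's
  inequality for \<open>1 + norm (X t)\<close> works both ways and either end controls the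
  other.\<close>

lemma trajectory_growth:
  assumes X: "trajectory T k c D f X v" and k: "nonneg_L1 T k" and n: "integral {0..T} k \<le> real n / 2"
    and t: "t \<in> {0..T}" "t' \<in> {0..T}"
  shows "1 + norm (X t) \<le> 2 ^ n * (1 + norm (X t'))"
proof -
  let ?u = "\<lambda>t. 1 + norm (X t)"
  have k_int: "k integrable_on {a..b}" if "0 \<le> a" "b \<le> T" for a b
  proof -
    have "{a..b} \<subseteq> {0..T}" using that by auto
    then have "k absolutely_integrable_on {a..b}"
      using k absolutely_integrable_on_subinterval unfolding nonneg_L1_def by blast
    then show ?thesis using set_lebesgue_integral_eq_integral(1) by blast
  qed
  have k0: "0 \<le> k t" if "t \<in> {0..T}" for t using k that by (auto simp: nonneg_L1_def)
  have ku_int: "(\<lambda>t. k t * ?u t) integrable_on {a..b}" if "0 \<le> a" "b \<le> T" for a b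
    using trajectory_bound_integrable[OF X k that] set_lebesgue_integral_eq_integral by blast
  have *: "norm (X b - X a) \<le> integral {a..b} (\<lambda>t. k t * ?u t)" if "0 \<le> a" "a \<le> b" "b \<le> T" for a b
  proof -
    have "norm (integral {a..b} v) \<le> integral {a..b} (\<lambda>t. k t * ?u t)"
    proof (rule integral_norm_bound_AE)
      show "AE t in lebesgue. t \<in> {a..b} \<longrightarrow> norm (v t) \<le> k t * ?u t"
        using trajectoryD(3)[OF X] by eventually_elim (use that in auto)
    qed (use trajectory_has_integral[OF X that] that in \<open>auto intro: ku_int\<close>)
    then show ?thesis using trajectory_has_integral[OF X that] by (simp add: integral_unique)
  qed
  have sub: "integral {a..b} k \<le> real n / 2" if "0 \<le> a" "b \<le> T" for a b
  proof -
    have "integral {a..b} k \<le> integral {0..T} k"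
      using that k0 by (intro integral_subset_le k_int) auto
    then show ?thesis using n by simp
  qed
  show ?thesis
  proof (cases "t \<le> t'")
    case True
    show ?thesis
    proof (rule gronwall_backward[of k t t' ?u])
      fix r assume r: "r \<in> {t..t'}"
      have "norm (X r) \<le> norm (X t') + norm (X t' - X r)" by norm
      with * [of r t'] r t show "?u r \<le> ?u t' + integral {r..t'} (\<lambda>t. k t * ?u t)" by auto
    next
      show "integral {t..t'} k \<le> real n / 2" by (rule sub) (use t in auto)
    qed (use t k0 True in \<open>auto intro!: k_int ku_int\<close>)
  next
    case False
    show ?thesis
    proof (rule gronwall_forward[of k t' t ?u])
      fix r assume r: "r \<in> {t'..t}"
      have "norm (X r) \<le> norm (X t') + norm (X r - X t')" by norm
      with * [of t' r] r t show "?u r \<le> ?u t' + integral {t'..r} (\<lambda>t. k t * ?u t)" by auto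
    next
      show "integral {t'..t} k \<le> real n / 2" by (rule sub) (use t in auto)
    qed (use t k0 False in \<open>auto intro!: k_int ku_int\<close>)
  qed
qed

text \<open>The derivative of \<open>(norm (X t - Y t))\<^sup>2\<close> is
  \<open>2 * ((V t - v t) \<bullet> (X t - Y t))\<close>, bounded below only. Integrating up to
  \<open>T\<close> therefore bounds the distance at earlier times by the final one; the sign of the
  hypothesis dictates the direction. The term \<open>h\<close> leaves room for velocities that come
  from different fields.\<close>

lemma one_sided_gronwall:
  fixes X Y V v :: "real \<Rightarrow> 'a::euclidean_space"
  assumes c: "nonneg_L1 T c" and h: "h integrable_on {0..T}" "\<And>t. 0 \<le> h t"
    and X: "abs_continuous_on 0 T X"
      "AE t in lebesgue. t \<in> {0..T} \<longrightarrow> (X has_vector_derivative V t) (at t within {0..T})"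
    and Y: "abs_continuous_on 0 T Y"
      "AE t in lebesgue. t \<in> {0..T} \<longrightarrow> (Y has_vector_derivative v t) (at t within {0..T})"
    and le: "AE t in lebesgue. t \<in> {0..T} \<longrightarrow>
        - ((V t - v t) \<bullet> (X t - Y t)) \<le> c t * (norm (X t - Y t))\<^sup>2 + h t"
    and m: "integral {0..T} (\<lambda>t. 2 * c t) \<le> real m / 2" and t: "t \<in> {0..T}"
  shows "(norm (X t - Y t))\<^sup>2 \<le> 2 ^ m * ((norm (X T - Y T))\<^sup>2 + 2 * integral {0..T} h)"
proof -
  define u where "u t = (norm (X t - Y t))\<^sup>2" for t
  have u_cont: "continuous_on {0..T} u"
    unfolding u_def by (intro continuous_intros abs_continuous_on_imp_continuous_on X Y)
  have "(\<lambda>t. u t * (2 * c t)) absolutely_integrable_on {0..T}"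
    using c u_cont
    by (intro absolutely_integrable_bounded_measurable_product_real
        continuous_imp_measurable_on_sets_lebesgue compact_imp_bounded compact_continuous_image)
      (auto simp: nonneg_L1_def)
  then have "(\<lambda>t. 2 * c t * u t) absolutely_integrable_on {0..T}"
    by (simp add: mult.commute)
  then have cu: "(\<lambda>t. 2 * c t * u t) integrable_on {0..T}"
    using set_lebesgue_integral_eq_integral by blast
  have c_int: "(\<lambda>t. 2 * c t) integrable_on {0..T}"
    using c set_lebesgue_integral_eq_integral(1) unfolding nonneg_L1_def by (blast intro: integrable_on_mult_right)
  have "u t \<le> 2 ^ m * (u T + 2 * integral {0..T} h)"
  proof (rule gronwall_backward[OF c_int _ _ cu _ m t])
    fix t assume t: "t \<in> {0..T}"
    let ?w = "\<lambda>t. 2 * ((V t - v t) \<bullet> (X t - Y t))"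
    have ivl: "{t..T} \<subseteq> {0..T}" using t by auto
    have "(?w has_integral u T - u t) {t..T}"
    proof (rule abs_continuous_on_has_integral)
      show "t \<le> T" using t by simp
      have "abs_continuous_on 0 T (\<lambda>t. (X t - Y t) \<bullet> (X t - Y t))"
        by (intro abs_continuous_on_bilinear[OF bounded_bilinear_inner] abs_continuous_on_diff X Y)
      then show "abs_continuous_on t T u"
        unfolding u_def power2_norm_eq_inner using t by (auto intro: abs_continuous_on_subinterval)
      show "AE r in lebesgue. r \<in> {t..T} \<longrightarrow> (u has_vector_derivative ?w r) (at r within {t..T})"
        using X(2) Y(2)
      proof eventually_elim
        case (elim r)
        show ?case
        proof
          assume r: "r \<in> {t..T}"
          then have "((\<lambda>t. X t - Y t) has_vector_derivative V r - v r) (at r within {t..T})"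
            using elim ivl by (intro has_vector_derivative_diff) (auto intro: has_vector_derivative_within_subset)
          from bounded_bilinear.has_vector_derivative[OF bounded_bilinear_inner this this]
          show "(u has_vector_derivative ?w r) (at r within {t..T})"
            unfolding u_def power2_norm_eq_inner by (simp add: inner_commute)
        qed
      qed
    qed
    then have w: "?w integrable_on {t..T}" "integral {t..T} ?w = u T - u t"
      by (rule has_integral_integrable, rule integral_unique)
    have ints: "h integrable_on {t..T}" "(\<lambda>t. 2 * c t * u t) integrable_on {t..T}"
      using integrable_on_subinterval[OF h(1) ivl] integrable_on_subinterval[OF cu ivl] by auto
    have "integral {t..T} (\<lambda>r. - ?w r) \<le> integral {t..T} (\<lambda>r. 2 * c r * u r + 2 * h r)"
    proof (intro integral_le_AE integrable_add integrable_neg integrable_on_mult_right)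
      show "AE r in lebesgue. r \<in> {t..T} \<longrightarrow> - ?w r \<le> 2 * c r * u r + 2 * h r"
        using le
      proof eventually_elim
        case (elim r)
        show ?case
        proof
          assume "r \<in> {t..T}"
          then have "- ((V r - v r) \<bullet> (X r - Y r)) \<le> c r * u r + h r" using elim ivl unfolding u_def by blast
          then show "- ?w r \<le> 2 * c r * u r + 2 * h r" by simp
        qed
      qed
    qed (use w ints in auto)
    also have "\<dots> = integral {t..T} (\<lambda>r. 2 * c r * u r) + 2 * integral {t..T} h"
      using ints by (subst Henstock_Kurzweil_Integration.integral_add) (auto intro: integrable_on_mult_right)
    also have "integral {t..T} h \<le> integral {0..T} h"
      using h ivl by (intro integral_subset_le ints) auto
    finally show "u t \<le> u T + 2 * integral {0..T} h + integral {t..T} (\<lambda>r. 2 * c r * u r)"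
      using w by simp
  qed (use c in \<open>auto simp: u_def nonneg_L1_def\<close>)
  then show ?thesis by (simp add: u_def)
qed

text \<open>Both velocities belong to the same monotone extension, so the error term vanishes. The
  factor depends on \<open>c\<close> alone, which yields uniqueness as well as the Lipschitz bound
  of the flow.\<close>

lemma trajectory_lipschitz:
  assumes T: "0 \<le> T" and c: "nonneg_L1 T c" and D: "closure D = UNIV"
    and f: "AE t in lebesgue. t \<in> {0..T} \<longrightarrow> linear_growth (k t) (f t)"
    and X: "trajectory T k c D f X w" and Y: "trajectory T k c D f Y v"
    and m: "integral {0..T} (\<lambda>t. 2 * c t) \<le> real m / 2" and t: "t \<in> {0..T}"
  shows "norm (X t - Y t) \<le> sqrt (2 ^ m) * norm (X T - Y T)"
proof -
  have "(norm (X t - Y t))\<^sup>2 \<le> 2 ^ m * ((norm (X T - Y T))\<^sup>2 + 2 * integral {0..T} (\<lambda>_. 0))"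
  proof (rule one_sided_gronwall[OF c _ _ trajectoryD(1,2)[OF X] trajectoryD(1,2)[OF Y] _ m t])
    show "AE t in lebesgue. t \<in> {0..T} \<longrightarrow>
        - ((w t - v t) \<bullet> (X t - Y t)) \<le> c t * (norm (X t - Y t))\<^sup>2 + 0"
      using f trajectoryD(4)[OF X] trajectoryD(4)[OF Y]
    proof eventually_elim
      case (elim t)
      show ?case
      proof
        assume "t \<in> {0..T}"
        with elim have "- c t * (norm (X t - Y t))\<^sup>2 \<le> (w t - v t) \<bullet> (X t - Y t)"
          by (intro monotone_extension_monotone[OF D]) auto
        then show "- ((w t - v t) \<bullet> (X t - Y t)) \<le> c t * (norm (X t - Y t))\<^sup>2 + 0" by simp
      qed
    qed
  qed auto
  then have "(norm (X t - Y t))\<^sup>2 \<le> (sqrt (2 ^ m) * norm (X T - Y T))\<^sup>2"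
    by (simp add: power_mult_distrib)
  then show ?thesis by (rule power2_le_imp_le) simp
qed

section \<open>Stability of trajectories under convergence of the fields on \<open>D\<close>\<close>

context
  fixes T :: real and k c :: "real \<Rightarrow> real" and D :: "'a::euclidean_space set"
    and F :: "nat \<Rightarrow> real \<Rightarrow> 'a \<Rightarrow> 'a" and f :: "real \<Rightarrow> 'a \<Rightarrow> 'a"
    and X V :: "nat \<Rightarrow> real \<Rightarrow> 'a" and Y v :: "real \<Rightarrow> 'a"
  assumes T: "0 \<le> T" and k: "nonneg_L1 T k" and c: "nonneg_L1 T c" and D: "closure D = UNIV"
    and f: "AE t in lebesgue. t \<in> {0..T} \<longrightarrow> linear_growth (k t) (f t)"
    and F: "AE t in lebesgue. t \<in> {0..T} \<longrightarrow> (\<forall>q\<in>D. (\<lambda>n. F n t q) \<longlonglongrightarrow> f t q)"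
    and X: "\<And>n. trajectory T k c D (F n) (X n) (V n)" and Y: "trajectory T k c D f Y v"
    and lim: "(\<lambda>n. X n T) \<longlonglongrightarrow> Y T"
begin

lemma trajectories_bounded:
  obtains B where "0 \<le> B" "\<And>n t. t \<in> {0..T} \<Longrightarrow> norm (X n t) \<le> B" "\<And>t. t \<in> {0..T} \<Longrightarrow> norm (Y t) \<le> B"
proof -
  obtain m where m: "integral {0..T} k \<le> real m / 2" using nonneg_L1_integral_bound by blast
  have "bounded (range (\<lambda>n. X n T))" using lim convergent_imp_bounded by blast
  then obtain C where C: "\<And>n. norm (X n T) \<le> C" unfolding bounded_iff by auto
  define C' where "C' = max C (norm (Y T))"
  have C': "norm (X n T) \<le> C'" "norm (Y T) \<le> C'" for n using C[of n] by (auto simp: C'_def)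
  define B where "B = 2 ^ m * (1 + C')"
  have "norm (X n t) \<le> B" if "t \<in> {0..T}" for n t
  proof -
    have "1 + norm (X n t) \<le> 2 ^ m * (1 + norm (X n T))"
      using trajectory_growth[OF X k m that] T by simp
    also have "\<dots> \<le> B" unfolding B_def using C' by (intro mult_left_mono) auto
    finally show ?thesis by simp
  qed
  moreover have "norm (Y t) \<le> B" if "t \<in> {0..T}" for t
  proof -
    have "1 + norm (Y t) \<le> 2 ^ m * (1 + norm (Y T))"
      using trajectory_growth[OF Y k m that] T by simp
    also have "\<dots> \<le> B" unfolding B_def using C' by (intro mult_left_mono) auto
    finally show ?thesis by simp
  qed
  moreover have "0 \<le> C'" using C'(2) norm_ge_zero order_trans by blast
  then have "0 \<le> B" by (simp add: B_def)
  ultimately show ?thesis using that by blast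
qed

lemma k_integrable: "integrable (lebesgue_on {0..T}) k"
  using k by (simp add: nonneg_L1_def absolutely_integrable_on_iff_integrable)

lemma c_integrable: "integrable (lebesgue_on {0..T}) c"
  using c by (simp add: nonneg_L1_def absolutely_integrable_on_iff_integrable)

lemma velocities_measurable:
  "V n \<in> borel_measurable (lebesgue_on {0..T})" "v \<in> borel_measurable (lebesgue_on {0..T})"
  "X n \<in> borel_measurable (lebesgue_on {0..T})" "Y \<in> borel_measurable (lebesgue_on {0..T})"
  using trajectory_has_integral[OF X order_refl T order_refl] trajectory_has_integral[OF Y order_refl T order_refl]
  by (auto intro: integrable_imp_measurable
      continuous_imp_measurable_on_sets_lebesgue trajectory_continuous[OF X] trajectory_continuous[OF Y])

lemma velocity_bounds:
  assumes B: "\<And>n t. t \<in> {0..T} \<Longrightarrow> norm (X n t) \<le> B" "\<And>t. t \<in> {0..T} \<Longrightarrow> norm (Y t) \<le> B"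
  shows "AE t in lebesgue. t \<in> {0..T} \<longrightarrow> (\<forall>n. norm (V n t) \<le> k t * (1 + B)) \<and> norm (v t) \<le> k t * (1 + B)"
proof -
  have 1: "AE t in lebesgue. \<forall>n. t \<in> {0..T} \<longrightarrow> norm (V n t) \<le> k t * (1 + norm (X n t))"
    unfolding AE_all_countable using X by (simp add: trajectory_def)
  have 2: "AE t in lebesgue. t \<in> {0..T} \<longrightarrow> norm (v t) \<le> k t * (1 + norm (Y t))"
    using Y by (simp add: trajectory_def)
  show ?thesis
    using 1 2
  proof eventually_elim
    case (elim t)
    have *: "k t * (1 + y) \<le> k t * (1 + B)" if "t \<in> {0..T}" "y \<le> B" for y
      using that k by (intro mult_left_mono) (auto simp: nonneg_L1_def)
    show ?case
      using elim *[OF _ B(1)] *[OF _ B(2)] by (meson order_trans)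
  qed
qed

text \<open>The deficits \<open>h n\<close> tend to zero for almost every time and are dominated by
  a multiple of \<open>k\<close>, so their integrals vanish in the limit. Gronwall's inequality then
  bounds the distance by these integrals and the final distance, uniformly in
  \<open>t\<close>.\<close>

lemma uniform_limit_trajectories: "uniform_limit {0..T} X Y sequentially"
proof -
  obtain B where B: "0 \<le> B" "\<And>n t. t \<in> {0..T} \<Longrightarrow> norm (X n t) \<le> B" "\<And>t. t \<in> {0..T} \<Longrightarrow> norm (Y t) \<le> B"
    using trajectories_bounded by blast
  have bounds: "AE t in lebesgue. t \<in> {0..T} \<longrightarrow> (\<forall>n. norm (V n t) \<le> k t * (1 + B)) \<and> norm (v t) \<le> k t * (1 + B)"
    by (rule velocity_bounds) (use B in auto)
  note [measurable] = velocities_measurable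
  \<comment> \<open>The least nonnegative error for which the inequality required by
    \<open>one_sided_gronwall\<close> holds identically.\<close>
  define h where "h n t = max 0 (- ((V n t - v t) \<bullet> (X n t - Y t) + c t * (norm (X n t - Y t))\<^sup>2))" for n t
  define g where "g t = 2 * (k t * (1 + B)) * (2 * B)" for t
  have c0: "0 \<le> c t" if "t \<in> {0..T}" for t using c that by (auto simp: nonneg_L1_def)
  have h0: "0 \<le> h n t" for n t by (simp add: h_def)
  have c_meas[measurable]: "c \<in> borel_measurable (lebesgue_on {0..T})" using c_integrable by auto
  have h_meas: "h n \<in> borel_measurable (lebesgue_on {0..T})" for n
    unfolding h_def by measurable
  have g_int: "integrable (lebesgue_on {0..T}) g"
    unfolding g_def using k_integrable by auto
  have h_le: "AE t in lebesgue. t \<in> {0..T} \<longrightarrow> (\<forall>n. norm (h n t) \<le> g t)"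
    using bounds
  proof eventually_elim
    case (elim t)
    show ?case
    proof (intro impI allI)
      fix n assume t: "t \<in> {0..T}"
      have "\<bar>(V n t - v t) \<bullet> (X n t - Y t)\<bar> \<le> norm (V n t - v t) * norm (X n t - Y t)"
        by (rule Cauchy_Schwarz_ineq2)
      also have "\<dots> \<le> (2 * (k t * (1 + B))) * (2 * B)"
      proof (intro mult_mono)
        have "norm (V n t - v t) \<le> norm (V n t) + norm (v t)" by (rule norm_triangle_ineq4)
        also have "\<dots> \<le> k t * (1 + B) + k t * (1 + B)" using elim t by (intro add_mono) auto
        finally show "norm (V n t - v t) \<le> 2 * (k t * (1 + B))" by simp
        have "norm (X n t - Y t) \<le> norm (X n t) + norm (Y t)" by (rule norm_triangle_ineq4)
        then show "norm (X n t - Y t) \<le> 2 * B" using B(2)[OF t, of n] B(3)[OF t] by simp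
        show "0 \<le> 2 * (k t * (1 + B))" using elim t norm_ge_zero order_trans by (smt (verit))
      qed auto
      finally have "\<bar>(V n t - v t) \<bullet> (X n t - Y t)\<bar> \<le> g t" by (simp add: g_def)
      \<comment> \<open>The term with \<open>c\<close> can only lower the deficit, so the dominating
        function \<open>g\<close> is built from \<open>k\<close> alone.\<close>
      moreover have "0 \<le> c t * (norm (X n t - Y t))\<^sup>2" using c0[OF t] by simp
      ultimately show "norm (h n t) \<le> g t" unfolding h_def by auto
    qed
  qed
  have V_in: "AE t in lebesgue. \<forall>n. t \<in> {0..T} \<longrightarrow> V n t \<in> monotone_extension D (c t) (F n t) (X n t)"
    unfolding AE_all_countable using X by (simp add: trajectory_def)
  have v_in: "AE t in lebesgue. t \<in> {0..T} \<longrightarrow> v t \<in> monotone_extension D (c t) (f t) (Y t)"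
    using Y by (simp add: trajectory_def)
  have h_lim: "AE t in lebesgue. t \<in> {0..T} \<longrightarrow> (\<lambda>n. h n t) \<longlonglongrightarrow> 0"
    using bounds f F V_in v_in
  proof eventually_elim
    case (elim t)
    show ?case
      unfolding h_def using elim B
      by (intro impI monotone_extension_deficit_tendsto_0[OF D, where F = "\<lambda>n. F n t" and f = "f t"]) auto
  qed
  have h_int: "integrable (lebesgue_on {0..T}) (h n)" for n
    by (rule Bochner_Integration.integrable_bound[OF g_int h_meas])
      (use h_le in \<open>auto simp: AE_lebesgue_on_iff elim!: eventually_mono intro: order_trans[OF _ abs_ge_self]\<close>)
  define H where "H n = integral {0..T} (h n)" for n
  have "H \<longlonglongrightarrow> 0"
  proof -
    have "(\<lambda>n. integral\<^sup>L (lebesgue_on {0..T}) (h n)) \<longlonglongrightarrow> integral\<^sup>L (lebesgue_on {0..T}) (\<lambda>t. 0)"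
      by (rule integral_dominated_convergence[OF _ h_meas g_int])
        (use h_le h_lim in \<open>auto simp: AE_lebesgue_on_iff elim!: eventually_mono\<close>)
    then show ?thesis
      unfolding H_def using h_int by (simp add: lebesgue_integral_eq_integral)
  qed
  define u where "u n t = (norm (X n t - Y t))\<^sup>2" for n t
  obtain m where m: "integral {0..T} (\<lambda>t. 2 * c t) \<le> real m / 2" using nonneg_L1_integral_bound by blast
  have u_le: "u n t \<le> 2 ^ m * (u n T + 2 * H n)" if "t \<in> {0..T}" for n t
    unfolding u_def H_def
  proof (rule one_sided_gronwall[OF c _ h0 trajectoryD(1,2)[OF X] trajectoryD(1,2)[OF Y] _ m that])
    show "h n integrable_on {0..T}" using h_int by (simp add: integrable_on_lebesgue_on)
    have "- ((V n t - v t) \<bullet> (X n t - Y t)) \<le> c t * (norm (X n t - Y t))\<^sup>2 + h n t" for t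
      by (simp add: h_def)
    then show "AE t in lebesgue. t \<in> {0..T} \<longrightarrow>
        - ((V n t - v t) \<bullet> (X n t - Y t)) \<le> c t * (norm (X n t - Y t))\<^sup>2 + h n t" by simp
  qed
  define A where "A n = 2 ^ m * (u n T + 2 * H n)" for n
  have "(\<lambda>n. u n T) \<longlonglongrightarrow> (norm (Y T - Y T))\<^sup>2" unfolding u_def by (intro tendsto_intros lim)
  then have "A \<longlonglongrightarrow> 2 ^ m * ((norm (Y T - Y T))\<^sup>2 + 2 * 0)"
    unfolding A_def by (intro tendsto_intros \<open>H \<longlonglongrightarrow> 0\<close>)
  then have A: "A \<longlonglongrightarrow> 0" by simp
  show ?thesis
    unfolding uniform_limit_iff
  proof (intro allI impI)
    fix e :: real assume "0 < e"
    then have "0 < e\<^sup>2" by simp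
    with A have "eventually (\<lambda>n. A n < e\<^sup>2) sequentially" using order_tendstoD(2) by blast
    then show "\<forall>\<^sub>F n in sequentially. \<forall>t\<in>{0..T}. dist (X n t) (Y t) < e"
    proof eventually_elim
      case (elim n)
      show ?case
      proof
        fix t assume t: "t \<in> {0..T}"
        have "(norm (X n t - Y t))\<^sup>2 < e\<^sup>2" using u_le[OF t, of n] elim by (simp add: u_def A_def)
        then show "dist (X n t) (Y t) < e"
          using \<open>0 < e\<close> by (simp add: dist_norm power_less_imp_less_base)
      qed
    qed
  qed
qed

text \<open>Positions converge uniformly, and where the limit extension is single-valued this forces
  convergence of the velocities; domination by \<open>2 * (k t * (1 + B))\<close> finishes. The
  interval starts at \<open>s\<close> because at earlier times a trajectory may stay inside the
  discontinuities of the field for a set of times of positive measure.\<close>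

lemma velocities_tendsto:
  assumes s: "0 \<le> s" and ca: "AE t in lebesgue. t \<in> {s..T} \<longrightarrow> cauchy_at D (f t) (Y t)"
  shows "(\<lambda>n. integral {s..T} (\<lambda>t. norm (V n t - v t))) \<longlonglongrightarrow> 0"
proof -
  have sub: "{s..T} \<subseteq> {0..T}" using s by auto
  obtain B where B: "0 \<le> B" "\<And>n t. t \<in> {0..T} \<Longrightarrow> norm (X n t) \<le> B" "\<And>t. t \<in> {0..T} \<Longrightarrow> norm (Y t) \<le> B"
    using trajectories_bounded by blast
  have bounds: "AE t in lebesgue. t \<in> {0..T} \<longrightarrow> (\<forall>n. norm (V n t) \<le> k t * (1 + B)) \<and> norm (v t) \<le> k t * (1 + B)"
    by (rule velocity_bounds) (use B in auto)
  have V_in: "AE t in lebesgue. \<forall>n. t \<in> {0..T} \<longrightarrow> V n t \<in> monotone_extension D (c t) (F n t) (X n t)"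
    unfolding AE_all_countable using X by (simp add: trajectory_def)
  have v_in: "AE t in lebesgue. t \<in> {0..T} \<longrightarrow> v t \<in> monotone_extension D (c t) (f t) (Y t)"
    using Y by (simp add: trajectory_def)
  have "AE t in lebesgue. t \<in> {s..T} \<longrightarrow> (\<lambda>n. V n t) \<longlonglongrightarrow> v t"
    using bounds F V_in v_in ca
  proof eventually_elim
    case (elim t)
    show ?case
    proof
      assume t': "t \<in> {s..T}"
      then have t: "t \<in> {0..T}" using sub by blast
      have "(\<lambda>n. X n t) \<longlonglongrightarrow> Y t" using uniform_limit_trajectories t by (rule tendsto_uniform_limitI)
      show "(\<lambda>n. V n t) \<longlonglongrightarrow> v t"
      proof (rule monotone_extension_tendsto[OF D _ _ _ \<open>(\<lambda>n. X n t) \<longlonglongrightarrow> Y t\<close>])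
        show "V n t \<in> monotone_extension D (c t) (F n t) (X n t)" for n using elim(3) t by blast
        show "v t \<in> monotone_extension D (c t) (f t) (Y t)" using elim(4) t by blast
        show "(\<lambda>n. F n t q) \<longlonglongrightarrow> f t q" if "q \<in> D" for q using elim(2) t that by blast
        show "norm (V n t) \<le> k t * (1 + B)" for n using elim(1) t by blast
        show "cauchy_at D (f t) (Y t)" using elim(5) t' by blast
      qed
    qed
  qed
  then have lim0: "AE t in lebesgue_on {s..T}. (\<lambda>n. norm (V n t - v t)) \<longlonglongrightarrow> 0"
    unfolding AE_lebesgue_on_iff[OF lmeasurable_interval(1)[of s T, unfolded box_real, THEN fmeasurableD]]
    by eventually_elim (simp add: LIM_zero_iff tendsto_norm_zero)
  have meas: "(\<lambda>t. norm (V n t - v t)) \<in> borel_measurable (lebesgue_on {s..T})" for n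
  proof -
    have [measurable]: "V n \<in> borel_measurable (lebesgue_on {s..T})" "v \<in> borel_measurable (lebesgue_on {s..T})"
      using measurable_restrict_mono[OF velocities_measurable(1) sub]
        measurable_restrict_mono[OF velocities_measurable(2) sub] by auto
    show ?thesis by measurable
  qed
  define g where "g t = 2 * (k t * (1 + B))" for t
  have "integrable (lebesgue_on {0..T}) g"
    unfolding g_def using k_integrable by auto
  then have g_int: "integrable (lebesgue_on {s..T}) g" using sub by (rule integrable_subinterval)
  have le: "AE t in lebesgue_on {s..T}. \<forall>n. norm (norm (V n t - v t)) \<le> g t"
    unfolding AE_lebesgue_on_iff[OF lmeasurable_interval(1)[of s T, unfolded box_real, THEN fmeasurableD]]
    using bounds
  proof eventually_elim
    case (elim t)
    show ?case
    proof (intro impI allI)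
      fix n assume t: "t \<in> {s..T}"
      have "norm (V n t - v t) \<le> norm (V n t) + norm (v t)" by (rule norm_triangle_ineq4)
      also have "\<dots> \<le> k t * (1 + B) + k t * (1 + B)" using elim t sub by (intro add_mono) blast+
      finally show "norm (norm (V n t - v t)) \<le> g t" by (simp add: g_def)
    qed
  qed
  have "(\<lambda>n. integral\<^sup>L (lebesgue_on {s..T}) (\<lambda>t. norm (V n t - v t))) \<longlonglongrightarrow> integral\<^sup>L (lebesgue_on {s..T}) (\<lambda>t. 0::real)"
    by (rule integral_dominated_convergence[OF _ meas g_int])
      (use le lim0 in \<open>auto elim!: eventually_mono\<close>)
  moreover have "integrable (lebesgue_on {s..T}) (\<lambda>t. norm (V n t - v t))" for n
    by (rule Bochner_Integration.integrable_bound[OF g_int meas])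
      (use le in \<open>auto elim!: eventually_mono intro: order_trans[OF _ abs_ge_self]\<close>)
  ultimately show ?thesis by (simp add: lebesgue_integral_eq_integral)
qed

end

lemma trajectory_unique:
  assumes "0 \<le> T" "nonneg_L1 T c" "closure D = UNIV"
    and "AE t in lebesgue. t \<in> {0..T} \<longrightarrow> linear_growth (k t) (f t)"
    and "trajectory T k c D f X w" "trajectory T k c D f Y v" and "X T = Y T" and "t \<in> {0..T}"
  shows "X t = Y t"
proof -
  obtain m where "integral {0..T} (\<lambda>t. 2 * c t) \<le> real m / 2" using nonneg_L1_integral_bound by blast
  from trajectory_lipschitz[OF assms(1-6) this assms(8)] assms(7) show ?thesis by simp
qed

section \<open>The fundamental lemma of the calculus of variations\<close>

text \<open>The derivative of \<open>p / w\<^sup>j * exp (- \<kappa> / w)\<close>, where \<open>w x = (x - c) * (d - x)\<close>, is of the same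
  form, with exponent \<open>j + 2\<close>.\<close>

definition bump :: "real poly \<Rightarrow> nat \<Rightarrow> real \<Rightarrow> real \<Rightarrow> real \<Rightarrow> real \<Rightarrow> real" where
  "bump p j \<kappa> c d x =
     (let w = (x - c) * (d - x) in if 0 < w then poly p x / w ^ j * exp (- \<kappa> / w) else 0)"

text \<open>One term of the exponential series. It makes \<open>exp (- \<kappa> / w)\<close> smaller
  than any prescribed power of \<open>w\<close>.\<close>

lemma power_le_fact_exp:
  fixes u :: real
  assumes "0 \<le> u"
  shows "u ^ m \<le> fact m * exp u"
proof -
  have "sum (\<lambda>n. u ^ n /\<^sub>R fact n) {m} \<le> (\<Sum>n. u ^ n /\<^sub>R fact n)"
    using assms by (intro sum_le_suminf sums_summable[OF exp_converges]) auto
  then have "u ^ m / fact m \<le> exp u"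
    using sums_unique[OF exp_converges[of u]] by (simp add: divide_inverse mult.commute)
  then show ?thesis by (simp add: field_simps)
qed

lemma DERIV_zero_quadratic:
  fixes f :: "real \<Rightarrow> real"
  assumes "f x = 0" "0 < \<delta>" "\<And>y. \<bar>y - x\<bar> < \<delta> \<Longrightarrow> \<bar>f y\<bar> \<le> K * (y - x)\<^sup>2"
  shows "(f has_real_derivative 0) (at x)"
  unfolding has_field_derivative_iff
proof (rule Lim_null_comparison)
  show "\<forall>\<^sub>F y in at x. norm ((f y - f x) / (y - x)) \<le> K * \<bar>y - x\<bar>"
    unfolding eventually_at
  proof (intro exI[of _ \<delta>] conjI ballI impI assms(2))
    fix y assume y: "y \<noteq> x \<and> dist y x < \<delta>"
    then have "\<bar>f y\<bar> \<le> K * \<bar>y - x\<bar> * \<bar>y - x\<bar>" using assms(3)[of y] by (simp add: dist_real_def power2_eq_square abs_mult[symmetric] mult.assoc)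
    then show "norm ((f y - f x) / (y - x)) \<le> K * \<bar>y - x\<bar>"
      using y assms(1) by (simp add: pos_divide_le_eq)
  qed
  have "((\<lambda>y. K * \<bar>y - x\<bar>) \<longlongrightarrow> K * \<bar>x - x\<bar>) (at x)" by (intro tendsto_intros)
  then show "((\<lambda>y. K * \<bar>y - x\<bar>) \<longlongrightarrow> 0) (at x)" by simp
qed

text \<open>Only the zeros of \<open>w\<close> need an argument. There the exponential beats the
  factor \<open>1 / w ^ j\<close> with two powers of \<open>w\<close> to spare, so the function is
  quadratically small and has derivative zero, which is also the value of the new bump.\<close>

lemma bump_has_derivative:
  assumes "0 < \<kappa>"
  shows "\<exists>p'. \<forall>x. (bump p j \<kappa> c d has_real_derivative bump p' (j + 2) \<kappa> c d x) (at x)"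
proof -
  define W :: "real poly" where "W = [:- c * d, c + d, - 1:]"
  \<comment> \<open>The numerator after differentiating
    \<open>p / W ^ j * exp (- \<kappa> / W)\<close> over the common denominator
    \<open>W ^ (j + 2)\<close>; the last summand comes from the exponential.\<close>
  define p' where "p' = pderiv p * W\<^sup>2 - smult (real j) (p * pderiv W * W) + smult \<kappa> (p * pderiv W)"
  have W: "poly W x = (x - c) * (d - x)" for x by (simp add: W_def algebra_simps)
  have bump_eq: "bump p j \<kappa> c d x = (if 0 < poly W x then poly p x / poly W x ^ j * exp (- \<kappa> / poly W x) else 0)"
    for p j x by (simp add: bump_def W Let_def)
  have "(bump p j \<kappa> c d has_real_derivative bump p' (j + 2) \<kappa> c d x) (at x)" for x
  proof -
    consider "0 < poly W x" | "poly W x < 0" | "poly W x = 0" by linarith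
    then show ?thesis
    proof cases
      case 1
      let ?g = "\<lambda>x. poly p x / poly W x ^ j * exp (- \<kappa> / poly W x)"
      have "(?g has_real_derivative bump p' (j + 2) \<kappa> c d x) (at x)"
      proof (cases j)
        case 0
        then show ?thesis using 1
          apply (auto intro!: derivative_eq_intros)
          apply (simp add: bump_eq p'_def field_simps power2_eq_square)
          done
      next
        case (Suc i)
        then show ?thesis using 1
          apply (auto intro!: derivative_eq_intros)
          apply (simp add: bump_eq p'_def field_simps power2_eq_square)
          apply (cases i; simp)
          done
      qed
      moreover have "open {y. 0 < poly W y}" by (intro open_Collect_less continuous_intros)
      ultimately show ?thesis
        by (rule has_field_derivative_transform_within_open) (simp_all add: bump_eq 1)
    next
      case 2
      have "((\<lambda>_. 0) has_real_derivative bump p' (j + 2) \<kappa> c d x) (at x)"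
        using 2 by (simp add: bump_eq)
      moreover have "open {y. poly W y < 0}" by (intro open_Collect_less continuous_intros)
      ultimately show ?thesis
        by (rule has_field_derivative_transform_within_open) (use 2 in \<open>simp_all add: bump_eq\<close>)
    next
      case 3
      have "bounded (poly p ` {x - 1..x + 1})"
        by (intro compact_imp_bounded compact_continuous_image continuous_intros) auto
      then obtain M where M: "0 < M" "\<And>y. \<bar>y - x\<bar> \<le> 1 \<Longrightarrow> \<bar>poly p y\<bar> \<le> M"
        unfolding bounded_pos by (force simp: abs_le_iff)
      \<comment> \<open>As \<open>W\<close> vanishes at \<open>x\<close>, it factors as
        \<open>(y - x) * (c + d - y - x)\<close>; \<open>L\<close> bounds the second factor within
        distance 1 of \<open>x\<close>.\<close>
      define L where "L = \<bar>c + d\<bar> + 2 * \<bar>x\<bar> + 1"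
      have L: "0 \<le> L" "\<bar>poly W y\<bar> \<le> L * \<bar>y - x\<bar>" if "\<bar>y - x\<bar> \<le> 1" for y
      proof -
        have "poly W y = (y - x) * (c + d - y - x)"
          using 3 by (simp add: W_def algebra_simps)
        then have "\<bar>poly W y\<bar> = \<bar>y - x\<bar> * \<bar>c + d - y - x\<bar>" by (simp add: abs_mult)
        also have "\<dots> \<le> \<bar>y - x\<bar> * L" using that by (intro mult_left_mono) (auto simp: L_def)
        finally show "\<bar>poly W y\<bar> \<le> L * \<bar>y - x\<bar>" by (simp add: mult.commute)
      qed (simp add: L_def)
      \<comment> \<open>\<open>M\<close> bounds the polynomial, the quotient comes from comparing
        the exponential with the power \<open>j + 2\<close>, and \<open>L\<^sup>2\<close> converts
        \<open>w\<^sup>2\<close> into \<open>(y - x)\<^sup>2\<close>.\<close>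
      define K where "K = M * (fact (j + 2) / \<kappa> ^ (j + 2)) * L\<^sup>2"
      have "\<bar>bump p j \<kappa> c d y\<bar> \<le> K * (y - x)\<^sup>2" if y: "\<bar>y - x\<bar> < 1" for y
      proof (cases "0 < poly W y")
        case True
        define w where "w = poly W y"
        have w: "0 < w" using True by (simp add: w_def)
        have "(\<kappa> / w) ^ (j + 2) \<le> fact (j + 2) * exp (\<kappa> / w)"
          using assms w by (intro power_le_fact_exp) auto
        then have "\<kappa> ^ (j + 2) * exp (- \<kappa> / w) \<le> fact (j + 2) * w ^ (j + 2)"
          using w by (simp add: exp_minus field_simps power_divide)
        then have e: "exp (- \<kappa> / w) \<le> (fact (j + 2) / \<kappa> ^ (j + 2)) * w ^ (j + 2)"
          using assms by (simp add: field_simps)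
        have "\<bar>bump p j \<kappa> c d y\<bar> = \<bar>poly p y\<bar> / w ^ j * exp (- \<kappa> / w)"
          using True by (simp add: bump_eq w_def abs_mult)
        also have "\<dots> \<le> M / w ^ j * ((fact (j + 2) / \<kappa> ^ (j + 2)) * w ^ (j + 2))"
          using M y w e by (intro mult_mono divide_right_mono) auto
        also have "\<dots> = M * (fact (j + 2) / \<kappa> ^ (j + 2)) * w\<^sup>2"
          using w by (simp add: power_add power2_eq_square)
        also have "\<dots> \<le> M * (fact (j + 2) / \<kappa> ^ (j + 2)) * (L * \<bar>y - x\<bar>)\<^sup>2"
          using L(2)[of y] y w M assms by (intro mult_left_mono power_mono) (auto simp: w_def)
        also have "M * (fact (j + 2) / \<kappa> ^ (j + 2)) * (L * \<bar>y - x\<bar>)\<^sup>2 = K * (y - x)\<^sup>2"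
          by (simp add: K_def power_mult_distrib)
        finally show ?thesis .
      next
        case False
        then show ?thesis using M assms by (simp add: bump_eq K_def)
      qed
      then have "(bump p j \<kappa> c d has_real_derivative 0) (at x)"
        using 3 by (intro DERIV_zero_quadratic[of _ _ 1 K]) (auto simp: bump_eq)
      then show ?thesis using 3 by (simp add: bump_eq)
    qed
  qed
  then show ?thesis by blast
qed

lemma bump_higher_deriv:
  assumes "0 < \<kappa>"
  shows "\<exists>p' j'. (deriv ^^ n) (bump p j \<kappa> c d) = bump p' j' \<kappa> c d"
proof (induction n)
  case (Suc n)
  then obtain p' j' where 1: "(deriv ^^ n) (bump p j \<kappa> c d) = bump p' j' \<kappa> c d" by blast
  obtain p'' where "\<forall>x. (bump p' j' \<kappa> c d has_real_derivative bump p'' (j' + 2) \<kappa> c d x) (at x)"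
    using bump_has_derivative[OF assms] by blast
  then have "deriv (bump p' j' \<kappa> c d) = bump p'' (j' + 2) \<kappa> c d"
    by (intro ext DERIV_imp_deriv) auto
  with 1 show ?case by (intro exI[of _ p''] exI[of _ "j' + 2"]) simp
qed auto

lemma test_function_bump:
  assumes "0 < \<kappa>" "a < c" "c < d" "d < b"
  shows "test_function a b (bump 1 0 \<kappa> c d)"
proof -
  have "(deriv ^^ n) (bump 1 0 \<kappa> c d) differentiable_on UNIV" for n
  proof -
    obtain p j where "(deriv ^^ n) (bump 1 0 \<kappa> c d) = bump p j \<kappa> c d"
      using bump_higher_deriv[OF assms(1)] by blast
    moreover obtain p' where "\<forall>x. (bump p j \<kappa> c d has_real_derivative bump p' (j + 2) \<kappa> c d x) (at x)"
      using bump_has_derivative[OF assms(1)] by blast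
    ultimately show ?thesis
      unfolding differentiable_on_def using real_differentiable_def by fastforce
  qed
  moreover have "{t. bump 1 0 \<kappa> c d t \<noteq> 0} = {c<..<d}"
    using assms(3) by (auto simp: bump_def Let_def zero_less_mult_iff)
  ultimately show ?thesis
    using assms by (auto simp: test_function_def)
qed

text \<open>The purpose of the parameter \<open>\<kappa>\<close>: sending it to zero approximates
  the indicator of an open interval by test functions between 0 and 1 with fixed support.\<close>

lemma bump_tendsto_indicator:
  assumes "c < d"
  shows "(\<lambda>n. bump 1 0 (1 / Suc n) c d t) \<longlonglongrightarrow> indicator {c<..<d} t"
proof (cases "t \<in> {c<..<d}")
  case True
  then have w: "0 < (t - c) * (d - t)" by auto
  have "(\<lambda>n. exp (- (1 / real (Suc n)) / ((t - c) * (d - t)))) \<longlonglongrightarrow> exp (- 0 / ((t - c) * (d - t)))"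
    using LIMSEQ_inverse_real_of_nat w
    by (intro tendsto_intros) (auto simp: inverse_eq_divide)
  then show ?thesis using True w by (simp add: bump_def Let_def)
next
  case False
  then have "\<not> 0 < (t - c) * (d - t)" using assms by (auto simp: zero_less_mult_iff)
  then show ?thesis using False by (simp add: bump_def Let_def)
qed

lemma bump_bounded: "0 < \<kappa> \<Longrightarrow> \<bar>bump 1 0 \<kappa> c d t\<bar> \<le> 1"
  by (auto simp: bump_def Let_def)

text \<open>By Henstock's lemma the Riemann sums of \<open>w\<close> differ little from its
  integrals, interval by interval in norm. As all these integrals vanish, the Riemann sums of
  \<open>norm (w t)\<close> are themselves small.\<close>

lemma AE_zero_of_integrals_zero:
  fixes w :: "real \<Rightarrow> 'b::euclidean_space"
  assumes w: "w absolutely_integrable_on {a..b}"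
    and 0: "\<And>c d. a \<le> c \<Longrightarrow> c \<le> d \<Longrightarrow> d \<le> b \<Longrightarrow> integral {c..d} w = 0"
  shows "AE t in lebesgue. t \<in> {a..b} \<longrightarrow> w t = 0"
proof -
  have "((\<lambda>t. norm (w t)) has_integral 0) {a..b}"
    unfolding has_integral_real
  proof (intro allI impI)
    fix e :: real assume "0 < e"
    have "w integrable_on cbox a b" using w set_lebesgue_integral_eq_integral by auto
    then obtain \<gamma> where \<gamma>: "gauge \<gamma>"
      "\<And>p. p tagged_partial_division_of (cbox a b) \<Longrightarrow> \<gamma> fine p \<Longrightarrow>
          (\<Sum>(x,k)\<in>p. norm (measure lborel k *\<^sub>R w x - integral k w)) < e"
      using Henstock_lemma[OF _ \<open>0 < e\<close>] by blast
    show "\<exists>\<gamma>. gauge \<gamma> \<and> (\<forall>p. p tagged_division_of {a..b} \<and> \<gamma> fine p \<longrightarrow>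
        norm ((\<Sum>(x, k)\<in>p. measure lborel k *\<^sub>R norm (w x)) - 0) < e)"
    proof (intro exI[of _ \<gamma>] conjI \<gamma>(1) allI impI; elim conjE)
      fix p assume p: "p tagged_division_of {a..b}" "\<gamma> fine p"
      have "(\<Sum>(x, k)\<in>p. measure lborel k *\<^sub>R norm (w x))
          = (\<Sum>(x,k)\<in>p. norm (measure lborel k *\<^sub>R w x - integral k w))"
      proof (intro sum.cong refl, safe)
        fix x K assume xK: "(x, K) \<in> p"
        then obtain c d where "K = cbox c d" "x \<in> K" "K \<subseteq> {a..b}"
          using tagged_division_ofD(2-4)[OF p(1) xK] by blast
        then have "integral K w = 0" using 0[of c d] by auto
        then show "measure lborel K *\<^sub>R norm (w x) = norm (measure lborel K *\<^sub>R w x - integral K w)" by simp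
      qed
      also have "\<dots> < e" using \<gamma>(2) p unfolding tagged_division_of_def by auto
      finally show "norm ((\<Sum>(x, k)\<in>p. measure lborel k *\<^sub>R norm (w x)) - 0) < e"
        by (simp add: sum_nonneg case_prod_unfold)
    qed
  qed
  then have "integral {a..b} (\<lambda>t. norm (w t)) = 0" by (rule integral_unique)
  moreover have int: "integrable (lebesgue_on {a..b}) (\<lambda>t. norm (w t))"
    using absolutely_integrable_norm[OF w] by (simp add: absolutely_integrable_on_iff_integrable o_def)
  ultimately have "integral\<^sup>L (lebesgue_on {a..b}) (\<lambda>t. norm (w t)) = 0"
    by (simp add: lebesgue_integral_eq_integral)
  then have "AE t in lebesgue_on {a..b}. norm (w t) = 0"
    using integral_nonneg_eq_0_iff_AE[OF int] by auto
  then show ?thesis by (simp add: AE_lebesgue_on_iff)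
qed

lemma fundamental_lemma_calculus_of_variations:
  fixes w :: "real \<Rightarrow> 'b::euclidean_space"
  assumes w: "set_integrable lebesgue {a..b} w"
    and 0: "\<And>\<psi>. test_function a b \<psi> \<Longrightarrow> (LINT t:{a..b}|lebesgue. \<psi> t *\<^sub>R w t) = 0"
  shows "AE t in lebesgue. t \<in> {a..b} \<longrightarrow> w t = 0"
proof -
  \<comment> \<open>Strict inequalities at \<open>a\<close> and \<open>b\<close>, because the bumps
    have support \<open>{c..d}\<close>, which must lie in the open interval.\<close>
  have int0: "integral {c..d} w = 0" if cd: "a < c" "c \<le> d" "d < b" for c d
  proof (cases "c = d")
    case False
    then have "c < d" using cd by simp
    let ?g = "\<lambda>n t. indicator {a..b} t *\<^sub>R (bump 1 0 (1 / Suc n) c d t *\<^sub>R w t)"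
    have w_int: "integrable lebesgue (\<lambda>t. indicator {a..b} t *\<^sub>R w t)"
      using w by (simp add: set_integrable_def)
    have cont: "continuous_on UNIV (bump 1 0 (1 / Suc n) c d)" for n
    proof -
      obtain p' where "\<forall>x. (bump 1 0 (1 / Suc n) c d has_real_derivative bump p' (0 + 2) (1 / Suc n) c d x) (at x)"
        using bump_has_derivative[of "1 / Suc n" 1 0 c d] by auto
      then show ?thesis by (intro DERIV_continuous_on) (auto intro: has_field_derivative_at_within)
    qed
    have "(\<lambda>n. integral\<^sup>L lebesgue (?g n)) \<longlonglongrightarrow>
        integral\<^sup>L lebesgue (\<lambda>t. indicator {a..b} t *\<^sub>R (indicator {c<..<d} t *\<^sub>R w t))"
    proof (rule integral_dominated_convergence[OF _ _ integrable_norm[OF w_int]])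
      have bm: "bump 1 0 (1 / Suc n) c d \<in> borel_measurable lebesgue" for n
        using borel_measurable_continuous_onI[OF cont] by (simp add: measurable_completion)
      have *: "?g n = (\<lambda>t. bump 1 0 (1 / Suc n) c d t *\<^sub>R (indicator {a..b} t *\<^sub>R w t))" for n
        by (simp add: mult.commute)
      show "?g n \<in> borel_measurable lebesgue" for n
        unfolding * by (rule borel_measurable_scaleR[OF bm borel_measurable_integrable[OF w_int]])
      have **: "(\<lambda>t. indicator {a..b} t *\<^sub>R (indicator {c<..<d} t *\<^sub>R w t)) =
          (\<lambda>t. indicator {c<..<d} t *\<^sub>R (indicator {a..b} t *\<^sub>R w t))"
        by (simp add: mult.commute)
      show "(\<lambda>t. indicator {a..b} t *\<^sub>R (indicator {c<..<d} t *\<^sub>R w t)) \<in> borel_measurable lebesgue"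
        unfolding ** by (rule borel_measurable_scaleR[OF borel_measurable_indicator borel_measurable_integrable[OF w_int]]) simp
      show "AE t in lebesgue. (\<lambda>n. ?g n t) \<longlonglongrightarrow> indicator {a..b} t *\<^sub>R (indicator {c<..<d} t *\<^sub>R w t)"
        by (intro AE_I2 tendsto_intros bump_tendsto_indicator \<open>c < d\<close>)
      show "AE t in lebesgue. norm (?g n t) \<le> norm (indicator {a..b} t *\<^sub>R w t)" for n
      proof (intro AE_I2)
        fix t
        have "\<bar>bump 1 0 (1 / Suc n) c d t\<bar> * norm (w t) \<le> 1 * norm (w t)"
          by (intro mult_right_mono bump_bounded) auto
        then show "norm (?g n t) \<le> norm (indicator {a..b} t *\<^sub>R w t)"
          by (auto simp: indicator_def)
      qed
    qed
    moreover have "integral\<^sup>L lebesgue (?g n) = 0" for n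
      using 0[OF test_function_bump[of "1 / Suc n" a c d b]] cd \<open>c < d\<close>
      by (simp add: set_lebesgue_integral_def)
    ultimately have "(\<lambda>n::nat. 0) \<longlonglongrightarrow> integral\<^sup>L lebesgue (\<lambda>t. indicator {a..b} t *\<^sub>R (indicator {c<..<d} t *\<^sub>R w t))"
      by simp
    then have "integral\<^sup>L lebesgue (\<lambda>t. indicator {a..b} t *\<^sub>R (indicator {c<..<d} t *\<^sub>R w t)) = 0"
      by (simp add: LIMSEQ_const_iff)
    moreover have "(\<lambda>t. indicator {a..b} t *\<^sub>R (indicator {c<..<d} t *\<^sub>R w t)) = (\<lambda>t. indicator {c<..<d} t *\<^sub>R w t)"
      using cd by (auto simp: indicator_def)
    ultimately have "(LINT t:{c<..<d}|lebesgue. w t) = 0" by (simp add: set_lebesgue_integral_def)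
    moreover have "set_integrable lebesgue {c<..<d} w"
      by (rule set_integrable_subset[OF w]) (use cd in auto)
    ultimately have "integral {c<..<d} w = 0" using set_lebesgue_integral_eq_integral by metis
    then show ?thesis by (simp add: integral_open_interval_real)
  qed auto
  \<comment> \<open>Compact subintervals exhaust the open interval; the two end points are dealt
    with as null sets.\<close>
  have "AE t in lebesgue. \<forall>n. t \<in> {a + 1 / Suc n..b - 1 / Suc n} \<longrightarrow> w t = 0"
    unfolding AE_all_countable
  proof
    fix n
    have pos: "0 < 1 / real (Suc n)" by simp
    show "AE t in lebesgue. t \<in> {a + 1 / Suc n..b - 1 / Suc n} \<longrightarrow> w t = 0"
    proof (rule AE_zero_of_integrals_zero)
      have "{a + 1 / Suc n..b - 1 / Suc n} \<subseteq> {a..b}" using pos by auto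
      then show "w absolutely_integrable_on {a + 1 / Suc n..b - 1 / Suc n}"
        using w absolutely_integrable_on_subinterval by blast
      show "integral {c..d} w = 0" if "a + 1 / Suc n \<le> c" "c \<le> d" "d \<le> b - 1 / Suc n" for c d
        by (rule int0) (use that pos in linarith)+
    qed
  qed
  moreover have "AE t in lebesgue. t \<noteq> a" "AE t in lebesgue. t \<noteq> b"
    unfolding AE_lebesgue_negligible by auto
  ultimately show ?thesis
  proof eventually_elim
    case (elim t)
    show ?case
    proof
      assume "t \<in> {a..b}"
      then have "0 < min (t - a) (b - t)" using elim by auto
      then obtain n where "1 / Suc n < min (t - a) (b - t)" using nat_approx_posE by blast
      then have "t \<in> {a + 1 / Suc n..b - 1 / Suc n}" by auto
      then show "w t = 0" using elim by blast
    qed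
  qed
qed

section \<open>Norms in \<open>W\<^sup>1\<^sup>,\<^sup>1\<close> and \<open>L\<^sup>p(A, W\<^sup>1\<^sup>,\<^sup>1)\<close>\<close>

lemma set_nn_integral_norm:
  fixes w :: "real \<Rightarrow> 'b::euclidean_space"
  assumes w: "w absolutely_integrable_on {a..b}"
  shows "(\<integral>\<^sup>+t\<in>{a..b}. ennreal (norm (w t)) \<partial>lebesgue) = ennreal (integral {a..b} (\<lambda>t. norm (w t)))"
proof -
  have int: "integrable (lebesgue_on {a..b}) (\<lambda>t. norm (w t))"
    using absolutely_integrable_norm[OF w] by (simp add: absolutely_integrable_on_iff_integrable o_def)
  have "(\<integral>\<^sup>+t\<in>{a..b}. ennreal (norm (w t)) \<partial>lebesgue) = (\<integral>\<^sup>+t. ennreal (norm (w t)) \<partial>lebesgue_on {a..b})"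
    by (simp add: nn_integral_restrict_space)
  also have "\<dots> = ennreal (integral\<^sup>L (lebesgue_on {a..b}) (\<lambda>t. norm (w t)))"
    using int by (intro nn_integral_eq_integral) auto
  finally show ?thesis using int by (simp add: lebesgue_integral_eq_integral)
qed

text \<open>Integration by parts: the fundamental theorem applies to the absolutely continuous
  product \<open>\<psi> t *\<^sub>R u t\<close>, which vanishes at both ends because the support of
  \<open>\<psi>\<close> lies in the open interval.\<close>

lemma has_weak_derivative_abs_continuous:
  fixes u v :: "real \<Rightarrow> 'b::euclidean_space"
  assumes "a \<le> b" and u: "abs_continuous_on a b u"
    and deriv: "AE t in lebesgue. t \<in> {a..b} \<longrightarrow> (u has_vector_derivative v t) (at t within {a..b})"
    and v: "v absolutely_integrable_on {a..b}"
  shows "has_weak_derivative u v a b"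
  unfolding has_weak_derivative_def
proof (intro conjI allI impI v)
  fix \<psi> assume \<psi>: "test_function a b \<psi>"
  have "((deriv ^^ n) \<psi>) differentiable_on UNIV" for n using \<psi> by (simp add: test_function_def)
  from this[of 0] this[of 1] have "\<psi> differentiable_on UNIV" and d1: "deriv \<psi> differentiable_on UNIV" by simp_all
  then have d: "(\<psi> has_real_derivative deriv \<psi> t) (at t)" for t
    by (simp add: differentiable_on_def DERIV_deriv_iff_real_differentiable)
  have cont: "continuous_on S (deriv \<psi>)" "continuous_on S \<psi>" for S
    using differentiable_imp_continuous_on[OF d1] differentiable_imp_continuous_on[OF \<open>\<psi> differentiable_on UNIV\<close>]
      continuous_on_subset by auto
  have contu: "continuous_on {a..b} u" using abs_continuous_on_imp_continuous_on[OF u] .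
  have "bounded (deriv \<psi> ` {a..b})"
    by (intro compact_imp_bounded compact_continuous_image cont) auto
  then obtain L where L: "0 < L" "\<And>t. t \<in> {a..b} \<Longrightarrow> norm (deriv \<psi> t) \<le> L"
    unfolding bounded_pos by auto
  have "L-lipschitz_on {a..b} \<psi>"
  proof (rule lipschitz_onI)
    fix x y assume "x \<in> {a..b}" "y \<in> {a..b}"
    then show "dist (\<psi> x) (\<psi> y) \<le> L * dist x y"
      unfolding dist_norm
      by (intro field_differentiable_bound[of "{a..b}" \<psi> "deriv \<psi>"] L)
        (auto intro: has_field_derivative_at_within d)
  qed (use L in simp)
  then have "abs_continuous_on a b \<psi>" by (rule abs_continuous_on_lipschitz)
  then have ac: "abs_continuous_on a b (\<lambda>t. \<psi> t *\<^sub>R u t)"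
    by (intro abs_continuous_on_bilinear[OF bounded_bilinear_scaleR] u)
  have "((\<lambda>t. \<psi> t *\<^sub>R v t + deriv \<psi> t *\<^sub>R u t) has_integral \<psi> b *\<^sub>R u b - \<psi> a *\<^sub>R u a) {a..b}"
  proof (rule abs_continuous_on_has_integral[OF assms(1) ac])
    show "AE t in lebesgue. t \<in> {a..b} \<longrightarrow>
        ((\<lambda>t. \<psi> t *\<^sub>R u t) has_vector_derivative \<psi> t *\<^sub>R v t + deriv \<psi> t *\<^sub>R u t) (at t within {a..b})"
      using deriv by eventually_elim
        (auto intro!: has_vector_derivative_scaleR has_field_derivative_at_within d)
  qed
  moreover have "\<psi> a = 0" "\<psi> b = 0"
  proof -
    have "t \<in> {a<..<b}" if "\<psi> t \<noteq> 0" for t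
      using \<psi> that closure_subset[of "{t. \<psi> t \<noteq> 0}"] unfolding test_function_def by blast
    then show "\<psi> a = 0" "\<psi> b = 0" by force+
  qed
  ultimately have sum: "integral {a..b} (\<lambda>t. \<psi> t *\<^sub>R v t + deriv \<psi> t *\<^sub>R u t) = 0"
    by (simp add: integral_unique)
  have 1: "(\<lambda>t. deriv \<psi> t *\<^sub>R u t) absolutely_integrable_on {a..b}"
    by (intro absolutely_integrable_continuous_real continuous_intros cont contu)
  have "bilinear (\<lambda>x (y::'b). x *\<^sub>R y)"
    using bounded_bilinear_scaleR bilinear_conv_bounded_bilinear by blast
  then have 2: "(\<lambda>t. \<psi> t *\<^sub>R v t) absolutely_integrable_on {a..b}"
    by (rule absolutely_integrable_bounded_measurable_product)
      (auto intro!: v continuous_imp_measurable_on_sets_lebesgue cont compact_imp_bounded compact_continuous_image)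
  have "integral {a..b} (\<lambda>t. \<psi> t *\<^sub>R v t) + integral {a..b} (\<lambda>t. deriv \<psi> t *\<^sub>R u t) = 0"
    using sum set_lebesgue_integral_eq_integral(1)[OF 1] set_lebesgue_integral_eq_integral(1)[OF 2]
    by (simp add: Henstock_Kurzweil_Integration.integral_add)
  then show "(LINT t:{a..b}|lebesgue. deriv \<psi> t *\<^sub>R u t) = - (LINT t:{a..b}|lebesgue. \<psi> t *\<^sub>R v t)"
    unfolding set_lebesgue_integral_eq_integral(2)[OF 1] set_lebesgue_integral_eq_integral(2)[OF 2]
    by (simp add: eq_neg_iff_add_eq_0 add.commute)
qed

lemma has_weak_derivative_unique:
  fixes u v w :: "real \<Rightarrow> 'b::euclidean_space"
  assumes v: "has_weak_derivative u v a b" and w: "has_weak_derivative u w a b"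
  shows "AE t in lebesgue. t \<in> {a..b} \<longrightarrow> v t = w t"
proof -
  have vi: "set_integrable lebesgue {a..b} v" and wi: "set_integrable lebesgue {a..b} w"
    using v w by (auto simp: has_weak_derivative_def)
  have "AE t in lebesgue. t \<in> {a..b} \<longrightarrow> v t - w t = 0"
  proof (rule fundamental_lemma_calculus_of_variations)
    show "set_integrable lebesgue {a..b} (\<lambda>t. v t - w t)" using vi wi by (rule set_integral_diff)
    fix \<psi> assume \<psi>: "test_function a b \<psi>"
    have cont: "continuous_on {a..b} \<psi>"
    proof -
      have "((deriv ^^ 0) \<psi>) differentiable_on UNIV" using \<psi> unfolding test_function_def by blast
      then show ?thesis using differentiable_imp_continuous_on continuous_on_subset by (metis funpow_0 subset_UNIV)
    qed
    have bil: "bilinear (\<lambda>x (y::'b). x *\<^sub>R y)"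
      using bounded_bilinear_scaleR bilinear_conv_bounded_bilinear by blast
    have int: "set_integrable lebesgue {a..b} (\<lambda>t. \<psi> t *\<^sub>R z t)" if "set_integrable lebesgue {a..b} z"
      for z :: "real \<Rightarrow> 'b"
      by (rule absolutely_integrable_bounded_measurable_product[OF bil])
        (auto intro!: that continuous_imp_measurable_on_sets_lebesgue cont compact_imp_bounded compact_continuous_image)
    have "(LINT t:{a..b}|lebesgue. \<psi> t *\<^sub>R (v t - w t)) =
        (LINT t:{a..b}|lebesgue. \<psi> t *\<^sub>R v t) - (LINT t:{a..b}|lebesgue. \<psi> t *\<^sub>R w t)"
      unfolding scaleR_diff_right by (rule set_integral_diff(2)[OF int[OF vi] int[OF wi]])
    also have "\<dots> = 0"
    proof -
      have "- (LINT t:{a..b}|lebesgue. \<psi> t *\<^sub>R v t) = - (LINT t:{a..b}|lebesgue. \<psi> t *\<^sub>R w t)"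
        using v[unfolded has_weak_derivative_def, THEN conjunct2, rule_format, OF \<psi>]
          w[unfolded has_weak_derivative_def, THEN conjunct2, rule_format, OF \<psi>] by (rule trans[OF sym])
      then show ?thesis by simp
    qed
    finally show "(LINT t:{a..b}|lebesgue. \<psi> t *\<^sub>R (v t - w t)) = 0" .
  qed
  then show ?thesis by eventually_elim auto
qed

text \<open>The weak derivative in the norm is an arbitrary choice; uniqueness up to null sets
  identifies it with the pointwise derivative, so the norm becomes computable.\<close>

lemma W11_norm_abs_continuous:
  fixes u v :: "real \<Rightarrow> 'b::euclidean_space"
  assumes "a \<le> b" and u: "abs_continuous_on a b u"
    and deriv: "AE t in lebesgue. t \<in> {a..b} \<longrightarrow> (u has_vector_derivative v t) (at t within {a..b})"
    and v: "v absolutely_integrable_on {a..b}"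
  shows "u \<in> W11 a b"
    and "W11_norm a b u = ennreal (integral {a..b} (\<lambda>t. norm (u t)) + integral {a..b} (\<lambda>t. norm (v t)))"
proof -
  have ui: "u absolutely_integrable_on {a..b}"
    using abs_continuous_on_imp_continuous_on[OF u] by (intro absolutely_integrable_continuous_real)
  have wd: "has_weak_derivative u v a b" using assms by (rule has_weak_derivative_abs_continuous)
  then show mem: "u \<in> W11 a b" using ui by (auto simp: W11_def)
  have "has_weak_derivative u (weak_derivative a b u) a b"
    unfolding weak_derivative_def by (rule someI[of "\<lambda>v. has_weak_derivative u v a b", OF wd])
  then have ae: "AE t in lebesgue. t \<in> {a..b} \<longrightarrow> weak_derivative a b u t = v t"
    using wd by (rule has_weak_derivative_unique)
  have "(\<integral>\<^sup>+t\<in>{a..b}. norm (weak_derivative a b u t) \<partial>lebesgue) = (\<integral>\<^sup>+t\<in>{a..b}. norm (v t) \<partial>lebesgue)"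
    by (rule nn_integral_cong_AE) (use ae in \<open>eventually_elim, auto simp: indicator_def\<close>)
  then show "W11_norm a b u = ennreal (integral {a..b} (\<lambda>t. norm (u t)) + integral {a..b} (\<lambda>t. norm (v t)))"
    using mem set_nn_integral_norm[OF ui] set_nn_integral_norm[OF v]
    by (simp add: W11_norm_def integral_nonneg ennreal_plus
        set_lebesgue_integral_eq_integral(1)[OF absolutely_integrable_norm[OF ui, unfolded o_def]]
        set_lebesgue_integral_eq_integral(1)[OF absolutely_integrable_norm[OF v, unfolded o_def]])
qed

section \<open>Convergence and finiteness of the norms after integration over the starting
  points\<close>

lemma ennreal_powr_tendsto_0:
  assumes f: "(f \<longlongrightarrow> 0) F" and p: "0 < p"
  shows "((\<lambda>x. ennreal_powr (f x) p) \<longlongrightarrow> 0) F"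
proof -
  have fin: "\<forall>\<^sub>F x in F. f x < \<infinity>" using order_tendstoD(2)[OF f, of \<infinity>] by simp
  have "((\<lambda>x. enn2real (f x)) \<longlongrightarrow> enn2real 0) F" using f by (intro tendsto_enn2real) auto
  then have "((\<lambda>x. enn2real (f x) powr p) \<longlongrightarrow> 0) F"
    using p by (intro tendsto_zero_powrI) auto
  then have "((\<lambda>x. ennreal (enn2real (f x) powr p)) \<longlongrightarrow> ennreal 0) F" by (rule tendsto_ennrealI)
  moreover have "\<forall>\<^sub>F x in F. ennreal (enn2real (f x) powr p) = ennreal_powr (f x) p"
    using fin by eventually_elim (simp add: ennreal_powr_def)
  ultimately show ?thesis by (simp add: tendsto_cong)
qed

lemma ennreal_powr_le:
  assumes "c \<le> ennreal M" "0 \<le> M" "0 \<le> p"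
  shows "ennreal_powr c p \<le> ennreal (M powr p)"
proof -
  have "c < \<infinity>" using assms(1) ennreal_less_top order_le_less_trans by (metis infinity_ennreal_def)
  moreover have "enn2real c \<le> M" using assms enn2real_leI by blast
  then have "enn2real c powr p \<le> M powr p" using assms(3) by (intro powr_mono2) auto
  ultimately show ?thesis by (auto simp: ennreal_powr_def intro: ennreal_leI)
qed

text \<open>The integral of a function that need not be measurable is approximated from below by simple
  functions, so dominated convergence to \<open>0\<close> still holds.\<close>

lemma nn_integral_tendsto_0:
  fixes g :: "nat \<Rightarrow> 'a \<Rightarrow> ennreal"
  assumes fin: "emeasure M (space M) < \<infinity>"
    and le: "AE x in M. \<forall>n. g n x \<le> ennreal C"
    and lim: "AE x in M. (\<lambda>n. g n x) \<longlonglongrightarrow> 0"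
  shows "(\<lambda>n. integral\<^sup>N M (g n)) \<longlonglongrightarrow> 0"
proof -
  have "\<exists>s. simple_function M s \<and> s \<le> g n \<and> integral\<^sup>N M (g n) \<le> integral\<^sup>N M s + ennreal (1 / Suc n)" for n
  \<comment> \<open>A zero integral is set apart because subtracting \<open>1 / Suc n\<close> from
    it yields nothing strictly smaller, and a strict inequality is what extracts a simple function
    from the supremum.\<close>
  proof (cases "integral\<^sup>N M (g n) = 0")
    case True
    then show ?thesis by (intro exI[of _ "\<lambda>_. 0"]) (auto simp: le_fun_def)
  next
    case False
    have "integral\<^sup>N M (g n) \<le> (\<integral>\<^sup>+x. ennreal C \<partial>M)"
      using le by (intro nn_integral_mono_AE) (auto elim: eventually_mono)
    also have "\<dots> < \<infinity>" using fin by (simp add: ennreal_mult_less_top)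
    finally have "integral\<^sup>N M (g n) - ennreal (1 / Suc n) < integral\<^sup>N M (g n)"
      using False by (intro ennreal_between) (auto simp: less_top zero_less_iff_neq_zero)
    then obtain s where s: "simple_function M s" "s \<le> g n"
        "integral\<^sup>N M (g n) - ennreal (1 / Suc n) < integral\<^sup>S M s"
      unfolding nn_integral_def[of M "g n"] less_SUP_iff by blast
    then have "integral\<^sup>N M (g n) - ennreal (1 / Suc n) \<le> integral\<^sup>N M s"
      using nn_integral_eq_simple_integral[of M s] by simp
    then show ?thesis using s by (intro exI[of _ s]) (simp add: ennreal_minus_le_iff add.commute)
  qed
  then obtain s where s: "\<And>n. simple_function M (s n)" "\<And>n. s n \<le> g n"
    "\<And>n. integral\<^sup>N M (g n) \<le> integral\<^sup>N M (s n) + ennreal (1 / Suc n)"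
    by metis
  have "(\<lambda>n. integral\<^sup>N M (s n)) \<longlonglongrightarrow> (\<integral>\<^sup>+x. 0 \<partial>M)"
  proof (rule nn_integral_dominated_convergence[where w = "\<lambda>_. ennreal C"])
    show "s n \<in> borel_measurable M" for n using s(1) by (rule borel_measurable_simple_function)
    show "AE x in M. s n x \<le> ennreal C" for n
      using le by eventually_elim (use s(2) in \<open>auto simp: le_fun_def intro: order_trans\<close>)
    show "(\<integral>\<^sup>+x. ennreal C \<partial>M) < \<infinity>" using fin by (simp add: ennreal_mult_less_top)
    show "AE x in M. (\<lambda>n. s n x) \<longlonglongrightarrow> 0"
      using lim by eventually_elim
        (rule tendsto_sandwich[OF _ _ tendsto_const], use s(2) in \<open>auto simp: le_fun_def\<close>)
  qed auto
  then have "(\<lambda>n. integral\<^sup>N M (s n) + ennreal (1 / Suc n)) \<longlonglongrightarrow> 0 + ennreal 0"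
    using LIMSEQ_inverse_real_of_nat
    by (intro tendsto_add tendsto_ennrealI) (simp_all add: inverse_eq_divide)
  then have "(\<lambda>n. integral\<^sup>N M (s n) + ennreal (1 / Suc n)) \<longlonglongrightarrow> 0" by simp
  then show ?thesis
    by (rule tendsto_sandwich[OF _ _ tendsto_const, rotated 2]) (use s(3) in auto)
qed

lemma LpW11_norm_tendsto_0:
  assumes A: "A \<in> lmeasurable" and p: "1 \<le> p" and M: "0 \<le> M"
    and le: "AE x in lebesgue. x \<in> A \<longrightarrow> (\<forall>n. W11_norm a b (U n x) \<le> ennreal M)"
    and lim: "AE x in lebesgue. x \<in> A \<longrightarrow> (\<lambda>n. W11_norm a b (U n x)) \<longlonglongrightarrow> 0"
  shows "(\<lambda>n. LpW11_norm p A a b (U n)) \<longlonglongrightarrow> 0"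
proof -
  have As: "A \<in> sets lebesgue" using A by (rule fmeasurableD)
  have "(\<lambda>n. integral\<^sup>N (lebesgue_on A) (\<lambda>x. ennreal_powr (W11_norm a b (U n x)) p)) \<longlonglongrightarrow> 0"
  proof (rule nn_integral_tendsto_0)
    show "emeasure (lebesgue_on A) (space (lebesgue_on A)) < \<infinity>"
      using A As by (simp add: emeasure_restrict_space fmeasurable_def)
    show "AE x in lebesgue_on A. \<forall>n. ennreal_powr (W11_norm a b (U n x)) p \<le> ennreal (M powr p)"
      unfolding AE_lebesgue_on_iff[OF As] using le
      by eventually_elim (use p M in \<open>auto intro!: ennreal_powr_le\<close>)
    show "AE x in lebesgue_on A. (\<lambda>n. ennreal_powr (W11_norm a b (U n x)) p) \<longlonglongrightarrow> 0"
      unfolding AE_lebesgue_on_iff[OF As] using lim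
      by eventually_elim (use p in \<open>auto intro!: ennreal_powr_tendsto_0\<close>)
  qed
  then show ?thesis
    unfolding LpW11_norm_def using As p
    by (intro ennreal_powr_tendsto_0) (simp_all add: nn_integral_restrict_space)
qed

lemma LpW11_norm_finite:
  assumes A: "A \<in> lmeasurable" and p: "1 \<le> p" and M: "0 \<le> M"
    and le: "AE x in lebesgue. x \<in> A \<longrightarrow> W11_norm a b (U x) \<le> ennreal M"
  shows "LpW11_norm p A a b U < \<infinity>"
proof -
  have "(\<integral>\<^sup>+x\<in>A. ennreal_powr (W11_norm a b (U x)) p \<partial>lebesgue) \<le> (\<integral>\<^sup>+x. ennreal (M powr p) * indicator A x \<partial>lebesgue)"
    using le by (intro nn_integral_mono_AE, eventually_elim)
      (use p M in \<open>auto simp: indicator_def intro!: ennreal_powr_le\<close>)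
  also have "\<dots> = ennreal (M powr p) * emeasure lebesgue A"
    by (rule nn_integral_cmult_indicator[OF fmeasurableD[OF A]])
  also have "\<dots> < \<infinity>"
    using fmeasurableD2[OF A] by (simp add: ennreal_mult_less_top less_top del: emeasure_completion)
  finally show ?thesis by (simp add: LpW11_norm_def ennreal_powr_def)
qed

section \<open>Measurability of the exceptional set\<close>

text \<open>A null set has empty interior, so its complement is dense, and subsets of a Euclidean
  space are separable. This trades almost every point for every point of a countable dense
  set.\<close>

lemma AE_countable_dense:
  fixes P :: "'a::euclidean_space \<Rightarrow> bool"
  assumes "AE q in lebesgue. P q"
  shows "\<exists>D. countable D \<and> closure D = UNIV \<and> (\<forall>q\<in>D. P q)"
proof -
  have "negligible (- {q. P q})" using assms by (simp add: AE_lebesgue_negligible Collect_neg_eq)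
  then have "negligible (interior (- {q. P q}))" by (rule negligible_subset[OF _ interior_subset])
  then have "interior (- {q. P q}) = {}" using open_not_negligible[OF open_interior] by auto
  then have dense: "closure {q. P q} = UNIV" by (simp add: closure_interior)
  obtain D where D: "countable D" "D \<subseteq> {q. P q}" "{q. P q} \<subseteq> closure D"
    using separable[of "{q. P q}"] by blast
  then have "closure D = UNIV" using dense closure_mono[OF D(3)] by auto
  with D show ?thesis by blast
qed

lemma completion_ex_borel_measurable_euclidean:
  fixes g :: "'a \<Rightarrow> 'b::euclidean_space"
  assumes g: "g \<in> borel_measurable (completion M)"
  shows "\<exists>g'\<in>borel_measurable M. AE x in M. g x = g' x"
proof -
  have "(\<lambda>x. g x \<bullet> i) \<in> borel_measurable (completion M)" for i
    using g by (intro borel_measurable_inner) auto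
  then have "\<forall>i. \<exists>g'\<in>borel_measurable M. AE x in M. g x \<bullet> i = g' x"
    using completion_ex_borel_measurable_real by blast
  then obtain h where h: "\<And>i. h i \<in> borel_measurable M" "\<And>i. AE x in M. g x \<bullet> i = h i x" by metis
  have "AE x in M. \<forall>i\<in>Basis. g x \<bullet> i = h i x" using h(2) by (simp add: AE_finite_all)
  then have "AE x in M. g x = (\<Sum>i\<in>Basis. h i x *\<^sub>R i)"
  proof eventually_elim
    case (elim x)
    have "g x = (\<Sum>i\<in>Basis. (g x \<bullet> i) *\<^sub>R i)" by (rule euclidean_representation[symmetric])
    also have "\<dots> = (\<Sum>i\<in>Basis. h i x *\<^sub>R i)" using elim by (intro sum.cong) auto
    finally show ?case .
  qed
  moreover have "(\<lambda>x. \<Sum>i\<in>Basis. h i x *\<^sub>R i) \<in> borel_measurable M" using h(1) by simp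
  ultimately show ?thesis by (rule bexI[of _ "\<lambda>x. \<Sum>i\<in>Basis. h i x *\<^sub>R i"])
qed

interpretation lborel_pair: pair_sigma_finite lborel lborel ..

text \<open>Lebesgue measure on the product is the completion of the Borel product and not the
  product of the completed factors. The exceptional set is therefore enlarged to a Borel null set
  before Fubini is applied.\<close>

lemma AE_lebesgue_prod:
  fixes P :: "'a::euclidean_space \<Rightarrow> 'b::euclidean_space \<Rightarrow> bool"
  assumes "AE z in lebesgue. P (fst z) (snd z)"
  shows "AE y in lebesgue. AE x in lebesgue. P x y"
proof -
  have "AE z in (lborel :: ('a \<times> 'b) measure). P (fst z) (snd z)" using assms by (simp add: AE_completion_iff)
  then obtain N where N: "{z. \<not> P (fst z) (snd z)} \<subseteq> N" "N \<in> null_sets (lborel :: ('a \<times> 'b) measure)"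
    unfolding eventually_ae_filter by auto
  have Ns: "N \<in> sets (lborel \<Otimes>\<^sub>M lborel)" using N(2) unfolding lborel_prod by auto
  have "AE z in lborel \<Otimes>\<^sub>M lborel. z \<notin> N" using N(2) unfolding lborel_prod by (rule AE_not_in)
  then have "AE x in (lborel :: 'a measure). AE y in (lborel :: 'b measure). (x, y) \<notin> N"
    by (rule lborel_pair.AE_pair)
  moreover have "{z \<in> space (lborel \<Otimes>\<^sub>M lborel). (fst z, snd z) \<notin> N} \<in> sets (lborel \<Otimes>\<^sub>M lborel)"
  proof -
    have "{z \<in> space (lborel \<Otimes>\<^sub>M lborel). (fst z, snd z) \<notin> N} = space (lborel \<Otimes>\<^sub>M lborel) - N" by auto
    then show ?thesis using sets.Diff[OF sets.top Ns] by simp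
  qed
  ultimately have "AE y in (lborel :: 'b measure). AE x in (lborel :: 'a measure). (x, y) \<notin> N"
    using lborel_pair.AE_commute[of "\<lambda>x y. (x, y) \<notin> N"] by simp
  then have "AE y in (lborel :: 'b measure). AE x in (lborel :: 'a measure). P x y"
  proof eventually_elim
    case (elim y)
    then show ?case
    proof eventually_elim
      case (elim x)
      then show ?case using N(1) by (auto dest: subsetD[of _ _ "(x, y)"])
    qed
  qed
  then show ?thesis by (simp add: AE_completion_iff)
qed

text \<open>Joint Lebesgue measurability controls only almost every section. A Borel representative
  has measurable sections throughout, and for almost every \<open>q\<close> its section agrees with
  that of \<open>b\<close> at almost every time.\<close>

lemma measurable_field_sections:
  fixes b :: "real \<Rightarrow> 'a::euclidean_space \<Rightarrow> 'a"
  assumes "measurable_field T b"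
  shows "AE q in lebesgue. (\<lambda>t. b t q) \<in> borel_measurable (lebesgue_on {0..T})"
proof -
  define g :: "real \<times> 'a \<Rightarrow> 'a" where "g z = (if z \<in> {0..T} \<times> UNIV then b (fst z) (snd z) else 0)" for z
  have S: "{0..T} \<times> (UNIV :: 'a set) \<in> sets lebesgue"
    by (intro sets_completionI_sets) (simp add: borel_closed closed_Times)
  have "(\<lambda>z. b (fst z) (snd z)) \<in> borel_measurable (lebesgue_on ({0..T} \<times> UNIV))"
    using assms by (simp add: measurable_field_def case_prod_unfold)
  then have "g \<in> borel_measurable lebesgue"
    unfolding g_def using S by (intro borel_measurable_if_I) auto
  then obtain g' where g': "g' \<in> borel_measurable lborel" "AE z in lborel. g z = g' z"
    using completion_ex_borel_measurable_euclidean by blast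
  have "AE q in lebesgue. AE t in lebesgue. g (t, q) = g' (t, q)"
    using g'(2) AE_lebesgue_prod[of "\<lambda>t q. g (t, q) = g' (t, q)"] by (simp add: AE_completion_iff)
  then show ?thesis
  proof eventually_elim
    case (elim q)
    have "(\<lambda>t. g' (t, q)) \<in> borel_measurable lborel"
      using g'(1) unfolding lborel_prod[symmetric] by measurable
    then have "(\<lambda>t. g' (t, q)) \<in> borel_measurable lebesgue" by (rule measurable_completion)
    then have "(\<lambda>t. g (t, q)) \<in> borel_measurable lebesgue"
      by (rule borel_measurable_AE) (use elim in \<open>auto elim: eventually_mono\<close>)
    then have "(\<lambda>t. g (t, q)) \<in> borel_measurable (lebesgue_on {0..T})" by (rule measurable_restrict_space1)
    then show ?case by (rule measurable_cong[THEN iffD1, rotated]) (simp add: g_def)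
  qed
qed

text \<open>Only values at points of the countable set \<open>D\<close> enter \<^const>\<open>cauchy_at\<close>, so measurability of
  the time sections there suffices for Fubini.\<close>

lemma AE_cauchy_at_commute:
  fixes b :: "real \<Rightarrow> 'a::euclidean_space \<Rightarrow> 'a" and Y :: "real \<times> 'c::euclidean_space \<Rightarrow> 'a"
  assumes D: "countable D" and b: "\<And>q. q \<in> D \<Longrightarrow> (\<lambda>t. b t q) \<in> borel_measurable (lebesgue_on S)"
    and S: "S \<in> sets borel" and Y: "Y \<in> borel_measurable borel"
    and ae: "AE t in lebesgue. t \<in> S \<longrightarrow> (AE x in lebesgue. cauchy_at D (b t) (Y (t, x)))"
  shows "AE x in lebesgue. AE t in lebesgue. t \<in> S \<longrightarrow> cauchy_at D (b t) (Y (t, x))"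
proof -
  have "\<forall>q\<in>D. \<exists>g. g \<in> borel_measurable lborel \<and> (AE t in lborel. (if t \<in> S then b t q else 0) = g t)"
  proof
    fix q assume "q \<in> D"
    have "(\<lambda>t. if t \<in> S then b t q else 0) \<in> borel_measurable lebesgue"
      using b[OF \<open>q \<in> D\<close>] S by (intro borel_measurable_if_I) auto
    then show "\<exists>g. g \<in> borel_measurable lborel \<and> (AE t in lborel. (if t \<in> S then b t q else 0) = g t)"
      using completion_ex_borel_measurable_euclidean by blast
  qed
  from bchoice[OF this] obtain g where
    g: "\<And>q. q \<in> D \<Longrightarrow> g q \<in> borel_measurable lborel"
       "\<And>q. q \<in> D \<Longrightarrow> AE t in lborel. (if t \<in> S then b t q else 0) = g q t"
    by blast
  have g_eq: "AE t in lborel. \<forall>q\<in>D. (if t \<in> S then b t q else 0) = g q t"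
    using g(2) D by (simp add: AE_ball_countable)
  \<comment> \<open>The property is rewritten with Borel representatives of the time sections. As
    \<open>D\<close> is countable, one null set of times makes it equivalent to the original
    property for all \<open>x\<close> at once.\<close>
  define P where "P t x \<longleftrightarrow> (t \<in> S \<longrightarrow> cauchy_at D (\<lambda>q. g q t) (Y (t, x)))" for t x
  have P_eq: "AE t in lborel. \<forall>x. P t x \<longleftrightarrow> (t \<in> S \<longrightarrow> cauchy_at D (b t) (Y (t, x)))"
    using g_eq
  proof eventually_elim
    case (elim t)
    show ?case
    proof (intro allI)
      fix x
      have "cauchy_at D (\<lambda>q. g q t) y \<longleftrightarrow> cauchy_at D (b t) y" if "t \<in> S" for y
        unfolding cauchy_at_def using elim that by simp
      then show "P t x \<longleftrightarrow> (t \<in> S \<longrightarrow> cauchy_at D (b t) (Y (t, x)))" unfolding P_def by blast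
    qed
  qed
  have Ym[measurable]: "Y \<in> borel_measurable (lborel \<Otimes>\<^sub>M lborel)"
    using Y unfolding lborel_prod by simp
  have gm[measurable]: "(\<lambda>z. g q (fst z)) \<in> borel_measurable (lborel \<Otimes>\<^sub>M lborel)" if "q \<in> D" for q
    using measurable_compose[OF measurable_fst g(1)[OF that]] .
  have "Measurable.pred (lborel \<Otimes>\<^sub>M lborel) (\<lambda>z. P (fst z) (snd z))"
  proof -
    have 1: "Measurable.pred (lborel \<Otimes>\<^sub>M lborel) (\<lambda>z::real \<times> 'c. fst z \<in> S)"
      using S by measurable
    have 2: "Measurable.pred (lborel \<Otimes>\<^sub>M lborel) (\<lambda>z. dist q (Y (fst z, snd z)) < r)" for q r
      using Ym by simp
    have 3: "Measurable.pred (lborel \<Otimes>\<^sub>M lborel) (\<lambda>z::real \<times> 'c. dist (g q (fst z)) (g q' (fst z)) \<le> r)"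
      if "q \<in> D" "q' \<in> D" for q q' r
      using gm[OF that(1)] gm[OF that(2)] by measurable
    have Ball: "Measurable.pred M (\<lambda>z. \<forall>q\<in>D. Q q z)" if "\<And>q. q \<in> D \<Longrightarrow> Measurable.pred M (Q q)"
      for M :: "(real \<times> 'c) measure" and Q
      using that D unfolding pred_def by (intro sets.sets_Collect_countable_All') auto
    show ?thesis
      unfolding P_def cauchy_at_def
      by (intro pred_intros_logic pred_intros_countable Ball 1 2 3)
  qed
  then have "{z \<in> space (lborel \<Otimes>\<^sub>M lborel). P (fst z) (snd z)} \<in> sets (lborel \<Otimes>\<^sub>M lborel)"
    by (simp add: pred_def)
  moreover have "AE t in lborel. AE x in lborel. P t x"
    using ae P_eq unfolding AE_completion_iff by eventually_elim auto
  ultimately have "AE x in lborel. AE t in lborel. P t x"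
    using lborel_pair.AE_commute[of P] by simp
  then have "AE x in lborel. AE t in lborel. t \<in> S \<longrightarrow> cauchy_at D (b t) (Y (t, x))"
  proof eventually_elim
    case (elim x)
    from elim P_eq show ?case by eventually_elim auto
  qed
  then show ?thesis by (simp add: AE_completion_iff)
qed

section \<open>Strong measurability by piecewise linear interpolation\<close>

text \<open>A finite net of the ball by compactness; sending each point to the admissible net point
  of least index makes the choice measurable.\<close>

lemma finite_rounding:
  fixes r \<epsilon> :: real
  assumes "0 < \<epsilon>"
  obtains R :: "'b::euclidean_space \<Rightarrow> 'b"
    where "finite (range R)" "R \<in> borel_measurable borel" "\<And>y. norm y \<le> r \<Longrightarrow> norm (R y - y) \<le> \<epsilon>"
proof -
  have cover: "cball (0::'b) r \<subseteq> (\<Union>c\<in>cball 0 r. ball c \<epsilon>)" using assms by auto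
  obtain C where C: "C \<subseteq> cball (0::'b) r" "finite C" "cball 0 r \<subseteq> (\<Union>c\<in>C. ball c \<epsilon>)"
    by (rule compactE_image[OF compact_cball open_ball cover])
  obtain f :: "nat \<Rightarrow> 'b" and n where f: "C = f ` {i. i < n}" using C(2) finite_imp_nat_seg_image_inj_on by metis
  define P where "P i y \<longleftrightarrow> i < n \<and> y \<in> ball (f i) \<epsilon>" for i y
  define R where "R y = (if \<exists>i. P i y then f (LEAST i. P i y) else 0)" for y
  have R: "R y = f i \<and> P i y \<and> i < n" if "\<exists>i. P i y" "i = (LEAST i. P i y)" for y i
    using that LeastI_ex[OF that(1)] by (auto simp: R_def P_def)
  have "range R \<subseteq> insert 0 C" using R f unfolding R_def P_def by fastforce
  then have fin: "finite (range R)" using C(2) finite_subset by blast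
  have [measurable]: "Measurable.pred borel (P i)" for i
    unfolding P_def by simp
  have [measurable]: "(\<lambda>y. f (LEAST i. P i y)) \<in> borel_measurable borel"
    by (rule measurable_compose[OF measurable_Least]) auto
  have meas: "R \<in> borel_measurable borel" unfolding R_def by measurable
  show ?thesis
  proof (rule that[OF fin meas])
    fix y :: 'b assume "norm y \<le> r"
    then have "\<exists>i. P i y" using C(3) unfolding f P_def by (force simp: subset_eq)
    then have "R y = f (LEAST i. P i y)" "P (LEAST i. P i y) y" using R by blast+
    then show "norm (R y - y) \<le> \<epsilon>" by (simp add: P_def dist_norm)
  qed
qed

definition mesh :: "real \<Rightarrow> real \<Rightarrow> nat \<Rightarrow> nat \<Rightarrow> real" where
  "mesh a b m k = a + real k * ((b - a) / Suc m)"

text \<open>The piecewise linear curve with value \<open>w k\<close> at the node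
  \<open>mesh a b m k\<close>. As a sum of clamped ramps it is Lipschitz term by term, without
  locating the cell of \<open>t\<close>, and it depends on \<open>w 0\<close>, ...,
  \<open>w (Suc m)\<close> only.\<close>

definition interpolant :: "real \<Rightarrow> real \<Rightarrow> nat \<Rightarrow> (nat \<Rightarrow> 'b::real_vector) \<Rightarrow> real \<Rightarrow> 'b" where
  "interpolant a b m w t = w 0 +
     (\<Sum>k\<le>m. max 0 (min ((b - a) / Suc m) (t - mesh a b m k)) *\<^sub>R (Suc m / (b - a)) *\<^sub>R (w (Suc k) - w k))"

definition interpolant_slope :: "real \<Rightarrow> real \<Rightarrow> nat \<Rightarrow> (nat \<Rightarrow> 'b::real_vector) \<Rightarrow> real \<Rightarrow> 'b" where
  "interpolant_slope a b m w t =
     (\<Sum>k\<le>m. indicator {mesh a b m k<..<mesh a b m (Suc k)} t *\<^sub>R (Suc m / (b - a)) *\<^sub>R (w (Suc k) - w k))"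

lemma mesh_Suc: "mesh a b m (Suc k) = mesh a b m k + (b - a) / Suc m"
  by (simp only: mesh_def of_nat_Suc[of k] distrib_right mult_1_left add_ac)

lemma mesh_bounds:
  assumes "a < b" "k \<le> Suc m"
  shows "mesh a b m k \<in> {a..b}"
proof -
  have "real k * ((b - a) / Suc m) \<le> real (Suc m) * ((b - a) / Suc m)"
    using assms by (intro mult_right_mono) auto
  then show ?thesis using assms by (simp add: mesh_def)
qed

lemma ramp_has_vector_derivative:
  fixes n h t :: real
  assumes "0 < h" "t \<noteq> n" "t \<noteq> n + h"
  shows "((\<lambda>t. max 0 (min h (t - n)) *\<^sub>R s) has_vector_derivative indicator {n<..<n + h} t *\<^sub>R s) (at t)"
proof -
  consider "t < n" | "n < t" "t < n + h" | "n + h < t" using assms by linarith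
  then show ?thesis
  proof cases
    case 1
    have "((\<lambda>t. 0) has_vector_derivative indicator {n<..<n + h} t *\<^sub>R s) (at t)" using 1 by simp
    then show ?thesis
      by (rule has_vector_derivative_transform_within_open[where S = "{..<n}"]) (use 1 in auto)
  next
    case 2
    have "((\<lambda>t. (t - n) *\<^sub>R s) has_vector_derivative indicator {n<..<n + h} t *\<^sub>R s) (at t)"
      using 2 by (auto intro!: derivative_eq_intros)
    then show ?thesis
      by (rule has_vector_derivative_transform_within_open[where S = "{n<..<n + h}"]) (use 2 in auto)
  next
    case 3
    have "((\<lambda>t. h *\<^sub>R s) has_vector_derivative indicator {n<..<n + h} t *\<^sub>R s) (at t)" using 3 by simp
    then show ?thesis
      by (rule has_vector_derivative_transform_within_open[where S = "{n + h<..}"]) (use 3 assms in auto)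
  qed
qed

context
  fixes a b :: real and m :: nat and w :: "nat \<Rightarrow> 'b::euclidean_space"
  assumes ab: "a < b"
begin

lemma AE_not_mesh: "AE t in lebesgue. \<forall>m k. t \<noteq> mesh a b m k"
  unfolding AE_all_countable AE_lebesgue_negligible by auto

lemma interpolant_abs_continuous: "abs_continuous_on a b (interpolant a b m w)"
proof (rule abs_continuous_on_lipschitz, rule lipschitz_onI)
  let ?s = "\<lambda>k. (Suc m / (b - a)) *\<^sub>R (w (Suc k) - w k)"
  let ?p = "\<lambda>k t. max 0 (min ((b - a) / Suc m) (t - mesh a b m k))"
  show "0 \<le> (\<Sum>k\<le>m. norm (?s k))" by (intro sum_nonneg) auto
  fix t t'
  have eq: "interpolant a b m w t - interpolant a b m w t' = (\<Sum>k\<le>m. (?p k t - ?p k t') *\<^sub>R ?s k)"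
    by (simp only: interpolant_def add_diff_cancel_left sum_subtractf[symmetric] scaleR_diff_left)
  have "dist (interpolant a b m w t) (interpolant a b m w t') \<le> (\<Sum>k\<le>m. dist t t' * norm (?s k))"
    unfolding dist_norm[of "interpolant a b m w t"] eq
  proof (rule sum_norm_le)
    fix k
    have "\<bar>?p k t - ?p k t'\<bar> \<le> dist t t'" by (auto simp: dist_real_def)
    then show "norm ((?p k t - ?p k t') *\<^sub>R ?s k) \<le> dist t t' * norm (?s k)"
      by (simp only: norm_scaleR[of "?p k t - ?p k t'"]) (intro mult_right_mono, auto)
  qed
  then show "dist (interpolant a b m w t) (interpolant a b m w t') \<le> (\<Sum>k\<le>m. norm (?s k)) * dist t t'"
    by (simp only: mult.commute[of _ "dist t t'"] sum_distrib_left)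
qed

lemma interpolant_has_vector_derivative:
  "AE t in lebesgue. t \<in> S \<longrightarrow>
    (interpolant a b m w has_vector_derivative interpolant_slope a b m w t) (at t within S)"
  using AE_not_mesh
proof eventually_elim
  case (elim t)
  have "((\<lambda>t. max 0 (min ((b - a) / Suc m) (t - mesh a b m k)) *\<^sub>R s) has_vector_derivative
      indicator {mesh a b m k<..<mesh a b m (Suc k)} t *\<^sub>R s) (at t within S)" for k and s :: 'b
    unfolding mesh_Suc
  proof (rule has_vector_derivative_at_within, rule ramp_has_vector_derivative)
    show "t \<noteq> mesh a b m k" "t \<noteq> mesh a b m k + (b - a) / Suc m"
      using elim mesh_Suc[of a b m k] by metis+
  qed (use ab in auto)
  then have "((\<lambda>t. \<Sum>k\<le>m. max 0 (min ((b - a) / Suc m) (t - mesh a b m k)) *\<^sub>R (Suc m / (b - a)) *\<^sub>R (w (Suc k) - w k))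
      has_vector_derivative interpolant_slope a b m w t) (at t within S)"
    unfolding interpolant_slope_def by (intro has_vector_derivative_sum)
  then have "((\<lambda>t. w 0 + (\<Sum>k\<le>m. max 0 (min ((b - a) / Suc m) (t - mesh a b m k)) *\<^sub>R (Suc m / (b - a)) *\<^sub>R (w (Suc k) - w k)))
      has_vector_derivative 0 + interpolant_slope a b m w t) (at t within S)"
    by (intro has_vector_derivative_add has_vector_derivative_const)
  then show ?case by (simp add: interpolant_def[abs_def])
qed

lemma interpolant_slope_absolutely_integrable: "interpolant_slope a b m w absolutely_integrable_on {a..b}"
proof (rule absolutely_integrable_bound_AE)
  show "interpolant_slope a b m w integrable_on {a..b}"
    using abs_continuous_on_has_integral[OF less_imp_le[OF ab] interpolant_abs_continuous
        interpolant_has_vector_derivative] by (rule has_integral_integrable)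
  show "AE t in lebesgue. t \<in> {a..b} \<longrightarrow> norm (interpolant_slope a b m w t) \<le>
      (\<Sum>k\<le>m. norm ((Suc m / (b - a)) *\<^sub>R (w (Suc k) - w k)))"
    unfolding interpolant_slope_def
    by (intro AE_I2 impI sum_norm_le) (auto simp: indicator_def)
qed auto

lemma interpolant_W11: "interpolant a b m w \<in> W11 a b"
  by (rule W11_norm_abs_continuous(1)[OF less_imp_le[OF ab] interpolant_abs_continuous
        interpolant_has_vector_derivative interpolant_slope_absolutely_integrable])

lemma interpolant_slope_eq:
  assumes "t \<in> {a..b}" "\<forall>m k. t \<noteq> mesh a b m k"
  obtains k where "k \<le> m" "mesh a b m k < t" "t < mesh a b m (Suc k)"
    "interpolant_slope a b m w t = (Suc m / (b - a)) *\<^sub>R (w (Suc k) - w k)"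
proof -
  define h where "h = (b - a) / Suc m"
  have h: "0 < h" using ab by (simp add: h_def)
  define k where "k = nat \<lfloor>(t - a) / h\<rfloor>"
  have mesh: "mesh a b m j = a + real j * h" for j by (simp add: mesh_def h_def)
  have "0 \<le> (t - a) / h" using assms(1) h by simp
  then have fl: "real k = of_int \<lfloor>(t - a) / h\<rfloor>" by (simp add: k_def)
  have "real k \<le> (t - a) / h" "(t - a) / h < real k + 1" unfolding fl by linarith+
  then have k1: "mesh a b m k \<le> t" "t < mesh a b m (Suc k)"
    using h by (simp_all add: mesh field_simps)
  then have k2: "mesh a b m k < t" using assms(2) by (metis order_le_less)
  have kb: "mesh a b m (Suc m) = b" using ab by (simp add: mesh_def)
  have "k \<le> m"
  proof (rule ccontr)
    assume "\<not> k \<le> m"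
    then have "mesh a b m (Suc m) \<le> mesh a b m k"
      unfolding mesh using h by (intro add_left_mono mult_right_mono) auto
    then show False using k2 kb assms(1) by simp
  qed
  have uniq: "t \<in> {mesh a b m j<..<mesh a b m (Suc j)} \<longleftrightarrow> j = k" for j
  proof
    assume j: "t \<in> {mesh a b m j<..<mesh a b m (Suc j)}"
    have "real j * h < real (Suc k) * h" "real k * h < real (Suc j) * h"
      using j k1 k2 by (auto simp: mesh)
    then show "j = k" using h by (simp add: mult_less_cancel_right)
  qed (use k1 k2 in auto)
  have "interpolant_slope a b m w t = (\<Sum>j\<le>m. if j = k then (Suc m / (b - a)) *\<^sub>R (w (Suc j) - w j) else 0)"
    unfolding interpolant_slope_def
  proof (intro sum.cong refl)
    fix j
    have "indicator {mesh a b m j<..<mesh a b m (Suc j)} t = (if j = k then 1 else 0 :: real)"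
      unfolding indicator_def uniq by simp
    then show "indicator {mesh a b m j<..<mesh a b m (Suc j)} t *\<^sub>R (Suc m / (b - a)) *\<^sub>R (w (Suc j) - w j)
        = (if j = k then (Suc m / (b - a)) *\<^sub>R (w (Suc j) - w j) else 0)" by simp
  qed
  also have "\<dots> = (Suc m / (b - a)) *\<^sub>R (w (Suc k) - w k)" using \<open>k \<le> m\<close> by simp
  finally show ?thesis using that \<open>k \<le> m\<close> k1 k2 by blast
qed

text \<open>On each cell the slope times the cell length is the increment of the node values, so the
  total variation of the nodes bounds the integral.\<close>

lemma nn_integral_interpolant_slope:
  "(\<integral>\<^sup>+t. norm (interpolant_slope a b m w t) \<partial>lebesgue_on {a..b}) \<le> ennreal (\<Sum>k\<le>m. norm (w (Suc k) - w k))"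
proof -
  let ?I = "\<lambda>k. {mesh a b m k<..<mesh a b m (Suc k)}"
  let ?s = "\<lambda>k. (Suc m / (b - a)) *\<^sub>R (w (Suc k) - w k)"
  have "(\<integral>\<^sup>+t. norm (interpolant_slope a b m w t) \<partial>lebesgue_on {a..b})
      \<le> (\<integral>\<^sup>+t. (\<Sum>k\<le>m. ennreal (norm (?s k)) * indicator (?I k) t) \<partial>lebesgue)"
  proof -
    have "ennreal (norm (interpolant_slope a b m w t)) \<le> (\<Sum>k\<le>m. ennreal (norm (?s k)) * indicator (?I k) t)" for t
    proof -
      have "norm (interpolant_slope a b m w t) \<le> (\<Sum>k\<le>m. norm (?s k) * indicator (?I k) t)"
        unfolding interpolant_slope_def by (intro sum_norm_le) (auto simp: indicator_def)
      then have "ennreal (norm (interpolant_slope a b m w t)) \<le> ennreal (\<Sum>k\<le>m. norm (?s k) * indicator (?I k) t)"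
        by (rule ennreal_leI)
      also have "\<dots> = (\<Sum>k\<le>m. ennreal (norm (?s k) * indicator (?I k) t))"
        by (rule sum_ennreal[symmetric]) auto
      also have "\<dots> = (\<Sum>k\<le>m. ennreal (norm (?s k)) * indicator (?I k) t)"
        by (intro sum.cong refl) (auto simp: indicator_def)
      finally show ?thesis .
    qed
    then show ?thesis
      by (subst nn_integral_restrict_space) (auto intro!: nn_integral_mono simp: indicator_def)
  qed
  also have "\<dots> = (\<Sum>k\<le>m. ennreal (norm (?s k)) * emeasure lebesgue (?I k))"
    by (subst nn_integral_sum) (simp_all add: nn_integral_cmult_indicator
        borel_measurable_times_ennreal borel_measurable_const borel_measurable_indicator)
  also have "\<dots> = (\<Sum>k\<le>m. ennreal (norm (w (Suc k) - w k)))"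
  proof (rule sum.cong[OF refl])
    fix k
    have em: "emeasure lebesgue (?I k) = ennreal ((b - a) / Suc m)"
      using ab by (simp add: mesh_Suc)
    have "ennreal (norm (?s k)) * emeasure lebesgue (?I k) = ennreal (norm (?s k) * ((b - a) / Suc m))"
      unfolding em by (rule ennreal_mult[symmetric]) (use ab in auto)
    also have "norm (?s k) * ((b - a) / Suc m) = norm (w (Suc k) - w k)"
      using ab by simp
    finally show "ennreal (norm (?s k)) * emeasure lebesgue (?I k) = ennreal (norm (w (Suc k) - w k))" .
  qed
  also have "\<dots> = ennreal (\<Sum>k\<le>m. norm (w (Suc k) - w k))" by (rule sum_ennreal) auto
  finally show ?thesis .
qed

end

text \<open>The cell containing \<open>t\<close> shrinks to \<open>t\<close>, and the straddle
  estimate makes the difference quotient of \<open>u\<close> over it converge to \<open>v\<close>.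
  Rounding adds at most \<open>2 / (Suc m)\<^sup>2\<close> to the increment; division by the cell
  length \<open>(b - a) / Suc m\<close> still leaves a null sequence, which is why the tolerance is
  quadratic.\<close>

lemma interpolant_slope_tendsto:
  fixes u :: "real \<Rightarrow> 'b::euclidean_space"
  assumes ab: "a < b" and t: "t \<in> {a..b}" "\<forall>m k. t \<noteq> mesh a b m k"
    and u: "(u has_vector_derivative v) (at t within {a..b})"
    and w: "eventually (\<lambda>m. \<forall>k\<le>Suc m. norm (w m k - u (mesh a b m k)) \<le> 1 / (Suc m)\<^sup>2) sequentially"
  shows "(\<lambda>m. interpolant_slope a b m (w m) t) \<longlonglongrightarrow> v"
  unfolding lim_sequentially
proof (intro allI impI)
  fix e :: real assume "0 < e"
  define e' where "e' = e / 2"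
  have e': "0 < e'" using \<open>0 < e\<close> by (simp add: e'_def)
  obtain d where d: "0 < d"
    "\<And>y. y \<in> {a..b} \<Longrightarrow> norm (y - t) < d \<Longrightarrow> norm (u y - u t - (y - t) *\<^sub>R v) \<le> e' * norm (y - t)"
    using u[unfolded has_vector_derivative_def has_derivative_within_alt] e' by blast
  have "(\<lambda>m. (b - a) / Suc m) \<longlonglongrightarrow> 0" "(\<lambda>m. (2 / (b - a)) / Suc m) \<longlonglongrightarrow> 0"
    using tendsto_mult_right_zero[OF LIMSEQ_inverse_real_of_nat] by (simp_all add: divide_inverse)
  then have "eventually (\<lambda>m. (b - a) / Suc m < d) sequentially"
      "eventually (\<lambda>m. (2 / (b - a)) / Suc m < e') sequentially"
    using d(1) e' order_tendstoD(2) by blast+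
  with w have "eventually (\<lambda>m. dist (interpolant_slope a b m (w m) t) v < e) sequentially"
  proof eventually_elim
    case (elim m)
    define h where "h = (b - a) / Suc m"
    have h: "0 < h" "h < d" using ab elim by (auto simp: h_def)
    obtain k where k: "k \<le> m" "mesh a b m k < t" "t < mesh a b m (Suc k)"
      "interpolant_slope a b m (w m) t = (Suc m / (b - a)) *\<^sub>R (w m (Suc k) - w m k)"
      using interpolant_slope_eq[OF ab t] by blast
    let ?x = "mesh a b m k" and ?y = "mesh a b m (Suc k)"
    have xy: "?y = ?x + h" by (simp only: mesh_Suc h_def)
    have in_ab: "?x \<in> {a..b}" "?y \<in> {a..b}" using mesh_bounds[OF ab] k(1) by auto
    have slope: "interpolant_slope a b m (w m) t = (1 / h) *\<^sub>R (w m (Suc k) - w m k)"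
      using k(4) by (simp add: h_def)
    have "norm (u ?y - u t - (?y - t) *\<^sub>R v) \<le> e' * norm (?y - t)"
      "norm (u ?x - u t - (?x - t) *\<^sub>R v) \<le> e' * norm (?x - t)"
      using d(2)[OF in_ab(2)] d(2)[OF in_ab(1)] h k xy by auto
    moreover have "w m k - u ?x - (w m (Suc k) - u ?y) + h *\<^sub>R (interpolant_slope a b m (w m) t - v)
        = (u ?y - u t - (?y - t) *\<^sub>R v) - (u ?x - u t - (?x - t) *\<^sub>R v)"
      using h by (simp add: slope xy algebra_simps)
    then have "h *\<^sub>R (interpolant_slope a b m (w m) t - v)
        = (u ?y - u t - (?y - t) *\<^sub>R v) - (u ?x - u t - (?x - t) *\<^sub>R v) + ((w m (Suc k) - u ?y) - (w m k - u ?x))"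
      by (simp add: algebra_simps)
    then have "norm (h *\<^sub>R (interpolant_slope a b m (w m) t - v))
        \<le> (norm (u ?y - u t - (?y - t) *\<^sub>R v) + norm (u ?x - u t - (?x - t) *\<^sub>R v))
          + (norm (w m (Suc k) - u ?y) + norm (w m k - u ?x))"
      by (metis add_mono norm_triangle_ineq4 norm_triangle_le)
    moreover have "norm (w m (Suc k) - u ?y) \<le> 1 / (Suc m)\<^sup>2" "norm (w m k - u ?x) \<le> 1 / (Suc m)\<^sup>2"
      using elim(1) k(1) by auto
    moreover have "e' * norm (?y - t) + e' * norm (?x - t) = e' * h"
      using k xy by (simp add: algebra_simps)
    ultimately have "h * norm (interpolant_slope a b m (w m) t - v) \<le> e' * h + 2 * (1 / (Suc m)\<^sup>2)"
      using h by simp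
    also have "2 * (1 / (Suc m)\<^sup>2) = h * ((2 / (b - a)) / Suc m)"
      using ab by (simp add: h_def power2_eq_square[of "real (Suc m)"] divide_simps del: of_nat_Suc)
    also have "\<dots> < h * e'" using elim h by (intro mult_strict_left_mono) auto
    finally have "h * norm (interpolant_slope a b m (w m) t - v) < h * (2 * e')" by (simp add: mult_ac)
    then show ?case using h by (simp add: dist_norm e'_def)
  qed
  then show "\<exists>M. \<forall>m\<ge>M. dist (interpolant_slope a b m (w m) t) v < e"
    by (simp add: eventually_sequentially)
qed

text \<open>No dominating function for the slopes is at hand, so Scheffe's lemma is used: they
  converge almost everywhere, and the limit superior of their L1 norms does not exceed that of
  \<open>v\<close>. Convergence of the positions follows from the initial value and the
  slopes.\<close>

lemma W11_norm_interpolant_tendsto: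
  fixes u v :: "real \<Rightarrow> 'b::euclidean_space"
  assumes ab: "a < b" and u: "abs_continuous_on a b u"
    and deriv: "AE t in lebesgue. t \<in> {a..b} \<longrightarrow> (u has_vector_derivative v t) (at t within {a..b})"
    and v: "v absolutely_integrable_on {a..b}"
    and w: "eventually (\<lambda>m. \<forall>k\<le>Suc m. norm (w m k - u (mesh a b m k)) \<le> 1 / (Suc m)\<^sup>2) sequentially"
  shows "(\<lambda>m. W11_norm a b (\<lambda>t. u t - interpolant a b m (w m) t)) \<longlonglongrightarrow> 0"
proof -
  let ?M = "lebesgue_on {a..b}"
  let ?F = "\<lambda>m. interpolant_slope a b m (w m)"
  have le: "a \<le> b" using ab by simp
  have norm_v: "(\<lambda>t. norm (v t)) integrable_on {a..b}"
    using set_lebesgue_integral_eq_integral(1)[OF absolutely_integrable_norm[OF v]] by (simp add: o_def)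
  have lim: "(\<lambda>m. \<integral>\<^sup>+t. norm (?F m t - v t) \<partial>?M) \<longlonglongrightarrow> 0"
  proof (rule Scheffe_lemma1)
    show "integrable ?M (?F m)" for m
      using interpolant_slope_absolutely_integrable[OF ab] by (simp add: absolutely_integrable_on_iff_integrable)
    show "integrable ?M v" using v by (simp add: absolutely_integrable_on_iff_integrable)
    show "AE t in ?M. (\<lambda>m. ?F m t) \<longlonglongrightarrow> v t"
      unfolding AE_lebesgue_on_iff[OF lmeasurable_cbox[of a b, unfolded box_real, THEN fmeasurableD]]
      using AE_not_mesh[OF ab] deriv
      by eventually_elim (use interpolant_slope_tendsto[OF ab _ _ _ w] in blast)
    have "eventually (\<lambda>m. (\<integral>\<^sup>+t. norm (?F m t) \<partial>?M) \<le> ennreal (integral {a..b} (\<lambda>t. norm (v t)) + 4 / Suc m)) sequentially"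
      using w
    proof eventually_elim
      case (elim m)
      have "(\<Sum>k\<le>m. norm (w m (Suc k) - w m k))
          \<le> (\<Sum>k\<le>m. integral {mesh a b m k..mesh a b m (Suc k)} (\<lambda>t. norm (v t)) + 2 / (Suc m)\<^sup>2)"
      proof (rule sum_mono)
        fix k assume k: "k \<in> {..m}"
        let ?x = "mesh a b m k" and ?y = "mesh a b m (Suc k)"
        have in_ab: "?x \<in> {a..b}" "?y \<in> {a..b}" using mesh_bounds[OF ab] k by auto
        have xy: "?x \<le> ?y" unfolding mesh_Suc using ab by simp
        have sub: "{?x..?y} \<subseteq> {a..b}" using in_ab by auto
        have vi: "(v has_integral u ?y - u ?x) {?x..?y}"
        proof (rule abs_continuous_on_has_integral[OF xy])
          show "abs_continuous_on ?x ?y u" using in_ab by (intro abs_continuous_on_subinterval[OF u]) auto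
          show "AE t in lebesgue. t \<in> {?x..?y} \<longrightarrow> (u has_vector_derivative v t) (at t within {?x..?y})"
            using deriv by eventually_elim (use sub in \<open>auto intro: has_vector_derivative_within_subset\<close>)
        qed
        then have "norm (u ?y - u ?x) \<le> integral {?x..?y} (\<lambda>t. norm (v t))"
          using integral_norm_bound_integral[OF has_integral_integrable[OF vi]
              integrable_on_subinterval[OF norm_v sub]] by (simp add: integral_unique)
        moreover have "norm (w m (Suc k) - u ?y) \<le> 1 / (Suc m)\<^sup>2" "norm (w m k - u ?x) \<le> 1 / (Suc m)\<^sup>2"
          using elim k by auto
        moreover have "norm (w m (Suc k) - w m k) \<le> norm (u ?y - u ?x) + (norm (w m (Suc k) - u ?y) + norm (w m k - u ?x))"
          by norm
        ultimately show "norm (w m (Suc k) - w m k) \<le> integral {?x..?y} (\<lambda>t. norm (v t)) + 2 / (Suc m)\<^sup>2"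
          by simp
      qed
      \<comment> \<open>There are \<open>Suc m\<close> cells, each with rounding error
        \<open>2 / (Suc m)\<^sup>2\<close>.\<close>
      also have "\<dots> = (\<Sum>k\<le>m. integral {mesh a b m k..mesh a b m (Suc k)} (\<lambda>t. norm (v t))) + 2 / Suc m"
        by (simp add: sum.distrib power2_eq_square[of "real (Suc m)"] del: of_nat_Suc)
      also have "(\<Sum>k\<le>j. integral {mesh a b m k..mesh a b m (Suc k)} (\<lambda>t. norm (v t)))
          = integral {a..mesh a b m (Suc j)} (\<lambda>t. norm (v t))" if "j \<le> m" for j
        using that
      proof (induction j)
        case 0
        then show ?case by (simp add: mesh_def)
      next
        case (Suc j)
        have "mesh a b m (Suc j) \<in> {a..b}" "mesh a b m (Suc (Suc j)) \<in> {a..b}"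
          using mesh_bounds[OF ab] Suc.prems by auto
        moreover have "mesh a b m (Suc j) \<le> mesh a b m (Suc (Suc j))"
          unfolding mesh_Suc[of a b m "Suc j"] using ab by simp
        ultimately have "integral {a..mesh a b m (Suc j)} (\<lambda>t. norm (v t))
            + integral {mesh a b m (Suc j)..mesh a b m (Suc (Suc j))} (\<lambda>t. norm (v t))
            = integral {a..mesh a b m (Suc (Suc j))} (\<lambda>t. norm (v t))"
          by (intro Henstock_Kurzweil_Integration.integral_combine integrable_on_subinterval[OF norm_v]) auto
        then show ?case using Suc by simp
      qed
      from this[of m] have "(\<Sum>k\<le>m. integral {mesh a b m k..mesh a b m (Suc k)} (\<lambda>t. norm (v t)))
          = integral {a..b} (\<lambda>t. norm (v t))" using ab by (simp add: mesh_def)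
      finally have "(\<Sum>k\<le>m. norm (w m (Suc k) - w m k)) \<le> integral {a..b} (\<lambda>t. norm (v t)) + 4 / Suc m"
        by (rule order_trans) (simp add: divide_right_mono)
      then show ?case by (intro order_trans[OF nn_integral_interpolant_slope[OF ab]] ennreal_leI)
    qed
    then have "limsup (\<lambda>m. \<integral>\<^sup>+t. norm (?F m t) \<partial>?M) \<le> limsup (\<lambda>m. ennreal (integral {a..b} (\<lambda>t. norm (v t)) + 4 / Suc m))"
      by (rule Limsup_mono)
    also have "\<dots> = ennreal (integral {a..b} (\<lambda>t. norm (v t)) + 0)"
    proof (rule lim_imp_Limsup)
      have "(\<lambda>m. 4 / real (Suc m)) \<longlonglongrightarrow> 0"
        using tendsto_mult_right_zero[OF LIMSEQ_inverse_real_of_nat] by (simp add: divide_inverse)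
      then show "(\<lambda>m. ennreal (integral {a..b} (\<lambda>t. norm (v t)) + 4 / Suc m)) \<longlonglongrightarrow>
          ennreal (integral {a..b} (\<lambda>t. norm (v t)) + 0)"
        by (intro tendsto_ennrealI tendsto_add tendsto_const)
    qed simp
    also have "\<dots> = (\<integral>\<^sup>+t. norm (v t) \<partial>?M)"
      using set_nn_integral_norm[OF v] by (simp add: nn_integral_restrict_space)
    finally show "limsup (\<lambda>m. \<integral>\<^sup>+t. norm (?F m t) \<partial>?M) \<le> (\<integral>\<^sup>+t. norm (v t) \<partial>?M)" .
  qed
  define \<delta> where "\<delta> m = integral {a..b} (\<lambda>t. norm (v t - ?F m t))" for m
  have diff_int: "(\<lambda>t. v t - ?F m t) absolutely_integrable_on {a..b}" for m
    by (intro set_integral_diff v interpolant_slope_absolutely_integrable ab)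
  then have nd_int: "(\<lambda>t. norm (v t - ?F m t)) integrable_on {a..b}" for m
    using set_lebesgue_integral_eq_integral(1)[OF absolutely_integrable_norm[OF diff_int]] by (simp add: o_def)
  have \<delta>0: "0 \<le> \<delta> m" for m unfolding \<delta>_def by (intro integral_nonneg nd_int) auto
  have "(\<integral>\<^sup>+t. norm (?F m t - v t) \<partial>?M) = ennreal (\<delta> m)" for m
    using set_nn_integral_norm[OF diff_int[of m]] by (simp add: nn_integral_restrict_space \<delta>_def norm_minus_commute)
  with lim have "(\<lambda>m. ennreal (\<delta> m)) \<longlonglongrightarrow> 0" by simp
  then have \<delta>_lim: "\<delta> \<longlonglongrightarrow> 0"
    using tendsto_enn2real[of "\<lambda>m. ennreal (\<delta> m)" 0 sequentially] \<delta>0 by simp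
  let ?d = "\<lambda>m t. u t - interpolant a b m (w m) t"
  have ac: "abs_continuous_on a b (?d m)" for m
    by (intro abs_continuous_on_diff u interpolant_abs_continuous ab)
  have der: "AE t in lebesgue. t \<in> {a..b} \<longrightarrow> (?d m has_vector_derivative v t - ?F m t) (at t within {a..b})" for m
    using deriv interpolant_has_vector_derivative[OF ab, of "{a..b}" m "w m"]
    by eventually_elim (auto intro: has_vector_derivative_diff)
  \<comment> \<open>The difference is its value at \<open>a\<close> plus the integral of the slope
    error, whose norm has total mass \<open>\<delta> m\<close>.\<close>
  have d_bound: "norm (?d m t) \<le> norm (?d m a) + \<delta> m" if t: "t \<in> {a..b}" for m t
  proof -
    have sub: "{a..t} \<subseteq> {a..b}" using t by auto
    have hi: "((\<lambda>t. v t - ?F m t) has_integral ?d m t - ?d m a) {a..t}"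
    proof (rule abs_continuous_on_has_integral)
      show "abs_continuous_on a t (?d m)" using t by (intro abs_continuous_on_subinterval[OF ac]) auto
      show "AE r in lebesgue. r \<in> {a..t} \<longrightarrow> (?d m has_vector_derivative v r - ?F m r) (at r within {a..t})"
        using der[of m] by eventually_elim (use sub in \<open>auto intro: has_vector_derivative_within_subset\<close>)
    qed (use t in auto)
    have "norm (integral {a..t} (\<lambda>t. v t - ?F m t)) \<le> integral {a..t} (\<lambda>t. norm (v t - ?F m t))"
      by (rule integral_norm_bound_integral[OF has_integral_integrable[OF hi] integrable_on_subinterval[OF nd_int sub]]) simp
    then have "norm (?d m t - ?d m a) \<le> integral {a..t} (\<lambda>t. norm (v t - ?F m t))"
      unfolding integral_unique[OF hi] .
    also have "\<dots> \<le> \<delta> m"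
      unfolding \<delta>_def by (intro integral_subset_le sub integrable_on_subinterval[OF nd_int sub] nd_int) auto
    finally show ?thesis using norm_triangle_sub[of "?d m t" "?d m a"] by linarith
  qed
  have "eventually (\<lambda>m. norm (?d m a) \<le> 1 / Suc m) sequentially"
    using w
  proof eventually_elim
    case (elim m)
    have "interpolant a b m (w m) a = w m 0"
    proof -
      have "a \<le> mesh a b m k" for k using ab by (simp add: mesh_def)
      then have "max 0 (min ((b - a) / Suc m) (a - mesh a b m k)) = 0" for k
        by (intro max_absorb1 min.coboundedI2) simp
      then show ?thesis unfolding interpolant_def by simp
    qed
    moreover have "norm (w m 0 - u a) \<le> 1 / (Suc m)\<^sup>2" using elim[rule_format, of 0] by (simp add: mesh_def)
    moreover have "1 / (real (Suc m))\<^sup>2 \<le> 1 / Suc m"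
      by (intro divide_left_mono) (auto simp: power2_eq_square)
    ultimately show ?case by (simp add: norm_minus_commute)
  qed
  then have ev: "eventually (\<lambda>m. W11_norm a b (?d m) \<le> ennreal ((b - a) * (1 / Suc m + \<delta> m) + \<delta> m)) sequentially"
  proof eventually_elim
    case (elim m)
    have "?d m absolutely_integrable_on {a..b}"
      using abs_continuous_on_imp_continuous_on[OF ac] by (intro absolutely_integrable_continuous_real)
    then have "(\<lambda>t. norm (?d m t)) integrable_on {a..b}"
      using set_lebesgue_integral_eq_integral(1)[OF absolutely_integrable_norm] by (fastforce simp: o_def)
    then have "integral {a..b} (\<lambda>t. norm (?d m t)) \<le> integral {a..b} (\<lambda>t. 1 / Suc m + \<delta> m)"
    proof (rule integral_le)
      show "norm (?d m t) \<le> 1 / Suc m + \<delta> m" if "t \<in> {a..b}" for t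
        using d_bound[OF that, of m] elim by linarith
    qed auto
    also have "\<dots> = (b - a) * (1 / Suc m + \<delta> m)" using ab by simp
    finally show ?case
      unfolding W11_norm_abs_continuous(2)[OF le ac der diff_int] \<delta>_def by (intro ennreal_leI) simp
  qed
  have "(\<lambda>m. (b - a) * (1 / Suc m + \<delta> m) + \<delta> m) \<longlonglongrightarrow> (b - a) * (0 + 0) + 0"
    using LIMSEQ_inverse_real_of_nat
    by (intro tendsto_intros \<delta>_lim) (simp add: inverse_eq_divide)
  then have "(\<lambda>m. ennreal ((b - a) * (1 / Suc m + \<delta> m) + \<delta> m)) \<longlonglongrightarrow> ennreal 0"
    by (intro tendsto_ennrealI) simp
  then show ?thesis
    by (intro tendsto_sandwich[OF _ ev tendsto_const]) auto
qed

text \<open>The simple functions sample each curve at the mesh nodes, round the samples to a finite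
  set and interpolate. Their level sets involve only samples at fixed times, so measurability in
  \<open>x\<close> at each time suffices.\<close>

theorem W11_strongly_measurable_abs_continuous:
  fixes u v :: "'a::euclidean_space \<Rightarrow> real \<Rightarrow> 'b::euclidean_space"
  assumes ab: "a < b" and A: "A \<in> sets lebesgue"
    and meas: "\<And>t. t \<in> {a..b} \<Longrightarrow> (\<lambda>x. u x t) \<in> borel_measurable lebesgue"
    and ac: "AE x in lebesgue. x \<in> A \<longrightarrow> abs_continuous_on a b (u x) \<and>
      (AE t in lebesgue. t \<in> {a..b} \<longrightarrow> (u x has_vector_derivative v x t) (at t within {a..b})) \<and>
      v x absolutely_integrable_on {a..b}"
  shows "W11_strongly_measurable A a b u"
proof -
  have "\<exists>R :: 'b \<Rightarrow> 'b. finite (range R) \<and> R \<in> borel_measurable borel \<and>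
      (\<forall>y. norm y \<le> real m \<longrightarrow> norm (R y - y) \<le> 1 / (Suc m)\<^sup>2)" for m
    by (rule finite_rounding[of "1 / (Suc m)\<^sup>2" "real m"]) auto
  then obtain R :: "nat \<Rightarrow> 'b \<Rightarrow> 'b" where R: "\<And>m. finite (range (R m))" "\<And>m. R m \<in> borel_measurable borel"
    "\<And>m y. norm y \<le> real m \<Longrightarrow> norm (R m y - y) \<le> 1 / (Suc m)\<^sup>2"
    by metis
  define w where "w x m k = R m (u x (mesh a b m k))" for x m k
  define W where "W m = PiE {..Suc m} (\<lambda>_. range (R m))" for m
  \<comment> \<open>Forgetting values beyond the last node places the samples in the finite set
    \<open>W m\<close>, whence finitely many interpolants.\<close>
  have interp_restrict: "interpolant a b m (w x m) = interpolant a b m (restrict (w x m) {..Suc m})" for x m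
    unfolding interpolant_def by (intro ext arg_cong2[where f = plus] sum.cong) auto
  have restrict_W: "restrict (w x m) {..Suc m} \<in> W m" for x m by (auto simp: W_def w_def)
  have finite_W: "finite (W m)" for m unfolding W_def using R(1) by (intro finite_PiE) auto
  have image: "(\<lambda>x. interpolant a b m (w x m)) ` A \<subseteq> interpolant a b m ` W m" for m
    using restrict_W interp_restrict by blast
  show ?thesis
    unfolding W11_strongly_measurable_def
  proof (intro exI[of _ "\<lambda>m x. interpolant a b m (w x m)"] conjI allI)
    fix m
    show "finite ((\<lambda>x. interpolant a b m (w x m)) ` A)"
      using image finite_W finite_subset by blast
    show "(\<lambda>x. interpolant a b m (w x m)) ` A \<subseteq> W11 a b" using interpolant_W11[OF ab] by blast
    fix g
    have fibre: "{x. w x m k = y} \<in> sets lebesgue" if "k \<le> Suc m" for k y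
    proof -
      have "(\<lambda>x. w x m k) \<in> borel_measurable lebesgue"
        unfolding w_def by (rule measurable_compose[OF meas[OF mesh_bounds[OF ab that]] R(2)])
      then have "(\<lambda>x. w x m k) -` {y} \<inter> space lebesgue \<in> sets lebesgue" by (rule measurable_sets) auto
      then show ?thesis by (simp add: vimage_def)
    qed
    have "{x \<in> A. interpolant a b m (w x m) = g} =
        A \<inter> (\<Union>q\<in>{q\<in>W m. interpolant a b m q = g}. \<Inter>k\<in>{..Suc m}. {x. w x m k = q k})"
    proof (intro equalityI subsetI)
      fix x assume "x \<in> {x \<in> A. interpolant a b m (w x m) = g}"
      then show "x \<in> A \<inter> (\<Union>q\<in>{q\<in>W m. interpolant a b m q = g}. \<Inter>k\<in>{..Suc m}. {x. w x m k = q k})"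
        using restrict_W[of x m] interp_restrict[of m x] by (auto intro!: exI[of _ "restrict (w x m) {..Suc m}"])
    next
      fix x assume "x \<in> A \<inter> (\<Union>q\<in>{q\<in>W m. interpolant a b m q = g}. \<Inter>k\<in>{..Suc m}. {x. w x m k = q k})"
      then obtain q where q: "x \<in> A" "q \<in> W m" "interpolant a b m q = g" "\<forall>k\<le>Suc m. w x m k = q k" by auto
      have "interpolant a b m (w x m) = interpolant a b m q"
        using q(4) unfolding interpolant_def by (intro ext arg_cong2[where f = plus] sum.cong) auto
      then show "x \<in> {x \<in> A. interpolant a b m (w x m) = g}" using q by simp
    qed
    also have "\<dots> \<in> sets lebesgue"
      using A finite_W fibre by (intro sets.Int sets.finite_UN sets.finite_INT) auto
    finally show "{x \<in> A. interpolant a b m (w x m) = g} \<in> sets lebesgue" .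
  next
    show "AE x in lebesgue_on A. (\<lambda>m. W11_norm a b (\<lambda>t. u x t - interpolant a b m (w x m) t)) \<longlonglongrightarrow> 0"
      unfolding AE_lebesgue_on_iff[OF A] using ac
    proof eventually_elim
      case (elim x)
      show ?case
      proof
        assume "x \<in> A"
        with elim have ux: "abs_continuous_on a b (u x)"
          "AE t in lebesgue. t \<in> {a..b} \<longrightarrow> (u x has_vector_derivative v x t) (at t within {a..b})"
          "v x absolutely_integrable_on {a..b}" by auto
        have "bounded (u x ` {a..b})"
          by (intro compact_imp_bounded compact_continuous_image abs_continuous_on_imp_continuous_on ux) auto
        then obtain B where B: "\<And>t. t \<in> {a..b} \<Longrightarrow> norm (u x t) \<le> B" unfolding bounded_iff by blast
        \<comment> \<open>Rounding at level \<open>m\<close> is accurate only on the ball of radius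
          \<open>m\<close>; a continuous curve on a compact interval lies in it from some level
          on.\<close>
        obtain N :: nat where N: "B \<le> real N" using real_arch_simple by blast
        have "\<forall>k\<le>Suc m. norm (w x m k - u x (mesh a b m k)) \<le> 1 / (Suc m)\<^sup>2" if "m \<ge> N" for m
          unfolding w_def
        proof (intro allI impI R(3))
          fix k assume "k \<le> Suc m"
          then show "norm (u x (mesh a b m k)) \<le> real m" using B[OF mesh_bounds[OF ab]] N that by force
        qed
        then have "eventually (\<lambda>m. \<forall>k\<le>Suc m. norm (w x m k - u x (mesh a b m k)) \<le> 1 / (Suc m)\<^sup>2) sequentially"
          unfolding eventually_sequentially by blast
        with ab ux show "(\<lambda>m. W11_norm a b (\<lambda>t. u x t - interpolant a b m (w x m) t)) \<longlonglongrightarrow> 0"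
          by (rule W11_norm_interpolant_tendsto)
      qed
    qed
  qed
qed

section \<open>The flow and its forward trajectories\<close>

text \<open>The restriction to the full-measure set of continuity points is continuous, and
  completeness of the measure absorbs the remaining null set.\<close>

lemma borel_measurable_AE_isCont:
  fixes f :: "'a::euclidean_space \<Rightarrow> 'b::euclidean_space"
  assumes "AE x in lebesgue. isCont f x"
  shows "f \<in> borel_measurable lebesgue"
proof -
  define S where "S = {x. isCont f x}"
  have "negligible (- S)" using assms by (simp add: AE_lebesgue_negligible S_def Collect_neg_eq)
  then have S: "S \<in> sets lebesgue" using negligible_imp_sets Compl_in_sets_lebesgue by blast
  have "continuous_on S f" by (intro continuous_at_imp_continuous_on) (auto simp: S_def)
  then have "f \<in> borel_measurable (lebesgue_on S)" using S by (rule continuous_imp_measurable_on_sets_lebesgue)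
  then have "(\<lambda>x. if x \<in> S then f x else 0) \<in> borel_measurable lebesgue" using S by (intro borel_measurable_if_I)
  then show ?thesis
    by (rule borel_measurable_AE) (use assms in \<open>auto simp: S_def elim!: eventually_mono\<close>)
qed

locale lower_lipschitz_flow =
  fixes T :: real and b :: "real \<Rightarrow> 'a::euclidean_space \<Rightarrow> 'a" and C\<^sub>0 C\<^sub>1 :: "real \<Rightarrow> real"
    and \<phi> :: "real \<Rightarrow> real \<Rightarrow> 'a \<Rightarrow> 'a"
  assumes T_pos: "0 < T"
    and field: "measurable_field T b"
    and C0: "nonneg_L1 T C\<^sub>0" and C1: "nonneg_L1 T C\<^sub>1"
    and growth: "\<forall>t\<in>{0..T}. linear_growth (C\<^sub>0 t) (b t)"
    and lower_lipschitz: "\<forall>t\<in>{0..T}. lower_one_sided_lipschitz (C\<^sub>1 t) (b t)"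
    and flow: "is_flow T b \<phi>"
begin

text \<open>Names the velocity whose existence the backward flow asserts; it has the stated
  properties for almost every \<open>t\<close> in \<open>{0..s}\<close>.\<close>

definition velocity :: "real \<Rightarrow> 'a \<Rightarrow> real \<Rightarrow> 'a" where
  "velocity s x t = (SOME v. v \<in> regularized_field b t (\<phi> t s x) \<and>
     ((\<lambda>t. \<phi> t s x) has_vector_derivative v) (at t within {0..s}))"

lemma AE_growth: "s \<le> T \<Longrightarrow> AE t in lebesgue. t \<in> {0..s} \<longrightarrow> linear_growth (C\<^sub>0 t) (b t)"
  using growth by (intro AE_I2) auto

lemma flow_self: "s \<in> {0..T} \<Longrightarrow> \<phi> s s x = x"
  using flow by (auto simp: is_flow_def is_backward_flow_def)

text \<open>\<open>D\<close> is arbitrary, so the same curve can be tested along whichever dense set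
  an argument selects. Membership in \<open>regularized_field\<close> is used through its growth
  bound and its inclusion in the extension.\<close>

lemma flow_trajectory:
  assumes s: "s \<in> {0..T}"
  shows "trajectory s C\<^sub>0 C\<^sub>1 D b (\<lambda>t. \<phi> t s x) (velocity s x)"
proof -
  have bf: "abs_continuous_on 0 s (\<lambda>t. \<phi> t s x)"
    "AE t in lebesgue_on {0..s}. \<exists>v\<in>regularized_field b t (\<phi> t s x).
        ((\<lambda>t. \<phi> t s x) has_vector_derivative v) (at t within {0..s})"
    using flow s unfolding is_flow_def is_backward_flow_def by blast+
  have "AE t in lebesgue. t \<in> {0..s} \<longrightarrow> (\<exists>v. v \<in> regularized_field b t (\<phi> t s x) \<and>
        ((\<lambda>t. \<phi> t s x) has_vector_derivative v) (at t within {0..s}))"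
    using bf(2) by (simp add: AE_lebesgue_on_iff Bex_def)
  then have vel: "AE t in lebesgue. t \<in> {0..s} \<longrightarrow> velocity s x t \<in> regularized_field b t (\<phi> t s x) \<and>
        ((\<lambda>t. \<phi> t s x) has_vector_derivative velocity s x t) (at t within {0..s})"
  proof eventually_elim
    case (elim t)
    then show ?case
      unfolding velocity_def
      by (intro impI someI_ex[of "\<lambda>v. v \<in> regularized_field b t (\<phi> t s x) \<and>
        ((\<lambda>t. \<phi> t s x) has_vector_derivative v) (at t within {0..s})"]) blast
  qed
  have sub: "t \<in> {0..T}" if "t \<in> {0..s}" for t using s that by auto
  show ?thesis
    unfolding trajectory_def
  proof (intro conjI bf(1))
    show "AE t in lebesgue. t \<in> {0..s} \<longrightarrow> ((\<lambda>t. \<phi> t s x) has_vector_derivative velocity s x t) (at t within {0..s})"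
      using vel by eventually_elim blast
    show "AE t in lebesgue. t \<in> {0..s} \<longrightarrow> norm (velocity s x t) \<le> C\<^sub>0 t * (1 + norm (\<phi> t s x))"
      using vel by eventually_elim (use growth sub regularized_field_norm_le in blast)
    show "AE t in lebesgue. t \<in> {0..s} \<longrightarrow> velocity s x t \<in> monotone_extension D (C\<^sub>1 t) (b t) (\<phi> t s x)"
      using vel by eventually_elim
        (use lower_lipschitz sub regularized_field_subset_monotone_extension in blast)
  qed
qed

lemma flow_unique:
  assumes s: "s \<in> {0..T}" and D: "closure D = UNIV" and X: "trajectory s C\<^sub>0 C\<^sub>1 D b X v" and t: "t \<in> {0..s}"
  shows "X t = \<phi> t s (X s)"
proof (rule trajectory_unique[OF _ _ D AE_growth X flow_trajectory[OF s]])
  show "nonneg_L1 s C\<^sub>1" using nonneg_L1_subinterval[OF C1] s by auto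
  show "X s = \<phi> s s (X s)" using flow_self[OF s] by simp
qed (use s t in auto)

section \<open>Semigroup property, fibres and composition of the flow\<close>

lemma flow_semigroup:
  assumes "0 \<le> r" "r \<le> s" "s \<le> t" "t \<le> T"
  shows "\<phi> r t x = \<phi> r s (\<phi> s t x)"
proof -
  have "trajectory s C\<^sub>0 C\<^sub>1 UNIV b (\<lambda>r. \<phi> r t x) (velocity t x)"
    using assms by (intro trajectory_subinterval[OF flow_trajectory]) auto
  then show ?thesis using assms by (intro flow_unique) auto
qed

lemma flow_lipschitz:
  assumes "0 \<le> s" "s \<le> t" "t \<le> T"
  obtains L where "0 \<le> L" "\<And>x y. norm (\<phi> s t x - \<phi> s t y) \<le> L * norm (x - y)"
proof -
  obtain m where m: "integral {0..t} (\<lambda>t. 2 * C\<^sub>1 t) \<le> real m / 2" using nonneg_L1_integral_bound by blast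
  have t: "t \<in> {0..T}" using assms by auto
  show ?thesis
  proof (rule that[of "sqrt (2 ^ m)"])
    fix x y
    have "norm (\<phi> s t x - \<phi> s t y) \<le> sqrt (2 ^ m) * norm (\<phi> t t x - \<phi> t t y)"
    proof (rule trajectory_lipschitz[OF _ _ closure_UNIV AE_growth flow_trajectory[OF t] flow_trajectory[OF t] m])
      show "nonneg_L1 t C\<^sub>1" using nonneg_L1_subinterval[OF C1] assms by auto
    qed (use assms in auto)
    then show "norm (\<phi> s t x - \<phi> s t y) \<le> sqrt (2 ^ m) * norm (x - y)" using flow_self[OF t] by simp
  qed simp
qed

lemma flow_continuous:
  assumes "0 \<le> s" "s \<le> t" "t \<le> T"
  shows "continuous_on UNIV (\<phi> s t)"
proof -
  obtain L where L: "0 \<le> L" "\<And>x y. norm (\<phi> s t x - \<phi> s t y) \<le> L * norm (x - y)"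
    using flow_lipschitz[OF assms] by blast
  then have "L-lipschitz_on UNIV (\<phi> s t)" by (intro lipschitz_onI) (auto simp: dist_norm)
  then show ?thesis by (rule lipschitz_on_continuous_on)
qed

text \<open>Singleton fibres almost everywhere make the image dense. Preimages of a convergent
  sequence stay bounded, and continuity of the backward map gives a preimage of the limit.\<close>

lemma flow_surj:
  assumes "0 \<le> s" "s \<le> t" "t \<le> T"
  shows "\<exists>x. \<phi> s t x = y"
proof -
  have t: "t \<in> {0..T}" using assms by auto
  have "AE y in lebesgue. \<exists>x. \<phi> s t -` {y} = {x}"
    using flow assms by (auto simp: is_flow_def is_forward_flow_def)
  from AE_countable_dense[OF this] obtain D where
    D: "closure D = UNIV" "\<forall>y\<in>D. \<exists>x. \<phi> s t -` {y} = {x}"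
    by blast
  obtain Y where Y: "\<And>n. Y n \<in> D" "Y \<longlonglongrightarrow> y" using dense_sequence[OF D(1)] by blast
  have "\<forall>n. \<exists>x. \<phi> s t x = Y n" using D(2) Y(1) by blast
  then obtain X where X: "\<And>n. \<phi> s t (X n) = Y n" by metis
  obtain m where m: "integral {0..t} C\<^sub>0 \<le> real m / 2" using nonneg_L1_integral_bound by blast
  have "bounded (range Y)" using Y(2) convergent_imp_bounded by blast
  then obtain B where B: "\<And>n. norm (Y n) \<le> B" unfolding bounded_iff by auto
  have "norm (X n) \<le> 2 ^ m * (1 + B)" for n
  proof -
    \<comment> \<open>The growth estimate is read forward in time here: the final position is
      bounded by the position at time \<open>s\<close>.\<close>
    have "1 + norm (\<phi> t t (X n)) \<le> 2 ^ m * (1 + norm (\<phi> s t (X n)))"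
      using assms nonneg_L1_subinterval[OF C0]
      by (intro trajectory_growth[OF flow_trajectory[OF t, where D = UNIV] _ m]) auto
    also have "\<dots> \<le> 2 ^ m * (1 + B)" unfolding X using B[of n] by (intro mult_left_mono) auto
    finally show ?thesis using flow_self[OF t] by simp
  qed
  then have "bounded (range X)" unfolding bounded_iff by auto
  then obtain x r where r: "strict_mono (r :: nat \<Rightarrow> nat)" "(X \<circ> r) \<longlonglongrightarrow> x"
    using bounded_imp_convergent_subsequence by blast
  have "(\<lambda>n. \<phi> s t ((X \<circ> r) n)) \<longlonglongrightarrow> \<phi> s t x"
    using continuous_on_tendsto_compose[OF flow_continuous[OF assms] r(2)] by auto
  moreover have "(\<lambda>n. \<phi> s t ((X \<circ> r) n)) \<longlonglongrightarrow> y"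
    using LIMSEQ_subseq_LIMSEQ[OF Y(2) r(1)] by (simp add: X o_def)
  ultimately show ?thesis using LIMSEQ_unique by blast
qed

lemma forward_eq:
  assumes "0 \<le> s" "s \<le> t" "t \<le> T" "\<phi> s t -` {x} = {y}"
  shows "\<phi> t s x = y"
  using flow assms by (auto simp: is_flow_def is_forward_flow_def)

text \<open>A point with a single preimage at time \<open>T\<close> has a single preimage at all earlier times.\<close>

lemma forward_via_T:
  assumes s: "0 \<le> s" "s \<le> T" and z: "\<phi> s T -` {x} = {z}" and t: "t \<in> {0..T}"
  shows "\<phi> t s x = \<phi> t T z"
proof -
  have sz: "\<phi> s T z = x" using z by auto
  show ?thesis
  proof (cases "s \<le> t")
    case True
    have "\<phi> s t -` {x} = {\<phi> t T z}"
    proof (intro equalityI subsetI)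
      fix y assume "y \<in> \<phi> s t -` {x}"
      then have y: "\<phi> s t y = x" by simp
      \<comment> \<open>Surjectivity extends any competing preimage up to time \<open>T\<close>,
        where uniqueness of the fibre applies.\<close>
      obtain z' where z': "\<phi> t T z' = y" using flow_surj[of t T] t by auto
      have "\<phi> s T z' = x" using flow_semigroup[of s t T z'] y z' True s t by auto
      then have "z' = z" using z by auto
      then show "y \<in> {\<phi> t T z}" using z' by simp
    next
      fix y assume "y \<in> {\<phi> t T z}"
      then show "y \<in> \<phi> s t -` {x}" using flow_semigroup[of s t T z] sz True s t by auto
    qed
    then show ?thesis using True s t by (intro forward_eq) auto
  next
    case False
    then have "\<phi> t T z = \<phi> t s (\<phi> s T z)" using s t by (intro flow_semigroup) auto
    then show ?thesis by (simp add: sz)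
  qed
qed

lemma AE_fibre:
  assumes "0 \<le> s" "s \<le> t" "t \<le> T"
  shows "AE x in lebesgue. \<phi> s t -` {x} = {\<phi> t s x}"
proof -
  have "AE x in lebesgue. \<exists>y. \<phi> s t -` {x} = {y}"
    using flow assms by (auto simp: is_flow_def is_forward_flow_def)
  then show ?thesis by eventually_elim (use forward_eq[OF assms] in metis)
qed

text \<open>For almost every \<open>x\<close> the fibres over \<open>x\<close> from times
  \<open>s\<close> and \<open>t\<close> are singletons. Then the fibre of \<open>\<phi> s t\<close>
  over \<open>\<phi> s r x\<close> is a singleton too, so the value there is prescribed and the
  exceptional set of \<open>\<phi> t s\<close> is never met.\<close>

lemma flow_composition:
  assumes r: "0 \<le> r" "r \<le> s" "s \<le> t" "t \<le> T"
  shows "AE x in lebesgue. \<phi> t r x = \<phi> t s (\<phi> s r x)"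
proof -
  have "AE x in lebesgue. \<phi> r s -` {x} = {\<phi> s r x}" "AE x in lebesgue. \<phi> r t -` {x} = {\<phi> t r x}"
    using r by (auto intro!: AE_fibre)
  then show ?thesis
  proof eventually_elim
    case (elim x)
    have 1: "\<phi> s t (\<phi> t r x) = \<phi> s r x"
    proof -
      have "\<phi> r t (\<phi> t r x) = x" using elim by auto
      then have "\<phi> r s (\<phi> s t (\<phi> t r x)) = x" using flow_semigroup[OF r] by simp
      then have "\<phi> s t (\<phi> t r x) \<in> \<phi> r s -` {x}" by simp
      then show ?thesis using elim by simp
    qed
    have "\<phi> s t -` {\<phi> s r x} = {\<phi> t r x}"
    proof (intro equalityI subsetI)
      fix w assume "w \<in> \<phi> s t -` {\<phi> s r x}"
      then have "\<phi> r t w = \<phi> r s (\<phi> s r x)" using flow_semigroup[OF r] by simp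
      also have "\<dots> = x" using elim by auto
      finally have "w \<in> \<phi> r t -` {x}" by simp
      then show "w \<in> {\<phi> t r x}" using elim by simp
    qed (use 1 in auto)
    then show ?case using r by (intro forward_eq[symmetric]) auto
  qed
qed

lemma forward_measurable:
  assumes "s \<in> {0..T}" "t \<in> {0..T}"
  shows "\<phi> t s \<in> borel_measurable lebesgue"
proof (cases "s \<le> t")
  case True
  then show ?thesis
    using flow assms by (intro borel_measurable_AE_isCont) (auto simp: is_flow_def is_forward_flow_def)
next
  case False
  then have "continuous_on UNIV (\<phi> t s)" using assms by (intro flow_continuous) auto
  then show ?thesis using borel_measurable_continuous_onI[of "\<phi> t s"] by (simp add: measurable_completion)
qed

section \<open>Joint continuity and avoidance of discontinuities\<close>

lemma uniform_limit_flow: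
  assumes "Z \<longlonglongrightarrow> z"
  shows "uniform_limit {0..T} (\<lambda>n t. \<phi> t T (Z n)) (\<lambda>t. \<phi> t T z) sequentially"
proof (rule uniform_limit_trajectories[where F = "\<lambda>_. b"])
  show "trajectory T C\<^sub>0 C\<^sub>1 UNIV b (\<lambda>t. \<phi> t T (Z n)) (velocity T (Z n))" for n
    using T_pos by (intro flow_trajectory) auto
  show "trajectory T C\<^sub>0 C\<^sub>1 UNIV b (\<lambda>t. \<phi> t T z) (velocity T z)"
    using T_pos by (intro flow_trajectory) auto
  show "(\<lambda>n. \<phi> T T (Z n)) \<longlonglongrightarrow> \<phi> T T z" using assms flow_self T_pos by simp
qed (use T_pos C0 C1 AE_growth in auto)

text \<open>Continuity in time for a fixed end point and uniform dependence on the end point combine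
  to joint continuity. Clamping the time makes the map total, so that Borel measurability holds on
  the whole product space.\<close>

lemma flow_jointly_continuous: "continuous_on UNIV (\<lambda>p. \<phi> (max 0 (min T (fst p))) T (snd p))"
  unfolding continuous_on_sequentially
proof (intro allI ballI impI; elim conjE)
  fix P and p :: "real \<times> 'a" assume P: "P \<longlonglongrightarrow> p"
  define \<tau> where "\<tau> t = max 0 (min T t)" for t
  have \<tau>_in: "\<tau> t \<in> {0..T}" for t using T_pos by (auto simp: \<tau>_def)
  have \<tau>: "(\<lambda>n. \<tau> (fst (P n))) \<longlonglongrightarrow> \<tau> (fst p)" unfolding \<tau>_def by (intro tendsto_intros P)
  have "continuous_on {0..T} (\<lambda>t. \<phi> t T (snd p))"
    using trajectory_continuous[OF flow_trajectory[where D = UNIV]] T_pos by simp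
  then have 1: "(\<lambda>n. \<phi> (\<tau> (fst (P n))) T (snd p)) \<longlonglongrightarrow> \<phi> (\<tau> (fst p)) T (snd p)"
    using \<tau> \<tau>_in by (auto intro: continuous_on_tendsto_compose)
  have "uniform_limit {0..T} (\<lambda>n t. \<phi> t T (snd (P n))) (\<lambda>t. \<phi> t T (snd p)) sequentially"
    by (rule uniform_limit_flow[OF tendsto_snd[OF P]])
  then have 2: "(\<lambda>n. dist (\<phi> (\<tau> (fst (P n))) T (snd (P n))) (\<phi> (\<tau> (fst (P n))) T (snd p))) \<longlonglongrightarrow> 0"
    unfolding uniform_limit_iff tendsto_iff using \<tau>_in by (fastforce elim: eventually_mono)
  have "(\<lambda>n. dist (\<phi> (\<tau> (fst (P n))) T (snd (P n))) (\<phi> (\<tau> (fst (P n))) T (snd p))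
      + dist (\<phi> (\<tau> (fst (P n))) T (snd p)) (\<phi> (\<tau> (fst p)) T (snd p))) \<longlonglongrightarrow> 0 + 0"
    by (intro tendsto_add 2 1[THEN iffD1[OF tendsto_dist_iff]])
  then have "(\<lambda>n. dist (\<phi> (\<tau> (fst (P n))) T (snd (P n))) (\<phi> (\<tau> (fst p)) T (snd p))) \<longlonglongrightarrow> 0"
    by (intro Lim_null_comparison[of "\<lambda>n. dist (\<phi> (\<tau> (fst (P n))) T (snd (P n))) (\<phi> (\<tau> (fst p)) T (snd p))"
          "\<lambda>n. dist (\<phi> (\<tau> (fst (P n))) T (snd (P n))) (\<phi> (\<tau> (fst (P n))) T (snd p))
      + dist (\<phi> (\<tau> (fst (P n))) T (snd p)) (\<phi> (\<tau> (fst p)) T (snd p))"] always_eventually)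
      (simp_all add: dist_triangle)
  then show "((\<lambda>p. \<phi> (max 0 (min T (fst p))) T (snd p)) \<circ> P) \<longlonglongrightarrow> \<phi> (max 0 (min T (fst p))) T (snd p)"
    unfolding o_def \<tau>_def[symmetric] by (rule iffD2[OF tendsto_dist_iff])
qed

lemma AE_cauchy_at_flow:
  assumes s: "0 \<le> s" "s \<le> T" and D: "countable D" "closure D = UNIV"
    and b: "\<And>q. q \<in> D \<Longrightarrow> (\<lambda>t. b t q) \<in> borel_measurable (lebesgue_on {0..T})"
  shows "AE x in lebesgue. AE t in lebesgue. t \<in> {s..T} \<longrightarrow> cauchy_at D (b t) (\<phi> t T (\<phi> T s x))"
proof -
  have "\<phi> T s \<in> borel_measurable (completion lborel)" using s T_pos by (intro forward_measurable) auto
  then obtain z where z: "z \<in> borel_measurable lborel" "AE x in lborel. \<phi> T s x = z x"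
    using completion_ex_borel_measurable_euclidean by blast
  \<comment> \<open>The forward map enters only through the Borel version \<open>z\<close> of
    \<open>\<phi> T s\<close>; composed with the jointly continuous backward flow it makes
    \<open>Y\<close> Borel in time and space together.\<close>
  define Y where "Y p = \<phi> (max 0 (min T (fst p))) T (z (snd p))" for p :: "real \<times> 'a"
  have z_eq: "AE x in lebesgue. \<phi> T s x = z x" using z(2) by (simp add: AE_completion_iff)
  have Y_eq: "Y (t, x) = \<phi> t T (z x)" if "t \<in> {s..T}" for t x
  proof -
    have "max 0 (min T t) = t" using that s by auto
    then show ?thesis by (simp add: Y_def)
  qed
  have "AE x in lebesgue. AE t in lebesgue. t \<in> {s..T} \<longrightarrow> cauchy_at D (b t) (Y (t, x))"
  proof (rule AE_cauchy_at_commute[OF D(1)])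
    show "(\<lambda>t. b t q) \<in> borel_measurable (lebesgue_on {s..T})" if "q \<in> D" for q
      by (rule measurable_restrict_mono[OF b[OF that]]) (use s in auto)
    have "(\<lambda>p :: real \<times> 'a. z (snd p)) \<in> borel_measurable borel"
      using measurable_compose[OF borel_measurable_continuous_onI[OF continuous_on_snd[OF continuous_on_id]], of z]
        z(1) by simp
    then have "(\<lambda>p :: real \<times> 'a. (fst p, z (snd p))) \<in> borel_measurable borel"
      by (rule borel_measurable_Pair[OF borel_measurable_continuous_onI[OF continuous_on_fst[OF continuous_on_id]]])
    from measurable_compose[OF this borel_measurable_continuous_onI[OF flow_jointly_continuous]]
    show "Y \<in> borel_measurable borel" by (simp add: Y_def[abs_def])
    show "AE t in lebesgue. t \<in> {s..T} \<longrightarrow> (AE x in lebesgue. cauchy_at D (b t) (Y (t, x)))"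
    proof (rule AE_I2, rule impI)
      fix t assume t: "t \<in> {s..T}"
      have t': "t \<in> {0..T}" using s t by auto
      have "negligible {y. \<not> cauchy_at D (b t) y}"
        using negligible_not_cauchy_at[OF D(2)] growth lower_lipschitz t' by blast
      then have "negligible (\<phi> s t ` {y. \<not> cauchy_at D (b t) y})"
      proof (rule negligible_locally_Lipschitz_image[rotated])
        have "0 \<le> s" "s \<le> t" "t \<le> T" using s t by auto
        then obtain L where L: "\<And>x y. norm (\<phi> s t x - \<phi> s t y) \<le> L * norm (x - y)"
          using flow_lipschitz by blast
        show "\<exists>S B. open S \<and> x \<in> S \<and> (\<forall>y\<in>{y. \<not> cauchy_at D (b t) y} \<inter> S. norm (\<phi> s t y - \<phi> s t x) \<le> B * norm (y - x))" for x
          using L by (intro exI[of _ UNIV] exI[of _ L]) auto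
      qed simp
      then have "AE x in lebesgue. x \<notin> \<phi> s t ` {y. \<not> cauchy_at D (b t) y}"
        by (simp add: AE_lebesgue_negligible)
      moreover have "AE x in lebesgue. \<phi> s T -` {x} = {\<phi> T s x}" using s by (intro AE_fibre) auto
      ultimately show "AE x in lebesgue. cauchy_at D (b t) (Y (t, x))"
        using z_eq
      proof eventually_elim
        case (elim x)
        \<comment> \<open>Were the position at time \<open>t\<close> a bad point, \<open>x\<close>
          would be its image under \<open>\<phi> s t\<close> and lie in the null set just
          excluded.\<close>
        have "\<phi> s t (\<phi> t T (z x)) = \<phi> s T (z x)" using flow_semigroup[of s t T] s t by simp
        also have "\<dots> = x" using elim by auto
        finally have "\<phi> s t (\<phi> t T (z x)) = x" .
        then show ?case unfolding Y_eq[OF t] using elim(1) by (metis imageI mem_Collect_eq)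
      qed
    qed
  qed auto
  with z_eq show ?thesis
  proof eventually_elim
    case (elim x)
    from elim(2) show ?case by eventually_elim (use Y_eq elim(1) in auto)
  qed
qed

end

section \<open>Trajectories as elements of W11, and classical flows\<close>

lemma AE_lebesgue_on_interval:
  fixes a b :: real
  shows "(AE t in lebesgue_on {a..b}. P t) \<longleftrightarrow> (AE t in lebesgue. t \<in> {a..b} \<longrightarrow> P t)"
  by (rule AE_lebesgue_on_iff) simp

lemma nonneg_L1_add:
  assumes "nonneg_L1 T k" "nonneg_L1 T l"
  shows "nonneg_L1 T (\<lambda>t. k t + l t)"
  using assms by (auto simp: nonneg_L1_def intro: set_integral_add)

lemma trajectory_mono:
  assumes X: "trajectory T k c D f X v" and "\<And>t. t \<in> {0..T} \<Longrightarrow> k t \<le> k' t" "\<And>t. t \<in> {0..T} \<Longrightarrow> c t \<le> c' t"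
  shows "trajectory T k' c' D f X v"
  unfolding trajectory_def
proof (intro conjI trajectoryD(1,2)[OF X])
  show "AE t in lebesgue. t \<in> {0..T} \<longrightarrow> norm (v t) \<le> k' t * (1 + norm (X t))"
    using trajectoryD(3)[OF X]
  proof eventually_elim
    case (elim t)
    show ?case
    proof
      assume t: "t \<in> {0..T}"
      then have "norm (v t) \<le> k t * (1 + norm (X t))" using elim by blast
      also have "\<dots> \<le> k' t * (1 + norm (X t))" using assms(2)[OF t] by (intro mult_right_mono) auto
      finally show "norm (v t) \<le> k' t * (1 + norm (X t))" .
    qed
  qed
  show "AE t in lebesgue. t \<in> {0..T} \<longrightarrow> v t \<in> monotone_extension D (c' t) (f t) (X t)"
    using trajectoryD(4)[OF X] by eventually_elim (use assms(3) monotone_extension_mono in blast)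
qed

text \<open>A forward curve is known only to agree with a trajectory on \<open>{0..T}\<close>; this
  transfers its regularity.\<close>

lemma trajectory_deriv_subinterval:
  assumes X: "trajectory T k c D f X v" and ab: "0 \<le> a" "b \<le> T"
    and eq: "\<forall>t\<in>{0..T}. u t = X t"
  shows "abs_continuous_on a b u"
    and "AE t in lebesgue. t \<in> {a..b} \<longrightarrow> (u has_vector_derivative v t) (at t within {a..b})"
proof -
  have sub: "{a..b} \<subseteq> {0..T}" using ab by auto
  have "abs_continuous_on a b X" using ab by (intro abs_continuous_on_subinterval[OF trajectoryD(1)[OF X]])
  then show "abs_continuous_on a b u" using abs_continuous_on_cong[of a b u X] eq sub by blast
  show "AE t in lebesgue. t \<in> {a..b} \<longrightarrow> (u has_vector_derivative v t) (at t within {a..b})"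
    using trajectoryD(2)[OF X]
  proof eventually_elim
    case (elim t)
    show ?case
    proof
      assume t: "t \<in> {a..b}"
      then have "(X has_vector_derivative v t) (at t within {a..b})"
        using elim sub by (blast intro: has_vector_derivative_within_subset)
      then show "(u has_vector_derivative v t) (at t within {a..b})"
        by (rule has_vector_derivative_transform[OF t, rotated]) (use eq sub in auto)
    qed
  qed
qed

lemma trajectory_velocity_integral_le:
  assumes X: "trajectory T k c D f X v" and k: "nonneg_L1 T k" and ab: "0 \<le> a" "a \<le> b" "b \<le> T"
    and B: "\<forall>t\<in>{0..T}. 1 + norm (X t) \<le> B"
  shows "integral {a..b} (\<lambda>t. norm (v t)) \<le> B * integral {a..b} k"
proof -
  have sub: "{a..b} \<subseteq> {0..T}" using ab by auto
  then have ki: "k integrable_on {a..b}"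
    using k absolutely_integrable_on_subinterval set_lebesgue_integral_eq_integral(1) unfolding nonneg_L1_def by blast
  have vi: "(\<lambda>t. norm (v t)) integrable_on {a..b}"
    using set_lebesgue_integral_eq_integral(1)[OF absolutely_integrable_norm[OF
        trajectory_absolutely_integrable[OF X k ab]]] by (simp add: o_def)
  have "integral {a..b} (\<lambda>t. norm (v t)) \<le> integral {a..b} (\<lambda>t. B * k t)"
  proof (rule integral_le_AE[OF vi integrable_on_mult_right[OF ki]])
    show "AE t in lebesgue. t \<in> {a..b} \<longrightarrow> norm (v t) \<le> B * k t"
      using trajectoryD(3)[OF X]
    proof eventually_elim
      case (elim t)
      show ?case
      proof
        assume "t \<in> {a..b}"
        then have t: "t \<in> {0..T}" using sub by blast
        then have "norm (v t) \<le> k t * (1 + norm (X t))" using elim by blast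
        also have "\<dots> \<le> k t * B" using k t bspec[OF B t] by (intro mult_left_mono) (auto simp: nonneg_L1_def)
        finally show "norm (v t) \<le> B * k t" by (simp add: mult.commute)
      qed
    qed
  qed
  then show ?thesis by simp
qed

lemma trajectory_W11_norm_le:
  assumes X: "trajectory T k c D f X v" and k: "nonneg_L1 T k" and ab: "0 \<le> a" "a \<le> b" "b \<le> T"
    and B: "\<forall>t\<in>{0..T}. 1 + norm (X t) \<le> B"
    and eq: "\<forall>t\<in>{0..T}. u t = X t"
  shows "W11_norm a b u \<le> ennreal (B * (b - a) + B * integral {a..b} k)"
proof -
  note u = trajectory_deriv_subinterval[OF X ab(1,3) eq]
  have sub: "{a..b} \<subseteq> {0..T}" using ab by auto
  have "continuous_on {a..b} (\<lambda>t. norm (u t))"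
    by (intro continuous_intros abs_continuous_on_imp_continuous_on[OF u(1)])
  then have "integral {a..b} (\<lambda>t. norm (u t)) \<le> integral {a..b} (\<lambda>t. B)"
  proof (intro integral_le integrable_continuous_real)
    fix t assume "t \<in> {a..b}"
    then have t: "t \<in> {0..T}" using sub by blast
    show "norm (u t) \<le> B" using bspec[OF B t] bspec[OF eq t] by simp
  qed auto
  then have "integral {a..b} (\<lambda>t. norm (u t)) \<le> B * (b - a)" using ab by (simp add: mult.commute)
  then show ?thesis
    unfolding W11_norm_abs_continuous(2)[OF ab(2) u trajectory_absolutely_integrable[OF X k ab]]
    using trajectory_velocity_integral_le[OF X k ab B] by (intro ennreal_leI add_mono) auto
qed

lemma trajectory_diff_W11_norm:
  assumes X: "trajectory T k c D F X V" and Y: "trajectory T k c D f Y v" and k: "nonneg_L1 T k"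
    and ab: "0 \<le> a" "a \<le> b" "b \<le> T"
    and eq: "\<forall>t\<in>{0..T}. u t = X t" "\<forall>t\<in>{0..T}. u' t = Y t"
  shows "abs_continuous_on a b (\<lambda>t. u t - u' t)"
    and "AE t in lebesgue. t \<in> {a..b} \<longrightarrow>
      ((\<lambda>t. u t - u' t) has_vector_derivative V t - v t) (at t within {a..b})"
    and "(\<lambda>t. V t - v t) absolutely_integrable_on {a..b}"
    and "W11_norm a b (\<lambda>t. u t - u' t) =
      ennreal (integral {a..b} (\<lambda>t. norm (u t - u' t)) + integral {a..b} (\<lambda>t. norm (V t - v t)))"
proof -
  note u = trajectory_deriv_subinterval[OF X ab(1,3) eq(1)]
  note u' = trajectory_deriv_subinterval[OF Y ab(1,3) eq(2)]
  show 1: "abs_continuous_on a b (\<lambda>t. u t - u' t)" by (intro abs_continuous_on_diff u u')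
  show 2: "AE t in lebesgue. t \<in> {a..b} \<longrightarrow>
      ((\<lambda>t. u t - u' t) has_vector_derivative V t - v t) (at t within {a..b})"
    using u(2) u'(2) by eventually_elim (auto intro: has_vector_derivative_diff)
  show 3: "(\<lambda>t. V t - v t) absolutely_integrable_on {a..b}"
    by (intro set_integral_diff trajectory_absolutely_integrable[OF X k ab] trajectory_absolutely_integrable[OF Y k ab])
  show "W11_norm a b (\<lambda>t. u t - u' t) =
      ennreal (integral {a..b} (\<lambda>t. norm (u t - u' t)) + integral {a..b} (\<lambda>t. norm (V t - v t)))"
    by (rule W11_norm_abs_continuous(2)[OF ab(2) 1 2 3])
qed

lemma trajectory_diff_W11_norm_le:
  assumes X: "trajectory T k c D F X V" and Y: "trajectory T k c D f Y v" and k: "nonneg_L1 T k"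
    and ab: "0 \<le> a" "a \<le> b" "b \<le> T"
    and B: "\<forall>t\<in>{0..T}. 1 + norm (X t) \<le> B" "\<forall>t\<in>{0..T}. 1 + norm (Y t) \<le> B"
    and eq: "\<forall>t\<in>{0..T}. u t = X t" "\<forall>t\<in>{0..T}. u' t = Y t"
  shows "W11_norm a b (\<lambda>t. u t - u' t) \<le> ennreal (2 * (B * (b - a) + B * integral {a..b} k))"
proof -
  note d = trajectory_diff_W11_norm[OF X Y k ab eq]
  have sub: "{a..b} \<subseteq> {0..T}" using ab by auto
  have "continuous_on {a..b} (\<lambda>t. norm (u t - u' t))"
    by (intro continuous_on_norm abs_continuous_on_imp_continuous_on[OF d(1)])
  then have "integral {a..b} (\<lambda>t. norm (u t - u' t)) \<le> integral {a..b} (\<lambda>t. 2 * B)"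
  proof (intro integral_le integrable_continuous_real)
    fix t assume "t \<in> {a..b}"
    then have t: "t \<in> {0..T}" using sub by blast
    have "norm (u t - u' t) \<le> norm (u t) + norm (u' t)" by (rule norm_triangle_ineq4)
    then show "norm (u t - u' t) \<le> 2 * B" using bspec[OF B(1) t] bspec[OF B(2) t] bspec[OF eq(1) t] bspec[OF eq(2) t] by simp
  qed auto
  then have 1: "integral {a..b} (\<lambda>t. norm (u t - u' t)) \<le> 2 * (B * (b - a))" using ab by (simp add: mult_ac)
  have Vi: "(\<lambda>t. norm (V t)) integrable_on {a..b}" and vi: "(\<lambda>t. norm (v t)) integrable_on {a..b}"
    and di: "(\<lambda>t. norm (V t - v t)) integrable_on {a..b}"
    using set_lebesgue_integral_eq_integral(1)[OF absolutely_integrable_norm[OF trajectory_absolutely_integrable[OF X k ab]]]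
      set_lebesgue_integral_eq_integral(1)[OF absolutely_integrable_norm[OF trajectory_absolutely_integrable[OF Y k ab]]]
      set_lebesgue_integral_eq_integral(1)[OF absolutely_integrable_norm[OF d(3)]] by (simp_all add: o_def)
  have "integral {a..b} (\<lambda>t. norm (V t - v t)) \<le> integral {a..b} (\<lambda>t. norm (V t) + norm (v t))"
    by (intro integral_le di integrable_add Vi vi) (rule norm_triangle_ineq4)
  also have "\<dots> = integral {a..b} (\<lambda>t. norm (V t)) + integral {a..b} (\<lambda>t. norm (v t))"
    by (intro Henstock_Kurzweil_Integration.integral_add Vi vi)
  also have "\<dots> \<le> B * integral {a..b} k + B * integral {a..b} k"
    by (intro add_mono trajectory_velocity_integral_le[OF X k ab B(1)] trajectory_velocity_integral_le[OF Y k ab B(2)])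
  finally show ?thesis unfolding d(4) using 1 by (intro ennreal_leI) simp
qed

lemma classical_flow_trajectory:
  assumes "is_classical_flow T f \<psi>" and "s \<in> {0..T}"
    and "AE t in lebesgue_on {0..T}. linear_growth (k t) (f t) \<and> lower_one_sided_lipschitz (c t) (f t)"
  shows "trajectory T k c D f (\<lambda>t. \<psi> t s x) (\<lambda>t. f t (\<psi> t s x))"
proof -
  have cf: "abs_continuous_on 0 T (\<lambda>t. \<psi> t s x)"
    "AE t in lebesgue_on {0..T}. ((\<lambda>t. \<psi> t s x) has_vector_derivative f t (\<psi> t s x)) (at t within {0..T})"
    using assms(1,2) unfolding is_classical_flow_def by blast+
  have gr: "AE t in lebesgue. t \<in> {0..T} \<longrightarrow> linear_growth (k t) (f t) \<and> lower_one_sided_lipschitz (c t) (f t)"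
    using assms(3) by (simp only: AE_lebesgue_on_interval)
  show ?thesis
    unfolding trajectory_def
  proof (intro conjI cf(1))
    show "AE t in lebesgue. t \<in> {0..T} \<longrightarrow>
        ((\<lambda>t. \<psi> t s x) has_vector_derivative f t (\<psi> t s x)) (at t within {0..T})"
      using cf(2) by (simp add: AE_lebesgue_on_iff)
    show "AE t in lebesgue. t \<in> {0..T} \<longrightarrow> norm (f t (\<psi> t s x)) \<le> k t * (1 + norm (\<psi> t s x))"
      using gr by eventually_elim (simp add: linear_growth_def)
    show "AE t in lebesgue. t \<in> {0..T} \<longrightarrow> f t (\<psi> t s x) \<in> monotone_extension D (c t) (f t) (\<psi> t s x)"
      using gr by eventually_elim (use lower_one_sided_lipschitz_monotone_extension in blast)
  qed
qed

text \<open>Provides measurability in the starting point of the regularized flow. The one-sided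
  condition controls distances only backwards in time, so the forward estimate uses the spatial
  Lipschitz constant; its dependence on the regularization is harmless for this purpose.\<close>

lemma classical_flow_continuous:
  fixes f :: "real \<Rightarrow> 'a::euclidean_space \<Rightarrow> 'a"
  assumes cf: "is_classical_flow T f \<psi>" and lip: "L1_lipschitz_field T f"
    and gr: "AE t in lebesgue_on {0..T}. linear_growth (k t) (f t) \<and> lower_one_sided_lipschitz (c t) (f t)"
    and s: "0 \<le> s" and t: "t \<in> {s..T}"
  shows "continuous_on UNIV (\<psi> t s)"
proof -
  obtain L where L: "nonneg_L1 T L" "AE t in lebesgue_on {0..T}. lipschitz_on (L t) UNIV (f t)"
    using lip by (auto simp: L1_lipschitz_field_def)
  have L_ae: "AE t in lebesgue. t \<in> {0..T} \<longrightarrow> lipschitz_on (L t) UNIV (f t)"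
    using L(2) by (simp add: AE_lebesgue_on_iff)
  have sub: "{s..T} \<subseteq> {0..T}" using s by auto
  have sT: "s \<in> {0..T}" using s t by auto
  have L_abs: "L absolutely_integrable_on {s..T}"
    using L(1) sub absolutely_integrable_on_subinterval unfolding nonneg_L1_def by blast
  obtain m where m: "integral {s..T} L \<le> real m / 2"
    using real_arch_simple[of "2 * integral {s..T} L"] by (auto simp: field_simps)
  have "norm (\<psi> t s x - \<psi> t s y) \<le> 2 ^ m * norm (x - y)" for x y
  proof -
    let ?X = "\<lambda>t. \<psi> t s x" and ?Y = "\<lambda>t. \<psi> t s y"
    note X = classical_flow_trajectory[OF cf sT gr, of UNIV x]
    note Y = classical_flow_trajectory[OF cf sT gr, of UNIV y]
    have init: "?X s = x" "?Y s = y" using cf sT by (auto simp: is_classical_flow_def)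
    have cont: "continuous_on {s..T} (\<lambda>t. norm (?X t - ?Y t))"
      using trajectory_continuous[OF X] trajectory_continuous[OF Y] sub
      by (intro continuous_on_norm continuous_on_diff) (auto intro: continuous_on_subset)
    have "(\<lambda>t. norm (?X t - ?Y t) * L t) absolutely_integrable_on {s..T}"
      using cont L_abs
      by (intro absolutely_integrable_bounded_measurable_product_real
          continuous_imp_measurable_on_sets_lebesgue compact_imp_bounded compact_continuous_image) auto
    then have Lu_abs: "(\<lambda>t. L t * norm (?X t - ?Y t)) absolutely_integrable_on {s..T}"
      by (simp only: mult.commute)
    have Lu: "(\<lambda>t. L t * norm (?X t - ?Y t)) integrable_on {s..r}" if "r \<in> {s..T}" for r
      using integrable_on_subinterval[OF set_lebesgue_integral_eq_integral(1)[OF Lu_abs]] that by auto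
    show ?thesis
    proof (rule gronwall_forward[of L s T "\<lambda>t. norm (?X t - ?Y t)"])
      show "L integrable_on {s..T}" using set_lebesgue_integral_eq_integral(1)[OF L_abs] .
      show "(\<lambda>t. L t * norm (?X t - ?Y t)) integrable_on {s..T}" using Lu t by auto
      show "0 \<le> L t" if "t \<in> {s..T}" for t using L(1) sub that by (auto simp: nonneg_L1_def)
    next
      fix r assume r: "r \<in> {s..T}"
      have r': "0 \<le> s" "s \<le> r" "r \<le> T" using s r by auto
      have i: "((\<lambda>t. f t (?X t) - f t (?Y t)) has_integral (?X r - ?X s) - (?Y r - ?Y s)) {s..r}"
        by (intro has_integral_diff trajectory_has_integral[OF X r'] trajectory_has_integral[OF Y r'])
      have "norm (integral {s..r} (\<lambda>t. f t (?X t) - f t (?Y t))) \<le> integral {s..r} (\<lambda>t. L t * norm (?X t - ?Y t))"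
      proof (rule integral_norm_bound_AE[OF has_integral_integrable[OF i] Lu[OF r]])
        show "AE t in lebesgue. t \<in> {s..r} \<longrightarrow> norm (f t (?X t) - f t (?Y t)) \<le> L t * norm (?X t - ?Y t)"
          using L_ae
        proof eventually_elim
          case (elim t)
          show ?case using elim r' lipschitz_on_normD[of "L t" UNIV "f t" "?X t" "?Y t"] by auto
        qed
      qed
      then have "norm ((?X r - x) - (?Y r - y)) \<le> integral {s..r} (\<lambda>t. L t * norm (?X t - ?Y t))"
        unfolding integral_unique[OF i] init .
      moreover have "norm (?X r - ?Y r) \<le> norm (x - y) + norm ((?X r - x) - (?Y r - y))" by norm
      ultimately show "norm (?X r - ?Y r) \<le> norm (x - y) + integral {s..r} (\<lambda>t. L t * norm (?X t - ?Y t))"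
        by linarith
    qed (use m t in auto)
  qed
  then have "(2 ^ m)-lipschitz_on UNIV (\<psi> t s)" by (intro lipschitz_onI) (auto simp: dist_norm)
  then show ?thesis by (rule lipschitz_on_continuous_on)
qed

section \<open>Forward trajectories as solutions of the integral equation\<close>

context lower_lipschitz_flow
begin

text \<open>The quantifier over \<open>t\<close> stands inside: one null set of starting points
  serves all times, because the only exceptional set is that of \<open>\<phi> s T\<close>.\<close>

lemma AE_forward:
  assumes s: "s \<in> {0..T}"
  shows "AE x in lebesgue. \<phi> s T -` {x} = {\<phi> T s x} \<and> (\<forall>t\<in>{0..T}. \<phi> t s x = \<phi> t T (\<phi> T s x))"
proof -
  have "AE x in lebesgue. \<phi> s T -` {x} = {\<phi> T s x}" using s by (intro AE_fibre) auto
  then show ?thesis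
  proof eventually_elim
    case (elim x)
    have "\<phi> t s x = \<phi> t T (\<phi> T s x)" if "t \<in> {0..T}" for t
      by (rule forward_via_T[OF _ _ elim that]) (use s in auto)
    with elim show ?case by blast
  qed
qed

text \<open>The selected velocity lies in the extension through \<open>regularized_field\<close>,
  and \<open>b t\<close> at the position lies in it by the one-sided condition; single-valuedness
  identifies them.\<close>

lemma velocity_eq_field:
  assumes s: "s \<in> {0..T}" and D: "closure D = UNIV"
    and ca: "AE t in lebesgue. t \<in> {s..T} \<longrightarrow> cauchy_at D (b t) (\<phi> t T z)"
  shows "AE t in lebesgue. t \<in> {s..T} \<longrightarrow> velocity T z t = b t (\<phi> t T z)"
proof -
  have "T \<in> {0..T}" using T_pos by simp
  from ca trajectoryD(4)[OF flow_trajectory[OF this, of D z]] show ?thesis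
  proof eventually_elim
    case (elim t)
    show ?case
    proof
      assume t: "t \<in> {s..T}"
      then have t': "t \<in> {0..T}" using s by auto
      have "b t (\<phi> t T z) \<in> monotone_extension D (C\<^sub>1 t) (b t) (\<phi> t T z)"
        using lower_lipschitz t' by (intro lower_one_sided_lipschitz_monotone_extension) blast
      then show "velocity T z t = b t (\<phi> t T z)"
        using cauchy_at_monotone_extension_unique[OF D] elim t t' by blast
    qed
  qed
qed

lemma forward_solution:
  assumes s: "s \<in> {0..T}"
  shows "AE x in lebesgue. abs_continuous_on s T (\<lambda>t. \<phi> t s x) \<and>
         (\<forall>t\<in>{s..T}. set_integrable lebesgue {s..t} (\<lambda>r. b r (\<phi> r s x)) \<and>
            \<phi> t s x = x + (LINT r:{s..t}|lebesgue. b r (\<phi> r s x)))"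
proof -
  obtain D where D: "countable D" "closure D = UNIV"
    "\<forall>q\<in>D. (\<lambda>t. b t q) \<in> borel_measurable (lebesgue_on {0..T})"
    using AE_countable_dense[OF measurable_field_sections[OF field]] by blast
  have "AE x in lebesgue. AE t in lebesgue. t \<in> {s..T} \<longrightarrow> cauchy_at D (b t) (\<phi> t T (\<phi> T s x))"
    using s D by (intro AE_cauchy_at_flow) auto
  with AE_forward[OF s] show ?thesis
  proof eventually_elim
    case (elim x)
    define z where "z = \<phi> T s x"
    have "\<phi> s T -` {x} = {z}" and z2: "\<forall>t\<in>{0..T}. \<phi> t s x = \<phi> t T z"
      using elim(1) unfolding z_def by blast+
    then have "z \<in> \<phi> s T -` {x}" by blast
    then have z: "\<phi> s T z = x" by simp
    have "T \<in> {0..T}" using T_pos by simp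
    note X = flow_trajectory[OF this, of D z]
    have vel: "AE t in lebesgue. t \<in> {s..T} \<longrightarrow> velocity T z t = b t (\<phi> t T z)"
      using elim(2) unfolding z_def[symmetric] by (rule velocity_eq_field[OF s D(2)])
    show ?case
    proof (intro conjI ballI)
      show "abs_continuous_on s T (\<lambda>t. \<phi> t s x)"
        using s by (intro trajectory_deriv_subinterval(1)[OF X _ _ z2]) auto
      fix t assume t: "t \<in> {s..T}"
      have st: "0 \<le> s" "s \<le> t" "t \<le> T" using s t by auto
      have "AE r in lebesgue. r \<in> {s..t} \<longrightarrow> velocity T z r = b r (\<phi> r s x)"
        using vel by eventually_elim (use st z2 in auto)
      then have N: "negligible {r. \<not> (r \<in> {s..t} \<longrightarrow> velocity T z r = b r (\<phi> r s x))}"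
        by (simp only: AE_lebesgue_negligible)
      show int: "set_integrable lebesgue {s..t} (\<lambda>r. b r (\<phi> r s x))"
        by (rule absolutely_integrable_spike[OF trajectory_absolutely_integrable[OF X C0 st] N]) auto
      have "(velocity T z has_integral \<phi> t T z - \<phi> s T z) {s..t}"
        by (rule trajectory_has_integral[OF X st])
      then have "((\<lambda>r. b r (\<phi> r s x)) has_integral \<phi> t T z - \<phi> s T z) {s..t}"
        by (rule has_integral_spike[OF N, rotated]) auto
      then show "\<phi> t s x = x + (LINT r:{s..t}|lebesgue. b r (\<phi> r s x))"
        unfolding set_lebesgue_integral_eq_integral(2)[OF int] using z z2 st by (simp add: integral_unique)
    qed
  qed
qed

lemma forward_bound:
  assumes s: "s \<in> {0..T}" and m: "integral {0..T} C\<^sub>0 \<le> real m / 2" and "\<phi> s T z = x" "t \<in> {0..T}"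
  shows "1 + norm (\<phi> t T z) \<le> 2 ^ m * (1 + norm x)"
proof -
  have "T \<in> {0..T}" using T_pos by simp
  from trajectory_growth[OF flow_trajectory[OF this] C0 m assms(4) s, of z] show ?thesis using assms(3) by simp
qed

text \<open>For almost every \<open>x\<close> the curve is a backward trajectory on the whole of
  \<open>{0..T}\<close>, so the selected velocity already gives the norm; the growth estimate bounds
  it uniformly for \<open>x\<close> in a compact set.\<close>

lemma flow_LpW11_loc:
  assumes s: "s \<in> {0..T}" and p: "1 \<le> p"
  shows "(\<lambda>x t. \<phi> t s x) \<in> LpW11_loc p 0 T"
  unfolding LpW11_loc_def LpW11_def mem_Collect_eq
proof (intro allI impI conjI)
  fix K :: "'a set" assume K: "compact K"
  have T: "T \<in> {0..T}" "0 \<le> T" using T_pos by auto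
  have Km: "K \<in> lmeasurable" using K by (rule lmeasurable_compact)
  show "W11_strongly_measurable K 0 T (\<lambda>x t. \<phi> t s x)"
  proof (rule W11_strongly_measurable_abs_continuous[OF T_pos fmeasurableD[OF Km]])
    show "(\<lambda>x. \<phi> t s x) \<in> borel_measurable lebesgue" if "t \<in> {0..T}" for t
      by (rule forward_measurable[OF s that])
    show "AE x in lebesgue. x \<in> K \<longrightarrow> abs_continuous_on 0 T (\<lambda>t. \<phi> t s x) \<and>
      (AE t in lebesgue. t \<in> {0..T} \<longrightarrow>
        ((\<lambda>t. \<phi> t s x) has_vector_derivative velocity T (\<phi> T s x) t) (at t within {0..T})) \<and>
      velocity T (\<phi> T s x) absolutely_integrable_on {0..T}"
      using AE_forward[OF s]
    proof eventually_elim
      case (elim x)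
      note X = flow_trajectory[OF T(1), of UNIV "\<phi> T s x"]
      have "\<forall>t\<in>{0..T}. \<phi> t s x = \<phi> t T (\<phi> T s x)" using elim by blast
      note u = trajectory_deriv_subinterval[OF X order_refl order_refl this]
      show ?case
        by (intro impI conjI u trajectory_absolutely_integrable[OF X C0 order_refl T(2) order_refl])
    qed
  qed
  obtain r where r: "0 < r" "\<And>x. x \<in> K \<Longrightarrow> norm x \<le> r"
    using compact_imp_bounded[OF K] unfolding bounded_pos by auto
  obtain m where m: "integral {0..T} C\<^sub>0 \<le> real m / 2" using nonneg_L1_integral_bound by blast
  define B where "B = 2 ^ m * (1 + r)"
  have B: "0 \<le> B" using r by (simp add: B_def)
  have I: "0 \<le> integral {0..T} C\<^sub>0"
    using C0 by (intro integral_nonneg set_lebesgue_integral_eq_integral(1)) (auto simp: nonneg_L1_def)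
  show "LpW11_norm p K 0 T (\<lambda>x t. \<phi> t s x) < \<infinity>"
  proof (rule LpW11_norm_finite[OF Km p])
    show "0 \<le> B * (T - 0) + B * integral {0..T} C\<^sub>0" using B T I by simp
    show "AE x in lebesgue. x \<in> K \<longrightarrow>
        W11_norm 0 T (\<lambda>t. \<phi> t s x) \<le> ennreal (B * (T - 0) + B * integral {0..T} C\<^sub>0)"
      using AE_forward[OF s]
    proof eventually_elim
      case (elim x)
      show ?case
      proof
        assume x: "x \<in> K"
        have "\<phi> T s x \<in> \<phi> s T -` {x}" using elim by blast
        then have "\<phi> s T (\<phi> T s x) = x" by simp
        then have bnd: "\<forall>t\<in>{0..T}. 1 + norm (\<phi> t T (\<phi> T s x)) \<le> B"
        proof (intro ballI)
          fix t assume "\<phi> s T (\<phi> T s x) = x" "t \<in> {0..T}"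
          have "1 + norm (\<phi> t T (\<phi> T s x)) \<le> 2 ^ m * (1 + norm x)"
            by (rule forward_bound[OF s m]) fact+
          also have "\<dots> \<le> B" unfolding B_def using r(2)[OF x] by (intro mult_left_mono) auto
          finally show "1 + norm (\<phi> t T (\<phi> T s x)) \<le> B" .
        qed
        show "W11_norm 0 T (\<lambda>t. \<phi> t s x) \<le> ennreal (B * (T - 0) + B * integral {0..T} C\<^sub>0)"
          by (rule trajectory_W11_norm_le[OF flow_trajectory[OF T(1), of UNIV] C0 order_refl T(2) order_refl bnd])
            (use elim in blast)
      qed
    qed
  qed
qed

end

section \<open>Regularizations\<close>

locale regularized_flow = lower_lipschitz_flow T b C\<^sub>0 C\<^sub>1 \<phi>
  for T b C\<^sub>0 C\<^sub>1 and \<phi> :: "real \<Rightarrow> real \<Rightarrow> 'a::euclidean_space \<Rightarrow> 'a" +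
  fixes b\<epsilon> :: "real \<Rightarrow> real \<Rightarrow> 'a \<Rightarrow> 'a" and \<phi>\<epsilon> :: "real \<Rightarrow> real \<Rightarrow> real \<Rightarrow> 'a \<Rightarrow> 'a"
    and K\<^sub>0 K\<^sub>1 :: "real \<Rightarrow> real" and s :: real
  assumes lipschitz_field: "0 < \<epsilon> \<Longrightarrow> L1_lipschitz_field T (b\<epsilon> \<epsilon>)"
    and field_tendsto: "AE z in lebesgue_on ({0..T} \<times> UNIV).
        ((\<lambda>\<epsilon>. b\<epsilon> \<epsilon> (fst z) (snd z)) \<longlongrightarrow> b (fst z) (snd z)) (at_right 0)"
    and K0: "nonneg_L1 T K\<^sub>0" and K1: "nonneg_L1 T K\<^sub>1"
    and bounds: "0 < \<epsilon> \<Longrightarrow> AE t in lebesgue_on {0..T}.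
           linear_growth (K\<^sub>0 t) (b\<epsilon> \<epsilon> t) \<and> lower_one_sided_lipschitz (K\<^sub>1 t) (b\<epsilon> \<epsilon> t)"
    and classical: "0 < \<epsilon> \<Longrightarrow> is_classical_flow T (b\<epsilon> \<epsilon>) (\<phi>\<epsilon> \<epsilon>)"
    and s: "0 \<le> s" "s < T"
begin

text \<open>The sums dominate the constants of both the limit field and the regularizations, so all
  trajectories share the same pair \<open>k\<close>, \<open>c\<close>, as the stability lemmas
  require.\<close>

definition k where "k t = C\<^sub>0 t + K\<^sub>0 t"
definition c where "c t = C\<^sub>1 t + K\<^sub>1 t"

lemma sT: "s \<in> {0..T}" "T \<in> {0..T}" "0 \<le> T" "s \<le> T"
  using s T_pos by auto

lemma k: "nonneg_L1 T k"
  unfolding k_def[abs_def] by (rule nonneg_L1_add[OF C0 K0])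

lemma c: "nonneg_L1 T c"
  unfolding c_def[abs_def] by (rule nonneg_L1_add[OF C1 K1])

lemma k_bounds: "t \<in> {0..T} \<Longrightarrow> C\<^sub>0 t \<le> k t" "t \<in> {0..T} \<Longrightarrow> K\<^sub>0 t \<le> k t"
    "t \<in> {0..T} \<Longrightarrow> C\<^sub>1 t \<le> c t" "t \<in> {0..T} \<Longrightarrow> K\<^sub>1 t \<le> c t"
  using C0 C1 K0 K1 by (auto simp: k_def c_def nonneg_L1_def)

lemma AE_growth': "AE t in lebesgue. t \<in> {0..T} \<longrightarrow> linear_growth (k t) (b t)"
proof (intro AE_I2 impI)
  fix t assume t: "t \<in> {0..T}"
  have "C\<^sub>0 t * (1 + norm x) \<le> k t * (1 + norm x)" for x :: 'a
    using k_bounds(1)[OF t] by (intro mult_right_mono) auto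
  then show "linear_growth (k t) (b t)"
    using growth t unfolding linear_growth_def by (meson order_trans)
qed

lemma limit_trajectory: "trajectory T k c D b (\<lambda>t. \<phi> t T z) (velocity T z)"
  by (rule trajectory_mono[OF flow_trajectory[OF sT(2)] k_bounds(1,3)])

lemma approx_trajectory:
  assumes "0 < \<epsilon>"
  shows "trajectory T k c D (b\<epsilon> \<epsilon>) (\<lambda>t. \<phi>\<epsilon> \<epsilon> t s x) (\<lambda>t. b\<epsilon> \<epsilon> t (\<phi>\<epsilon> \<epsilon> t s x))"
  by (rule trajectory_mono[OF classical_flow_trajectory[OF classical[OF assms] sT(1) bounds[OF assms]] k_bounds(2,4)])

lemma approx_start: "0 < \<epsilon> \<Longrightarrow> \<phi>\<epsilon> \<epsilon> s s x = x"
  using classical sT(1) by (auto simp: is_classical_flow_def)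

lemma uniform_bound:
  fixes R :: real
  assumes "0 \<le> R"
  obtains B where "0 \<le> B" "\<And>\<epsilon> x. 0 < \<epsilon> \<Longrightarrow> norm x \<le> R \<Longrightarrow> \<forall>t\<in>{0..T}. 1 + norm (\<phi>\<epsilon> \<epsilon> t s x) \<le> B"
    "\<And>z x. \<phi> s T z = x \<Longrightarrow> norm x \<le> R \<Longrightarrow> \<forall>t\<in>{0..T}. 1 + norm (\<phi> t T z) \<le> B"
proof -
  obtain m where m: "integral {0..T} k \<le> real m / 2" using nonneg_L1_integral_bound by blast
  have le: "2 ^ m * (1 + norm x) \<le> 2 ^ m * (1 + R)" if "norm x \<le> R" for x :: 'a
    using that by (intro mult_left_mono) auto
  show ?thesis
  proof (rule that[of "2 ^ m * (1 + R)"])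
    show "\<forall>t\<in>{0..T}. 1 + norm (\<phi>\<epsilon> \<epsilon> t s x) \<le> 2 ^ m * (1 + R)" if "0 < \<epsilon>" "norm x \<le> R" for \<epsilon> x
    proof
      fix t assume "t \<in> {0..T}"
      from trajectory_growth[OF approx_trajectory[OF that(1)] k m this sT(1), of x]
      show "1 + norm (\<phi>\<epsilon> \<epsilon> t s x) \<le> 2 ^ m * (1 + R)"
        unfolding approx_start[OF that(1)] by (rule order_trans[OF _ le[OF that(2)]])
    qed
    show "\<forall>t\<in>{0..T}. 1 + norm (\<phi> t T z) \<le> 2 ^ m * (1 + R)" if "\<phi> s T z = x" "norm x \<le> R" for z x
    proof
      fix t assume "t \<in> {0..T}"
      from trajectory_growth[OF limit_trajectory k m this sT(1), of z]
      show "1 + norm (\<phi> t T z) \<le> 2 ^ m * (1 + R)" unfolding that(1) by (rule order_trans[OF _ le[OF that(2)]])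
    qed
  qed (use assms in auto)
qed

text \<open>The exceptional set comes from \<open>AE_forward\<close> alone and is thus independent
  of \<open>\<epsilon>\<close>, although \<open>\<epsilon>\<close> ranges over an uncountable set.
  The constant serves as dominating function in the starting point.\<close>

lemma difference_bound:
  fixes R :: real
  assumes "0 \<le> R"
  obtains M where "0 \<le> M" "AE x in lebesgue. x \<in> ball 0 R \<longrightarrow>
    (\<forall>\<epsilon>>0. W11_norm s T (\<lambda>t. \<phi>\<epsilon> \<epsilon> t s x - \<phi> t s x) \<le> ennreal M)"
proof -
  obtain B where B: "0 \<le> B" "\<And>\<epsilon> x. 0 < \<epsilon> \<Longrightarrow> norm x \<le> R \<Longrightarrow> \<forall>t\<in>{0..T}. 1 + norm (\<phi>\<epsilon> \<epsilon> t s x) \<le> B"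
    "\<And>z x. \<phi> s T z = x \<Longrightarrow> norm x \<le> R \<Longrightarrow> \<forall>t\<in>{0..T}. 1 + norm (\<phi> t T z) \<le> B"
    using uniform_bound[OF assms] by blast
  define M where "M = 2 * (B * (T - s) + B * integral {s..T} k)"
  have "{s..T} \<subseteq> {0..T}" using s by auto
  then have "k absolutely_integrable_on {s..T}"
    using k absolutely_integrable_on_subinterval unfolding nonneg_L1_def by blast
  then have "0 \<le> integral {s..T} k"
    using k s by (intro integral_nonneg set_lebesgue_integral_eq_integral(1)) (auto simp: nonneg_L1_def)
  then have "0 \<le> M" using B(1) s by (simp add: M_def)
  moreover have "AE x in lebesgue. x \<in> ball 0 R \<longrightarrow>
    (\<forall>\<epsilon>>0. W11_norm s T (\<lambda>t. \<phi>\<epsilon> \<epsilon> t s x - \<phi> t s x) \<le> ennreal M)"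
    using AE_forward[OF sT(1)]
  proof eventually_elim
    case (elim x)
    have "\<phi> T s x \<in> \<phi> s T -` {x}" and eq: "\<forall>t\<in>{0..T}. \<phi> t s x = \<phi> t T (\<phi> T s x)" using elim by blast+
    then have z: "\<phi> s T (\<phi> T s x) = x" by simp
    show ?case
    proof (intro impI allI)
      fix \<epsilon> :: real assume x: "x \<in> ball 0 R" and \<epsilon>: "0 < \<epsilon>"
      have x': "norm x \<le> R" using x by simp
      show "W11_norm s T (\<lambda>t. \<phi>\<epsilon> \<epsilon> t s x - \<phi> t s x) \<le> ennreal M"
        unfolding M_def
        by (rule trajectory_diff_W11_norm_le[OF approx_trajectory[OF \<epsilon>, of UNIV] limit_trajectory k s(1) sT(4) order_refl
              B(2)[OF \<epsilon> x'] B(3)[OF z x'] _ eq]) simp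
    qed
  qed
  ultimately show ?thesis using that by blast
qed

text \<open>\<open>LpW11_norm\<close> is defined for maps that need not be measurable; membership
  shows that the norms in the limit statement are those of genuine elements of the space.\<close>

lemma difference_LpW11:
  assumes p: "1 \<le> p" and R: "0 < R" and \<epsilon>: "0 < \<epsilon>"
  shows "(\<lambda>x t. \<phi>\<epsilon> \<epsilon> t s x - \<phi> t s x) \<in> LpW11 p (ball 0 R) s T"
  unfolding LpW11_def mem_Collect_eq
proof
  show "W11_strongly_measurable (ball 0 R) s T (\<lambda>x t. \<phi>\<epsilon> \<epsilon> t s x - \<phi> t s x)"
  proof (rule W11_strongly_measurable_abs_continuous[OF s(2)])
    show "ball 0 R \<in> sets (lebesgue :: 'a measure)" by simp
    fix t assume t: "t \<in> {s..T}"
    then have t': "t \<in> {0..T}" using s by auto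
    have "continuous_on UNIV (\<phi>\<epsilon> \<epsilon> t s)"
      by (rule classical_flow_continuous[OF classical[OF \<epsilon>] lipschitz_field[OF \<epsilon>] bounds[OF \<epsilon>] s(1) t])
    then have "\<phi>\<epsilon> \<epsilon> t s \<in> borel_measurable lebesgue"
      using borel_measurable_continuous_onI[of "\<phi>\<epsilon> \<epsilon> t s"] by (simp add: measurable_completion)
    then show "(\<lambda>x. \<phi>\<epsilon> \<epsilon> t s x - \<phi> t s x) \<in> borel_measurable lebesgue"
      using forward_measurable[OF sT(1) t'] by (rule borel_measurable_diff)
  next
    show "AE x in lebesgue. x \<in> ball 0 R \<longrightarrow> abs_continuous_on s T (\<lambda>t. \<phi>\<epsilon> \<epsilon> t s x - \<phi> t s x) \<and>
      (AE t in lebesgue. t \<in> {s..T} \<longrightarrow> ((\<lambda>t. \<phi>\<epsilon> \<epsilon> t s x - \<phi> t s x) has_vector_derivative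
         b\<epsilon> \<epsilon> t (\<phi>\<epsilon> \<epsilon> t s x) - velocity T (\<phi> T s x) t) (at t within {s..T})) \<and>
      (\<lambda>t. b\<epsilon> \<epsilon> t (\<phi>\<epsilon> \<epsilon> t s x) - velocity T (\<phi> T s x) t) absolutely_integrable_on {s..T}"
      using AE_forward[OF sT(1)]
    proof eventually_elim
      case (elim x)
      then have eq: "\<forall>t\<in>{0..T}. \<phi> t s x = \<phi> t T (\<phi> T s x)" by blast
      have "\<forall>t\<in>{0..T}. \<phi>\<epsilon> \<epsilon> t s x = \<phi>\<epsilon> \<epsilon> t s x" by simp
      note d = trajectory_diff_W11_norm[OF approx_trajectory[OF \<epsilon>, of UNIV] limit_trajectory k s(1) sT(4) order_refl this eq]
      show ?case by (intro impI conjI d)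
    qed
  qed
  obtain M where M: "0 \<le> M" "AE x in lebesgue. x \<in> ball 0 R \<longrightarrow>
    (\<forall>\<epsilon>>0. W11_norm s T (\<lambda>t. \<phi>\<epsilon> \<epsilon> t s x - \<phi> t s x) \<le> ennreal M)"
    using difference_bound[OF less_imp_le[OF R]] by blast
  show "LpW11_norm p (ball 0 R) s T (\<lambda>x t. \<phi>\<epsilon> \<epsilon> t s x - \<phi> t s x) < \<infinity>"
    by (rule LpW11_norm_finite[OF _ p M(1)]) (use M(2) \<epsilon> in \<open>auto elim!: eventually_mono\<close>)
qed

lemma AE_difference_tendsto:
  fixes S :: "nat \<Rightarrow> real"
  assumes S: "\<And>n. 0 < S n" "S \<longlonglongrightarrow> 0"
  shows "AE x in lebesgue. (\<lambda>n. W11_norm s T (\<lambda>t. \<phi>\<epsilon> (S n) t s x - \<phi> t s x)) \<longlonglongrightarrow> 0"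
proof -
  have S0: "filterlim S (at_right 0) sequentially"
    using S less_imp_neq[OF S(1), symmetric] by (simp add: filterlim_at)
  have "AE z in lebesgue. fst z \<in> {0..T} \<longrightarrow> (\<lambda>n. b\<epsilon> (S n) (fst z) (snd z)) \<longlonglongrightarrow> b (fst z) (snd z)"
  proof -
    have "{0..T} \<times> (UNIV :: 'a set) \<in> sets lebesgue"
      by (intro sets_completionI_sets) (simp add: borel_closed closed_Times)
    from AE_lebesgue_on_iff[OF this] have "AE z in lebesgue. z \<in> {0..T} \<times> UNIV \<longrightarrow>
        ((\<lambda>\<epsilon>. b\<epsilon> \<epsilon> (fst z) (snd z)) \<longlongrightarrow> b (fst z) (snd z)) (at_right 0)"
      using field_tendsto by simp
    then show ?thesis
    proof eventually_elim
      case (elim z)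
      show ?case using elim filterlim_compose[OF _ S0] by (auto simp: mem_Times_iff)
    qed
  qed
  from AE_lebesgue_prod[OF this]
  have conv: "AE q in lebesgue. AE t in lebesgue. t \<in> {0..T} \<longrightarrow> (\<lambda>n. b\<epsilon> (S n) t q) \<longlonglongrightarrow> b t q" .
  \<comment> \<open>Both requirements on the points of \<open>D\<close> are collected before it is
    chosen: measurable sections for the avoidance of discontinuities, and convergence along
    \<open>S\<close> for stability.\<close>
  have "AE q in lebesgue. (\<lambda>t. b t q) \<in> borel_measurable (lebesgue_on {0..T}) \<and>
      (AE t in lebesgue. t \<in> {0..T} \<longrightarrow> (\<lambda>n. b\<epsilon> (S n) t q) \<longlonglongrightarrow> b t q)"
    using measurable_field_sections[OF field] conv by eventually_elim blast
  from AE_countable_dense[OF this] obtain D where D: "countable D" "closure D = UNIV"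
    "\<forall>q\<in>D. (\<lambda>t. b t q) \<in> borel_measurable (lebesgue_on {0..T}) \<and>
      (AE t in lebesgue. t \<in> {0..T} \<longrightarrow> (\<lambda>n. b\<epsilon> (S n) t q) \<longlonglongrightarrow> b t q)" by blast
  have "AE t in lebesgue. \<forall>q\<in>D. t \<in> {0..T} \<longrightarrow> (\<lambda>n. b\<epsilon> (S n) t q) \<longlonglongrightarrow> b t q"
    unfolding AE_ball_countable[OF D(1)] using D(3) by blast
  then have F: "AE t in lebesgue. t \<in> {0..T} \<longrightarrow> (\<forall>q\<in>D. (\<lambda>n. b\<epsilon> (S n) t q) \<longlonglongrightarrow> b t q)"
    by eventually_elim blast
  have F_sub: "AE t in lebesgue. t \<in> {0..T} \<longrightarrow> (\<forall>q\<in>D. (\<lambda>n. b\<epsilon> (S (r n)) t q) \<longlonglongrightarrow> b t q)"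
    if "strict_mono r" for r
    using F by eventually_elim (use LIMSEQ_subseq_LIMSEQ[OF _ that] in \<open>fastforce simp: o_def\<close>)
  have "AE x in lebesgue. AE t in lebesgue. t \<in> {s..T} \<longrightarrow> cauchy_at D (b t) (\<phi> t T (\<phi> T s x))"
    using D s by (intro AE_cauchy_at_flow) auto
  with AE_forward[OF sT(1)] show ?thesis
  proof eventually_elim
    case (elim x)
    define z where "z = \<phi> T s x"
    have fibre: "\<phi> s T -` {x} = {z}" and eq: "\<forall>t\<in>{0..T}. \<phi> t s x = \<phi> t T z"
      using elim(1) unfolding z_def by blast+
    have ca: "AE t in lebesgue. t \<in> {s..T} \<longrightarrow> cauchy_at D (b t) (\<phi> t T z)" using elim(2) by (simp only: z_def)
    define X where "X n t = \<phi>\<epsilon> (S n) t s x" for n t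
    define V where "V n t = b\<epsilon> (S n) t (X n t)" for n t
    have X: "trajectory T k c D (b\<epsilon> (S n)) (X n) (V n)" for n
      unfolding X_def V_def by (rule approx_trajectory[OF S(1)])
    have X_start: "X n s = x" for n unfolding X_def by (rule approx_start[OF S(1)])
    \<comment> \<open>The stability lemmas take convergence at the final time as input, but here
      only the common position \<open>x\<close> at time \<open>s\<close> is known.\<close>
    have end_lim: "(\<lambda>n. X n T) \<longlonglongrightarrow> z"
    proof (rule tendsto_subseqI)
      fix r :: "nat \<Rightarrow> nat" assume r: "strict_mono r"
      obtain B where "\<And>\<epsilon> y. 0 < \<epsilon> \<Longrightarrow> norm y \<le> norm x \<Longrightarrow> \<forall>t\<in>{0..T}. 1 + norm (\<phi>\<epsilon> \<epsilon> t s y) \<le> B"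
        using uniform_bound[of "norm x"] by (metis norm_ge_zero)
      then have "1 + norm (X n T) \<le> B" for n unfolding X_def using S(1) sT(2) by blast
      then have "norm (X n T) \<le> B" for n by (smt (verit))
      then have "bounded (range (\<lambda>n. X (r n) T))" unfolding bounded_iff by blast
      then obtain \<zeta> r' where r': "strict_mono (r' :: nat \<Rightarrow> nat)" "((\<lambda>n. X (r n) T) \<circ> r') \<longlonglongrightarrow> \<zeta>"
        using bounded_imp_convergent_subsequence by blast
      have "uniform_limit {0..T} (\<lambda>n. X (r (r' n))) (\<lambda>t. \<phi> t T \<zeta>) sequentially"
      proof (rule uniform_limit_trajectories[where F = "\<lambda>n. b\<epsilon> (S (r (r' n)))" and V = "\<lambda>n. V (r (r' n))",
            OF sT(3) k c D(2) AE_growth' F_sub[OF strict_mono_o[OF r r'(1)], unfolded o_def] X limit_trajectory])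
        show "(\<lambda>n. X (r (r' n)) T) \<longlonglongrightarrow> \<phi> T T \<zeta>" using r'(2) flow_self[OF sT(2)] by (simp add: o_def)
      qed
      then have "(\<lambda>n. X (r (r' n)) s) \<longlonglongrightarrow> \<phi> s T \<zeta>" using sT(1) by (rule tendsto_uniform_limitI)
      \<comment> \<open>The positions at \<open>s\<close> are constantly \<open>x\<close>, so
        stability towards the trajectory ending at \<open>\<zeta>\<close> places
        \<open>\<zeta>\<close> in the one-point fibre over \<open>x\<close>.\<close>
      then have "\<phi> s T \<zeta> = x" unfolding X_start by (simp add: LIMSEQ_const_iff)
      then have "\<zeta> \<in> \<phi> s T -` {x}" by simp
      then have "\<zeta> = z" unfolding fibre by simp
      with r' show "\<exists>r'. strict_mono r' \<and> (\<lambda>n. X (r (r' n)) T) \<longlonglongrightarrow> z" by (auto simp: o_def)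
    qed
    have end_lim': "(\<lambda>n. X n T) \<longlonglongrightarrow> \<phi> T T z" unfolding flow_self[OF sT(2)] by (rule end_lim)
    note setting = sT(3) k c D(2) AE_growth' F X limit_trajectory end_lim'
    have unif: "uniform_limit {0..T} X (\<lambda>t. \<phi> t T z) sequentially"
      by (rule uniform_limit_trajectories[OF setting])
    have vel: "(\<lambda>n. integral {s..T} (\<lambda>t. norm (V n t - velocity T z t))) \<longlonglongrightarrow> 0"
      by (rule velocities_tendsto[OF setting s(1) ca])
    have norm_eq: "W11_norm s T (\<lambda>t. \<phi>\<epsilon> (S n) t s x - \<phi> t s x) =
        ennreal (integral {s..T} (\<lambda>t. norm (X n t - \<phi> t s x)) + integral {s..T} (\<lambda>t. norm (V n t - velocity T z t)))" for n
      unfolding X_def[symmetric]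
      by (rule trajectory_diff_W11_norm(4)[OF X[of n] limit_trajectory k s(1) sT(4) order_refl _ eq]) simp
    have pos: "(\<lambda>n. integral {s..T} (\<lambda>t. norm (X n t - \<phi> t s x))) \<longlonglongrightarrow> 0"
      unfolding lim_sequentially
    proof (intro allI impI)
      fix e :: real assume "0 < e"
      define e' where "e' = e / (2 * (T - s))"
      have "0 < e'" using \<open>0 < e\<close> s by (simp add: e'_def)
      with unif obtain N where N: "\<And>n t. n \<ge> N \<Longrightarrow> t \<in> {0..T} \<Longrightarrow> dist (X n t) (\<phi> t T z) < e'"
        unfolding uniform_limit_iff eventually_sequentially by blast
      have "dist (integral {s..T} (\<lambda>t. norm (X n t - \<phi> t s x))) 0 < e" if n: "n \<ge> N" for n
      proof -
        have cont: "continuous_on {s..T} (\<lambda>t. norm (X n t - \<phi> t s x))"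
          by (intro continuous_on_norm abs_continuous_on_imp_continuous_on
              trajectory_diff_W11_norm(1)[OF X[of n] limit_trajectory k s(1) sT(4) order_refl _ eq]) simp
        have "integral {s..T} (\<lambda>t. norm (X n t - \<phi> t s x)) \<le> integral {s..T} (\<lambda>t. e')"
        proof (intro integral_le integrable_continuous_real cont)
          fix t assume "t \<in> {s..T}"
          then have t: "t \<in> {0..T}" using s by auto
          show "norm (X n t - \<phi> t s x) \<le> e'" using N[OF n t] bspec[OF eq t] by (simp add: dist_norm)
        qed auto
        also have "\<dots> = e / 2" using s by (simp add: e'_def field_simps)
        also have "\<dots> < e" using \<open>0 < e\<close> by simp
        finally have "integral {s..T} (\<lambda>t. norm (X n t - \<phi> t s x)) < e" .
        moreover have "0 \<le> integral {s..T} (\<lambda>t. norm (X n t - \<phi> t s x))"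
          by (intro integral_nonneg integrable_continuous_real cont) simp
        ultimately show ?thesis by simp
      qed
      then show "\<exists>N. \<forall>n\<ge>N. dist (integral {s..T} (\<lambda>t. norm (X n t - \<phi> t s x))) 0 < e" by blast
    qed
    have "(\<lambda>n. ennreal (integral {s..T} (\<lambda>t. norm (X n t - \<phi> t s x)) + integral {s..T} (\<lambda>t. norm (V n t - velocity T z t))))
        \<longlonglongrightarrow> ennreal (0 + 0)"
      by (intro tendsto_ennrealI tendsto_add pos vel)
    then show ?case unfolding norm_eq by simp
  qed
qed

lemma difference_tendsto:
  assumes p: "1 \<le> p" and R: "0 < R"
  shows "((\<lambda>\<epsilon>. LpW11_norm p (ball 0 R) s T (\<lambda>x t. \<phi>\<epsilon> \<epsilon> t s x - \<phi> t s x)) \<longlongrightarrow> 0) (at_right 0)"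
\<comment> \<open>Reduction to sequences, for which dominated convergence is available both in time
  and in the starting point.\<close>
proof (rule tendsto_at_right_sequentially[of 0 1])
  fix S :: "nat \<Rightarrow> real" assume S: "\<And>n. 0 < S n" "S \<longlonglongrightarrow> 0"
  obtain M where M: "0 \<le> M" "AE x in lebesgue. x \<in> ball 0 R \<longrightarrow>
    (\<forall>\<epsilon>>0. W11_norm s T (\<lambda>t. \<phi>\<epsilon> \<epsilon> t s x - \<phi> t s x) \<le> ennreal M)"
    using difference_bound[OF less_imp_le[OF R]] by blast
  show "(\<lambda>n. LpW11_norm p (ball 0 R) s T (\<lambda>x t. \<phi>\<epsilon> (S n) t s x - \<phi> t s x)) \<longlonglongrightarrow> 0"
  proof (rule LpW11_norm_tendsto_0[OF _ p M(1)])
    show "AE x in lebesgue. x \<in> ball 0 R \<longrightarrow>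
        (\<forall>n. W11_norm s T (\<lambda>t. \<phi>\<epsilon> (S n) t s x - \<phi> t s x) \<le> ennreal M)"
      using M(2) by eventually_elim (use S(1) in blast)
    show "AE x in lebesgue. x \<in> ball 0 R \<longrightarrow> (\<lambda>n. W11_norm s T (\<lambda>t. \<phi>\<epsilon> (S n) t s x - \<phi> t s x)) \<longlonglongrightarrow> 0"
      using AE_difference_tendsto[OF S] by eventually_elim blast
  qed simp
qed simp

end

theorem theorem4p8:
  fixes T p s :: real
    and b :: "real \<Rightarrow> 'a::euclidean_space \<Rightarrow> 'a"
    and C\<^sub>0 C\<^sub>1 :: "real \<Rightarrow> real"
    and \<phi> :: "real \<Rightarrow> real \<Rightarrow> 'a \<Rightarrow> 'a"
  assumes "0 < T"
    and "measurable_field T b"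
    and "nonneg_L1 T C\<^sub>0" and "nonneg_L1 T C\<^sub>1"
    and "\<forall>t\<in>{0..T}. linear_growth (C\<^sub>0 t) (b t)"
    and "\<forall>t\<in>{0..T}. lower_one_sided_lipschitz (C\<^sub>1 t) (b t)"
    and "is_flow T b \<phi>"
    and "1 \<le> p"
    and "0 \<le> s" and "s < T"
  shows "(\<lambda>x t. \<phi> t s x) \<in> LpW11_loc p 0 T
    \<and> (AE x in lebesgue.
         abs_continuous_on s T (\<lambda>t. \<phi> t s x) \<and>
         (\<forall>t\<in>{s..T}.
            set_integrable lebesgue {s..t} (\<lambda>r. b r (\<phi> r s x)) \<and>
            \<phi> t s x = x + (LINT r:{s..t}|lebesgue. b r (\<phi> r s x))))
    \<and> (\<forall>b\<epsilon> \<phi>\<epsilon>. admissible_regularization T b b\<epsilon> \<and> (\<forall>\<epsilon>>0. is_classical_flow T (b\<epsilon> \<epsilon>) (\<phi>\<epsilon> \<epsilon>)) \<longrightarrow>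
         (\<forall>R>0.
            (\<forall>\<epsilon>>0. (\<lambda>x t. \<phi>\<epsilon> \<epsilon> t s x - \<phi> t s x) \<in> LpW11 p (ball 0 R) s T) \<and>
            ((\<lambda>\<epsilon>. LpW11_norm p (ball 0 R) s T (\<lambda>x t. \<phi>\<epsilon> \<epsilon> t s x - \<phi> t s x)) \<longlongrightarrow> 0) (at_right 0)))
    \<and> (\<forall>r s' t. 0 \<le> r \<and> r \<le> s' \<and> s' \<le> t \<and> t \<le> T \<longrightarrow>
         (AE x in lebesgue. \<phi> t r x = \<phi> t s' (\<phi> s' r x)))"
proof (intro conjI allI impI)
  interpret lower_lipschitz_flow T b C\<^sub>0 C\<^sub>1 \<phi>
    using assms by unfold_locales
  have sT: "s \<in> {0..T}" using assms(9,10) by simp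
  show "(\<lambda>x t. \<phi> t s x) \<in> LpW11_loc p 0 T" by (rule flow_LpW11_loc[OF sT assms(8)])
  show "AE x in lebesgue. abs_continuous_on s T (\<lambda>t. \<phi> t s x) \<and>
         (\<forall>t\<in>{s..T}. set_integrable lebesgue {s..t} (\<lambda>r. b r (\<phi> r s x)) \<and>
            \<phi> t s x = x + (LINT r:{s..t}|lebesgue. b r (\<phi> r s x)))"
    by (rule forward_solution[OF sT])
  show "AE x in lebesgue. \<phi> t r x = \<phi> t s' (\<phi> s' r x)" if "0 \<le> r \<and> r \<le> s' \<and> s' \<le> t \<and> t \<le> T" for r s' t
    using that by (intro flow_composition) auto
  fix b\<epsilon> \<phi>\<epsilon> and R :: real
  assume reg: "admissible_regularization T b b\<epsilon> \<and> (\<forall>\<epsilon>>0. is_classical_flow T (b\<epsilon> \<epsilon>) (\<phi>\<epsilon> \<epsilon>))" and R: "0 < R"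
  then obtain K\<^sub>0 K\<^sub>1 where K: "nonneg_L1 T K\<^sub>0" "nonneg_L1 T K\<^sub>1"
    "\<forall>\<epsilon>>0. AE t in lebesgue_on {0..T}.
           linear_growth (K\<^sub>0 t) (b\<epsilon> \<epsilon> t) \<and> lower_one_sided_lipschitz (K\<^sub>1 t) (b\<epsilon> \<epsilon> t)"
    unfolding admissible_regularization_def by blast
  interpret regularized_flow T b C\<^sub>0 C\<^sub>1 \<phi> b\<epsilon> \<phi>\<epsilon> K\<^sub>0 K\<^sub>1 s
    using reg K assms(9,10) by unfold_locales (auto simp: admissible_regularization_def)
  show "(\<lambda>x t. \<phi>\<epsilon> \<epsilon> t s x - \<phi> t s x) \<in> LpW11 p (ball 0 R) s T" if "0 < \<epsilon>" for \<epsilon>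
    by (rule difference_LpW11[OF assms(8) R that])
  show "((\<lambda>\<epsilon>. LpW11_norm p (ball 0 R) s T (\<lambda>x t. \<phi>\<epsilon> \<epsilon> t s x - \<phi> t s x)) \<longlongrightarrow> 0) (at_right 0)"
    by (rule difference_tendsto[OF assms(8) R])
qed

end
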